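(* Let $S$ be a non-densely defined regular symmetric operator in $\mathcal H$ and let $\widetilde S$ be a maximal dissipative extension of $S$, $$\operatorname{dom}\widetilde S=\operatorname{dom}S\dot+(I-U)\mathfrak N_i,$$ where $U\in\mathbf B(\mathfrak N_i,\mathfrak N_{-i})$ is a contraction and $\ker\big((U-V_i)\upharpoonright\mathfrak L_i\big)=\{0\}$. Let $\widetilde S_0=P_{\mathcal H_0}\widetilde S\upharpoonright(\operatorname{dom}\widetilde S\cap\mathcal H_0)$ and $\widetilde S_{*0}=P_{\mathcal H_0}\widetilde S^*\upharpoonright(\operatorname{dom}\widetilde S^*\cap\mathcal H_0)$. Then: (1) the following equalities hold: $$\operatorname{dom}\widetilde S\cap\mathcal H_0=\operatorname{dom}S\dot+(I-U)\ker(P_{\mathfrak L_{-i}}U-V_iP_{\mathfrak L_i})=\operatorname{dom}S\dot+(I-P_{\mathfrak N'_{-i}}U)P_{\mathfrak N'_i}\ker(P_{\mathfrak L_{-i}}U-V_iP_{\mathfrak L_i}),$$ $$\operatorname{dom}\widetilde S^*\cap\mathcal H_0=\operatorname{dom}S\dot+(I-U^* )\ker(V_{-i}P_{\mathfrak L_{-i}}-P_{\mathfrak L_i}U^* )=\operatorname{dom}S\dot+(I-P_{\mathfrak N'_i}U^* )P_{\mathfrak N'_{-i}}\ker(V_{-i}P_{\mathfrak L_{-i}}-P_{\mathfrak L_i}U^* );$$ (2) the operators $U_0$ and $U_{*0}$ defined by $$U_0:P_{\mathfrak N'_i}\varphi\mapsto P_{\mathfrak N'_{-i}}U\varphi,\quad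 \varphi\in\ker(P_{\mathfrak L_{-i}}U-V_iP_{\mathfrak L_i}),$$ $$U_{*0}:P_{\mathfrak N'_{-i}}\psi\mapsto P_{\mathfrak N'_i}U^*\psi,\quad \psi\in\ker(P_{\mathfrak L_i}U^*-V_{-i}P_{\mathfrak L_{-i}}),$$ are contractions and the following are valid: $$\operatorname{dom}\widetilde S_0=\operatorname{dom}S\dot+(I-U_0)\operatorname{dom}U_0,\quad \widetilde S_0(f_S+(I-U_0)\varphi'_i)=S_0f_S+i(I+U_0)\varphi'_i,\quad f_S\in\operatorname{dom}S,\ \varphi'_i\in\operatorname{dom}U_0,$$ $$\operatorname{dom}\widetilde S_{*0}=\operatorname{dom}S\dot+(I-U_{*0})\operatorname{dom}U_{*0},\quad \widetilde S_{*0}(g_S+(I-U_{*0})\varphi'_{-i})=S_0g_S-i(I+U_{*0})\varphi'_{-i},\quad g_S\in\operatorname{dom}S,\ \varphi'_{-i}\in\operatorname{dom}U_{*0},$$ $$(U_0\varphi_i,\psi_{-i})=(\varphi_i,U_{*0}\psi_{-i})\quad\forall\varphi_i\in\operatorname{dom}U_0,\ \forall\psi_{-i}\in\operatorname{dom}U_{*0};$$ (3) the following are equivalent: (i) $\operatorname{dom}\widetilde S\cap\mathcal H_0=\operatorname{dom}S$; (ii) $\ker(P_{\mathfrak L_{-i}}U-V_iP_{\mathfrak L_i})=\{0\}$; (iii) $P_{\mathfrak N'_i}\ker(P_{\mathfrak L_{-i}}U-V_iP_{\mathfrak L_i})=\{0\}$; (4) the following are equivalent: (a) $\operatorname{dom}\widetilde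 S^*\cap\mathcal H_0=\operatorname{dom}S$; (b) $\ker(V_{-i}P_{\mathfrak L_{-i}}-P_{\mathfrak L_i}U^* )=\{0\}$; (c) $P_{\mathfrak N'_{-i}}\ker(V_{-i}P_{\mathfrak L_{-i}}-P_{\mathfrak L_i}U^* )=\{0\}$; in particular, if one of the semi-deficiency subspaces is trivial, then $\operatorname{dom}\widetilde S\cap\mathcal H_0=\operatorname{dom}S$ and the operator $\widetilde S_0=P_{\mathcal H_0}\widetilde S\upharpoonright(\operatorname{dom}\widetilde S\cap\mathcal H_0)$ is maximal symmetric; (5) the following are equivalent: (i) the operator $\widetilde S_0$ is maximal dissipative in $\mathcal H_0$; (ii) $P_{\mathfrak N'_i}\ker(P_{\mathfrak L_{-i}}U-V_iP_{\mathfrak L_i})=\mathfrak N'_i$; (6) the following are equivalent: (i) the operator $-\widetilde S_{*0}$ is maximal dissipative in $\mathcal H_0$; (ii) $P_{\mathfrak N'_{-i}}\ker(V_{-i}P_{\mathfrak L_{-i}}-P_{\mathfrak L_i}U^* )=\mathfrak N'_{-i}$; (7) the following are equivalent: (i) $\widetilde S_{*0}=(\widetilde S_0)^*$; (ii) $P_{\mathfrak N'_i}\ker(P_{\mathfrak L_{-i}}U-V_iP_{\mathfrak L_i})=\mathfrak N'_i$ and $P_{\mathfrak N'_{-i}}\ker(V_{-i}P_{\mathfrak L_{-i}}-P_{\mathfrak L_i}U^* )=\mathfrak N'_{-i}$; (8) if $\operatorname{codim}\mathcal H_0<\infty$, then $\widetilde S_{*0}=(\widetilde S_0)^*$.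
   Context: $\mathcal H$ is an infinite-dimensional complex separable Hilbert space; "subspace" means closed linear manifold; $P_{\mathfrak K}$ is the orthogonal projection onto $\mathfrak K$; $\dot+$ is the direct sum of linear manifolds; $\mathbf B(H_1,H_2)$ is the space of bounded operators. $S$ is symmetric if $\operatorname{Im}(Sf,f)=0$ on $\operatorname{dom}S$; $T$ is dissipative if $\operatorname{Im}(Tf,f)\ge0$ on $\operatorname{dom}T$, and maximal dissipative if it is dissipative and has no proper dissipative extension in the same space. For a closed non-densely defined symmetric $S$: $\mathcal H_0=\overline{\operatorname{dom}}\,S$, $\mathfrak L=\mathcal H\ominus\mathcal H_0$, $\operatorname{codim}\mathcal H_0=\dim\mathfrak L$, $S_0=P_{\mathcal H_0}S$ (an operator in $\mathcal H_0$ with domain $\operatorname{dom}S$); for $\lambda\in\mathbb C\setminus\mathbb R$, $\mathfrak N_\lambda=\mathcal H\ominus\operatorname{ran}(S-\bar\lambda I)$, $\mathfrak L_\lambda=P_{\mathfrak N_\lambda}\mathfrak L$, $\mathfrak N'_\lambda=\mathfrak N_\lambda\ominus\mathfrak L_\lambda\subset\mathcal H_0$ (semi-deficiency subspaces); $V_\lambda:\mathfrak L_\lambda\to\mathfrak L_{\bar\lambda}$ is the isometry $V_\lambda P_{\mathfrak N_\lambda}h=P_{\mathfrak N_{\bar\lambda}}h$, $h\in\mathfrak L$ ($V_{-i}=V_i^{-1}$). A closed symmetric $S$ is regular if $S_0$ is closed (then all $\mathfrak L_\lambda$ are closed). The extension $\widetilde S$ acts by $\widetilde S(f_S+(I-U)\varphi_i)=Sf_S+i(I+U)\varphi_i$,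 $f_S\in\operatorname{dom}S$, $\varphi_i\in\mathfrak N_i$; its adjoint has $\operatorname{dom}\widetilde S^*=\operatorname{dom}S\dot+(I-U^* )\mathfrak N_{-i}$, $\widetilde S^*(f_S+(I-U^* )\varphi_{-i})=Sf_S-i(I+U^* )\varphi_{-i}$. The adjoint $(\widetilde S_0)^*$ is taken in $\mathcal H_0$.
   Formalization: In (1) the last sets are read as {P_{N'_i}φ − P_{N'_{-i}}Uφ : φ in the kernel}, likewise for U*; in (4) trivial N'_{-i} gives the claim for S̃*, S̃_{*0} instead; in (7), (i)⇒(ii) is stated for closed S̃_0, or with P_{N'_i}ker replaced by its closure. *)

theory Defs
  imports "HOL-Analysis.Analysis"
begin

section \<open>Complex Hilbert spaces\<close>

text \<open>The inner product is linear in its first argument; the sign conventions for dissipativity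
  depend on this.  The axiom \<open>cinner_self\<close> gives positive definiteness through the norm.\<close>

class complex_hilbert = banach +
  fixes scaleC :: "complex \<Rightarrow> 'a \<Rightarrow> 'a"  (infixr \<open>*\<^sub>C\<close> 75)
    and cinner :: "'a \<Rightarrow> 'a \<Rightarrow> complex"
  assumes scaleC_of_real: "scaleC (complex_of_real r) x = scaleR r x"
    and scaleC_add_right: "scaleC a (x + y) = scaleC a x + scaleC a y"
    and scaleC_add_left: "scaleC (a + b) x = scaleC a x + scaleC b x"
    and scaleC_scaleC: "scaleC a (scaleC b x) = scaleC (a * b) x"
    and cinner_commute: "cinner x y = cnj (cinner y x)"
    and cinner_add_left: "cinner (x + y) z = cinner x z + cinner y z"
    and cinner_scaleC_left: "cinner (scaleC a x) y = a * cinner x y"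
    and cinner_self: "cinner x x = complex_of_real ((norm x)\<^sup>2)"

definition finite_dim :: "'a::complex_hilbert set \<Rightarrow> bool" where
  "finite_dim A \<longleftrightarrow> (\<exists>B. finite B \<and> A \<subseteq> module.span scaleC B)"

definition orth :: "'a::complex_hilbert set \<Rightarrow> 'a set" where
  "orth A = {x. \<forall>y\<in>A. cinner x y = 0}"

text \<open>Orthogonal projection; meaningful when \<open>K\<close> is a closed complex subspace.\<close>

definition proj :: "'a::complex_hilbert set \<Rightarrow> 'a \<Rightarrow> 'a" where
  "proj K x = (THE y. y \<in> K \<and> (\<forall>z\<in>K. cinner (x - y) z = 0))"

definition is_direct_sum :: "'a::complex_hilbert set \<Rightarrow> 'a set \<Rightarrow> 'a set \<Rightarrow> bool" where
  "is_direct_sum D A B \<longleftrightarrow> D = {a + b | a b. a \<in> A \<and> b \<in> B} \<and> A \<inter> B = {0}"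


section \<open>Unbounded operators\<close>

text \<open>A (not necessarily everywhere defined) operator is identified with its graph, a set of
  pairs \<open>(f, Tf)\<close>.  Its domain is \<^const>\<open>Domain\<close>, extension is \<open>\<subseteq>\<close>, equality of operators is
  equality of graphs, and \<open>T\<close> is closed if \<open>closed T\<close> holds in the product topology.\<close>

definition operator_in :: "'a::complex_hilbert set \<Rightarrow> ('a \<times> 'a) set \<Rightarrow> bool" where
  "operator_in K T \<longleftrightarrow>
     T \<subseteq> K \<times> K \<and> single_valued T \<and> (0, 0) \<in> T \<and>
     (\<forall>(f, g)\<in>T. \<forall>(f', g')\<in>T. (f + f', g + g') \<in> T) \<and>
     (\<forall>c. \<forall>(f, g)\<in>T. (c *\<^sub>C f, c *\<^sub>C g) \<in> T)"

definition symmetric_in :: "'a::complex_hilbert set \<Rightarrow> ('a \<times> 'a) set \<Rightarrow> bool" where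
  "symmetric_in K T \<longleftrightarrow> operator_in K T \<and> (\<forall>(f, g)\<in>T. Im (cinner g f) = 0)"

definition dissipative_in :: "'a::complex_hilbert set \<Rightarrow> ('a \<times> 'a) set \<Rightarrow> bool" where
  "dissipative_in K T \<longleftrightarrow> operator_in K T \<and> (\<forall>(f, g)\<in>T. Im (cinner g f) \<ge> 0)"

definition maximal_symmetric_in :: "'a::complex_hilbert set \<Rightarrow> ('a \<times> 'a) set \<Rightarrow> bool" where
  "maximal_symmetric_in K T \<longleftrightarrow>
     symmetric_in K T \<and> (\<forall>T'. symmetric_in K T' \<and> T \<subseteq> T' \<longrightarrow> T' = T)"

definition maximal_dissipative_in :: "'a::complex_hilbert set \<Rightarrow> ('a \<times> 'a) set \<Rightarrow> bool" where
  "maximal_dissipative_in K T \<longleftrightarrow>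
     dissipative_in K T \<and> (\<forall>T'. dissipative_in K T' \<and> T \<subseteq> T' \<longrightarrow> T' = T)"

definition op_neg :: "('a::complex_hilbert \<times> 'a) set \<Rightarrow> ('a \<times> 'a) set" where
  "op_neg T = {(f, - g) | f g. (f, g) \<in> T}"

text \<open>Adjoint in the Hilbert space \<open>K\<close>; it is the graph of an operator if the domain of \<open>T\<close> is
  dense in \<open>K\<close>.\<close>

definition adjoint_in :: "'a::complex_hilbert set \<Rightarrow> ('a \<times> 'a) set \<Rightarrow> ('a \<times> 'a) set" where
  "adjoint_in K T = {(g, h). g \<in> K \<and> h \<in> K \<and> (\<forall>(f, k)\<in>T. cinner k g = cinner f h)}"

text \<open>The compression \<open>P\<^sub>K T\<restriction>(dom T \<inter> K)\<close>.\<close>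

definition compression :: "'a::complex_hilbert set \<Rightarrow> ('a \<times> 'a) set \<Rightarrow> ('a \<times> 'a) set" where
  "compression K T = {(f, proj K g) | f g. (f, g) \<in> T \<and> f \<in> K}"

text \<open>Contractive linear operators with domain in \<open>M\<close> and values in \<open>N\<close>, as graphs.\<close>

definition contraction_graph ::
    "'a::complex_hilbert set \<Rightarrow> 'a set \<Rightarrow> ('a \<times> 'a) set \<Rightarrow> bool" where
  "contraction_graph M N T \<longleftrightarrow>
     operator_in UNIV T \<and> T \<subseteq> M \<times> N \<and> (\<forall>(x, y)\<in>T. norm y \<le> norm x)"

text \<open>Everywhere defined contractions \<open>M \<rightarrow> N\<close> are ordinary functions, of which only the values
  on \<open>M\<close> matter; likewise for the adjoint \<open>N \<rightarrow> M\<close>.\<close>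

definition contraction_on ::
    "'a::complex_hilbert set \<Rightarrow> 'a set \<Rightarrow> ('a \<Rightarrow> 'a) \<Rightarrow> bool" where
  "contraction_on M N U \<longleftrightarrow>
     (\<forall>x\<in>M. U x \<in> N \<and> norm (U x) \<le> norm x) \<and>
     (\<forall>x\<in>M. \<forall>y\<in>M. U (x + y) = U x + U y) \<and>
     (\<forall>c. \<forall>x\<in>M. U (c *\<^sub>C x) = c *\<^sub>C U x)"

definition adjoint_on :: "'a::complex_hilbert set \<Rightarrow> ('a \<Rightarrow> 'a) \<Rightarrow> 'a \<Rightarrow> 'a" where
  "adjoint_on M U y = (THE z. z \<in> M \<and> (\<forall>x\<in>M. cinner (U x) y = cinner x z))"


section \<open>Non-densely defined symmetric operators\<close>

text \<open>\<open>\<H>\<^sub>0\<close>, \<open>\<LL>\<close>, \<open>S\<^sub>0\<close>, \<open>\<NN>\<^sub>\<lambda>\<close>, \<open>\<LL>\<^sub>\<lambda>\<close>, \<open>\<NN>'\<^sub>\<lambda>\<close> and \<open>V\<^sub>\<lambda>\<close>, in this order.\<close>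

definition dom_space :: "('a::complex_hilbert \<times> 'a) set \<Rightarrow> 'a set" where
  "dom_space S = closure (Domain S)"

definition codom_space :: "('a::complex_hilbert \<times> 'a) set \<Rightarrow> 'a set" where
  "codom_space S = orth (dom_space S)"

definition core_op :: "('a::complex_hilbert \<times> 'a) set \<Rightarrow> ('a \<times> 'a) set" where
  "core_op S = {(f, proj (dom_space S) g) | f g. (f, g) \<in> S}"

definition defect :: "('a::complex_hilbert \<times> 'a) set \<Rightarrow> complex \<Rightarrow> 'a set" where
  "defect S z = orth {g - cnj z *\<^sub>C f | f g. (f, g) \<in> S}"

definition Lpart :: "('a::complex_hilbert \<times> 'a) set \<Rightarrow> complex \<Rightarrow> 'a set" where
  "Lpart S z = proj (defect S z) ` codom_space S"

definition semidefect :: "('a::complex_hilbert \<times> 'a) set \<Rightarrow> complex \<Rightarrow> 'a set" where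
  "semidefect S z = defect S z \<inter> orth (Lpart S z)"

definition Viso :: "('a::complex_hilbert \<times> 'a) set \<Rightarrow> complex \<Rightarrow> 'a \<Rightarrow> 'a" where
  "Viso S z x =
     (THE y. \<exists>h\<in>codom_space S. x = proj (defect S z) h \<and> y = proj (defect S (cnj z)) h)"

definition regular_symmetric :: "('a::complex_hilbert \<times> 'a) set \<Rightarrow> bool" where
  "regular_symmetric S \<longleftrightarrow> symmetric_in UNIV S \<and> closed S \<and> closed (core_op S)"


section \<open>Objects attached to the parameter \<open>U\<close>\<close>

text \<open>In the following, \<open>U : \<NN>\<^sub>i \<rightarrow> \<NN>\<^sub>-\<^sub>i\<close>.\<close>

abbreviation Uadj ::
    "('a::complex_hilbert \<times> 'a) set \<Rightarrow> ('a \<Rightarrow> 'a) \<Rightarrow> 'a \<Rightarrow> 'a" where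
  "Uadj S U \<equiv> adjoint_on (defect S \<i>) U"

definition kerU :: "('a::complex_hilbert \<times> 'a) set \<Rightarrow> ('a \<Rightarrow> 'a) \<Rightarrow> 'a set" where
  "kerU S U = {\<phi> \<in> defect S \<i>.
     proj (Lpart S (- \<i>)) (U \<phi>) - Viso S \<i> (proj (Lpart S \<i>) \<phi>) = 0}"

definition kerU_adj :: "('a::complex_hilbert \<times> 'a) set \<Rightarrow> ('a \<Rightarrow> 'a) \<Rightarrow> 'a set" where
  "kerU_adj S U = {\<psi> \<in> defect S (- \<i>).
     Viso S (- \<i>) (proj (Lpart S (- \<i>)) \<psi>) - proj (Lpart S \<i>) (Uadj S U \<psi>) = 0}"

text \<open>The graphs of \<open>U\<^sub>0\<close> and \<open>U\<^sub>*\<^sub>0\<close>.\<close>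

definition U0 :: "('a::complex_hilbert \<times> 'a) set \<Rightarrow> ('a \<Rightarrow> 'a) \<Rightarrow> ('a \<times> 'a) set" where
  "U0 S U = {(proj (semidefect S \<i>) \<phi>, proj (semidefect S (- \<i>)) (U \<phi>)) | \<phi>. \<phi> \<in> kerU S U}"

definition Us0 :: "('a::complex_hilbert \<times> 'a) set \<Rightarrow> ('a \<Rightarrow> 'a) \<Rightarrow> ('a \<times> 'a) set" where
  "Us0 S U = {(proj (semidefect S (- \<i>)) \<psi>, proj (semidefect S \<i>) (Uadj S U \<psi>)) | \<psi>.
     \<psi> \<in> kerU_adj S U}"

end

theory Submission
  imports Defs
begin

text \<open>A vector \<open>\<phi>\<close> of \<open>\<NN>\<^sub>i\<close> lies in \<open>ker (P U - V\<^sub>i P)\<close> exactly when \<open>\<phi> - U \<phi>\<close> lies in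
  \<open>\<H>\<^sub>0\<close>, and \<open>(I - V\<^sub>i) \<LL>\<^sub>i\<close> is contained in the domain of \<open>S\<close>.  Hence the compression of the
  extension with parameter \<open>U\<close> is the von Neumann extension of \<open>S\<^sub>0\<close> with parameter \<open>U\<^sub>0\<close>, which acts
  between the deficiency subspaces \<open>\<NN>'\<^sub>i\<close> and \<open>\<NN>'\<^sub>-\<^sub>i\<close> of the densely defined operator \<open>S\<^sub>0\<close>.
  Maximality and adjoints of such extensions are read off from the domains of their parameters:
  a partially defined contraction always extends to the whole deficiency subspace.  The statements
  about the adjoint are those for \<open>-S\<close> with the parameter \<open>U*\<close>, since passing to \<open>-S\<close> exchanges
  \<open>\<NN>\<^sub>i\<close> and \<open>\<NN>\<^sub>-\<^sub>i\<close>.\<close>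

subsection \<open>Complex Hilbert spaces\<close>

text \<open>The kernel criterion is a pairing with h in \<open>codom_space S\<close>: \<phi> meets h
  only through its component in \<open>Lpart S \<i>\<close> and the projection of h, and the
  isometry \<open>Viso\<close> moves this pairing to \<open>Lpart S (- \<i>)\<close>, where it can
  be compared with that of \<open>U \<phi>\<close>. The inclusion in the domain of \<open>S\<close>
  holds because one pair (f, g) of \<open>S\<close> yields both projections of h, as h - g - \<i> f
  and h - g + \<i> f. Regularity acts through closed ranges: those of S0 + \<i> and S0 - \<i> give
  orthogonal decompositions of the space H0 and make the sets \<open>Lpart\<close> closed. Maximal
  dissipativity forces the domain to be the whole semi-deficiency subspace. An adjoint, however,
  depends only on the closure of an operator, so the adjoint identity yields density for the domain
  of \<open>U0\<close>, but the full subspace for that of \<open>Us0\<close>. Equality on the first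
  side returns once the compression is closed.\<close>

interpretation cvs: vector_space "scaleC :: complex \<Rightarrow> 'a::complex_hilbert \<Rightarrow> 'a"
proof
  fix x :: 'a
  show "1 *\<^sub>C x = x" using scaleC_of_real[of 1 x] by simp
qed (simp_all add: scaleC_add_right scaleC_add_left scaleC_scaleC)

lemma cinner_add_right: "cinner x (y + z) = cinner x y + cinner x z"
  by (metis cinner_add_left cinner_commute complex_cnj_add)

lemma cinner_scaleC_right: "cinner x (c *\<^sub>C y) = cnj c * cinner x y"
  by (metis cinner_scaleC_left cinner_commute complex_cnj_mult)

lemma cinner_zero [simp]: "cinner 0 x = 0" "cinner x 0 = 0"
  using cinner_scaleC_left[of 0 0 x] cinner_scaleC_right[of x 0 0] by simp_all

lemma cinner_minus [simp]: "cinner (- x) y = - cinner x y" "cinner x (- y) = - cinner x y"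
  using cinner_add_left[of x "- x" y] cinner_add_right[of x y "- y"]
  by (simp_all add: eq_neg_iff_add_eq_0 add.commute)

lemma cinner_diff_left: "cinner (x - y) z = cinner x z - cinner y z"
  using cinner_add_left[of x "- y" z] by simp

lemma cinner_diff_right: "cinner x (y - z) = cinner x y - cinner x z"
  using cinner_add_right[of x y "- z"] by simp

lemmas cinner_simps = cinner_add_left cinner_add_right cinner_diff_left cinner_diff_right
  cinner_scaleC_left cinner_scaleC_right

lemma cinner_self_eq_0 [simp]: "cinner x x = 0 \<longleftrightarrow> x = 0"
  by (simp add: cinner_self)

lemma power2_norm_cinner: "(norm x)\<^sup>2 = Re (cinner x x)"
  by (simp add: cinner_self)

lemma Re_cinner_commute: "Re (cinner x y) = Re (cinner y x)"
  by (metis cinner_commute cnj.sel(1))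

lemma Im_cinner_commute: "Im (cinner x y) = - Im (cinner y x)"
  by (metis cinner_commute cnj.sel(2))

lemma norm_scaleC [simp]: "norm (c *\<^sub>C x) = cmod c * norm x"
proof -
  have "complex_of_real ((norm (c *\<^sub>C x))\<^sup>2) = c * cnj c * cinner x x"
    unfolding cinner_self[symmetric] cinner_scaleC_left cinner_scaleC_right by simp
  also have "\<dots> = complex_of_real ((cmod c * norm x)\<^sup>2)"
    by (simp add: complex_norm_square[symmetric] cinner_self power_mult_distrib)
  finally have "(norm (c *\<^sub>C x))\<^sup>2 = (cmod c * norm x)\<^sup>2"
    unfolding of_real_eq_iff .
  then show ?thesis by (simp add: power2_eq_iff_nonneg)
qed

lemma power2_norm_add: "(norm (x + y))\<^sup>2 = (norm x)\<^sup>2 + (norm y)\<^sup>2 + 2 * Re (cinner x y)"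
  using Re_cinner_commute[of x y] by (simp add: power2_norm_cinner cinner_simps)

lemma power2_norm_diff: "(norm (x - y))\<^sup>2 = (norm x)\<^sup>2 + (norm y)\<^sup>2 - 2 * Re (cinner x y)"
  using power2_norm_add[of x "- y"] by simp

lemma pythagoras: "cinner x y = 0 \<Longrightarrow> (norm (x + y))\<^sup>2 = (norm x)\<^sup>2 + (norm y)\<^sup>2"
  by (simp add: power2_norm_add)

text \<open>The subtracted vector is the projection of x onto the line of z. Nonnegativity of the
  left side is Cauchy-Schwarz; the drop in norm shows that a nearest point leaves an orthogonal
  remainder.\<close>

lemma power2_norm_diff_component:
  assumes "z \<noteq> 0"
  shows "(norm (x - (cinner x z / (norm z)\<^sup>2) *\<^sub>C z))\<^sup>2 = (norm x)\<^sup>2 - (cmod (cinner x z) / norm z)\<^sup>2"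
proof -
  have "cinner x ((cinner x z / (norm z)\<^sup>2) *\<^sub>C z) = complex_of_real ((cmod (cinner x z) / norm z)\<^sup>2)"
    unfolding cinner_scaleC_right power_divide of_real_divide complex_norm_square by simp
  then have "Re (cinner x ((cinner x z / (norm z)\<^sup>2) *\<^sub>C z)) = (cmod (cinner x z) / norm z)\<^sup>2"
    by simp
  moreover have "norm ((cinner x z / (norm z)\<^sup>2) *\<^sub>C z) = cmod (cinner x z) / norm z"
    using assms by (simp add: norm_divide norm_mult power2_eq_square)
  ultimately show ?thesis by (simp add: power2_norm_diff)
qed

lemma cmod_cinner_le: "cmod (cinner x y) \<le> norm x * norm y"
proof (cases "y = 0")
  case False
  have "(cmod (cinner x y) / norm y)\<^sup>2 \<le> (norm x)\<^sup>2"
    using power2_norm_diff_component[OF False, of x] zero_le_power2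
    by (smt (verit))
  then have "cmod (cinner x y) / norm y \<le> norm x"
    by (rule power2_le_imp_le) simp
  with False show ?thesis by (simp add: divide_le_eq)
qed simp

lemma scaleR_conv_scaleC: "r *\<^sub>R x = complex_of_real r *\<^sub>C x"
  by (simp add: scaleC_of_real)

lemma bounded_bilinear_cinner: "bounded_bilinear cinner"
proof
  show "\<exists>K. \<forall>a b. norm (cinner a b) \<le> norm a * norm b * K"
    by (rule exI[of _ 1]) (simp add: cmod_cinner_le)
qed (simp_all add: cinner_simps scaleR_conv_scaleC scaleR_conv_of_real)

lemma bounded_linear_scaleC: "bounded_linear (scaleC c)"
  by (rule bounded_linear_intro[where K = "cmod c"])
     (simp_all add: scaleC_add_right scaleR_conv_scaleC scaleC_scaleC mult.commute)

lemmas tendsto_cinner [tendsto_intros] = bounded_bilinear.tendsto[OF bounded_bilinear_cinner]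
lemmas tendsto_scaleC [tendsto_intros] = bounded_linear.tendsto[OF bounded_linear_scaleC]

lemma orth_subspace: "cvs.subspace (orth A)"
  by (auto simp: cvs.subspace_def orth_def cinner_simps)

lemma closed_orth: "closed (orth A)"
proof (unfold closed_sequential_limits, safe)
  fix x l assume x: "\<forall>n. x n \<in> orth A" "x \<longlonglongrightarrow> l"
  show "l \<in> orth A"
    unfolding orth_def
  proof safe
    fix y assume "y \<in> A"
    then have "\<And>n. cinner (x n) y = 0" using x(1) by (auto simp: orth_def)
    moreover have "(\<lambda>n. cinner (x n) y) \<longlonglongrightarrow> cinner l y"
      by (intro tendsto_intros x)
    ultimately show "cinner l y = 0"
      by (simp add: LIMSEQ_const_iff)
  qed
qed

lemma orthD: "x \<in> orth A \<Longrightarrow> y \<in> A \<Longrightarrow> cinner x y = 0"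
  by (simp add: orth_def)

lemma orthD': "x \<in> orth A \<Longrightarrow> y \<in> A \<Longrightarrow> cinner y x = 0"
  by (metis orthD cinner_commute complex_cnj_zero)

lemma orth_iff': "x \<in> orth A \<longleftrightarrow> (\<forall>y\<in>A. cinner y x = 0)"
proof -
  have "cinner x y = 0 \<longleftrightarrow> cinner y x = 0" for y
    using cinner_commute[of x y] by simp
  then show ?thesis by (simp add: orth_def)
qed

lemma orth_closure: "orth (closure A) = orth A"
proof
  show "orth A \<subseteq> orth (closure A)"
  proof
    fix x assume "x \<in> orth A"
    \<comment> \<open>Orthogonality is symmetric, and the closed set \<open>orth {x}\<close>
      contains the closure of \<open>A\<close> as soon as it contains \<open>A\<close>.\<close>
    then have "A \<subseteq> orth {x}" unfolding orth_iff' by (auto simp: orth_def)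
    then have "closure A \<subseteq> orth {x}" by (simp add: closed_orth closure_minimal)
    then show "x \<in> orth (closure A)" unfolding orth_iff' by (auto simp: orth_def)
  qed
qed (use closure_subset in \<open>auto simp: orth_def\<close>)

subsection \<open>Orthogonal projections\<close>

lemma ex_projection:
  assumes "cvs.subspace K" "closed K"
  shows "\<exists>y\<in>K. \<forall>z\<in>K. cinner (x - y) z = 0"
proof -
  define d where "d = (INF y\<in>K. (norm (x - y))\<^sup>2)"
  have bdd: "bdd_below ((\<lambda>y. (norm (x - y))\<^sup>2) ` K)"
    by (rule bdd_belowI[of _ 0]) auto
  have ne: "K \<noteq> {}" using assms(1) cvs.subspace_0 by blast
  have d_le: "d \<le> (norm (x - y))\<^sup>2" if "y \<in> K" for y
    unfolding d_def by (rule cINF_lower[OF bdd that])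
  have "\<exists>y\<in>K. (norm (x - y))\<^sup>2 < d + 1 / Suc n" for n
    using cINF_less_iff[OF ne bdd, of "d + 1 / Suc n"] by (simp add: d_def)
  then obtain y where y: "\<And>n. y n \<in> K" "\<And>n. (norm (x - y n))\<^sup>2 < d + 1 / Suc n"
    by metis
  \<comment> \<open>The midpoint of \<open>y m\<close> and \<open>y n\<close> lies in
    \<open>K\<close>, which bounds the norm of a + b from below; the parallelogram law turns this
    into an upper bound for a - b.\<close>
  have par: "(norm (y m - y n))\<^sup>2 \<le> 2 / Suc m + 2 / Suc n" for m n
  proof -
    define a where "a = x - y m"
    define b where "b = x - y n"
    have "(1 / 2 :: complex) *\<^sub>C (y m + y n) \<in> K"
      using y(1) assms(1) by (simp add: cvs.subspace_add cvs.subspace_scale)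
    then have "d \<le> (norm (x - (1 / 2 :: complex) *\<^sub>C (y m + y n)))\<^sup>2" by (rule d_le)
    also have "x - (1 / 2 :: complex) *\<^sub>C (y m + y n) = (1 / 2 :: complex) *\<^sub>C (a + b)"
    proof -
      have "(1 / 2 :: complex) *\<^sub>C (x + x) = (1 / 2 + 1 / 2 :: complex) *\<^sub>C x"
        by (simp only: scaleC_add_right scaleC_add_left)
      then have "x = (1 / 2 :: complex) *\<^sub>C (x + x)" by simp
      then show ?thesis
        by (simp only: a_def b_def cvs.scale_right_distrib cvs.scale_right_diff_distrib)
           (metis add_diff_add)
    qed
    finally have "4 * d \<le> (norm (a + b))\<^sup>2" by (simp add: power_mult_distrib power_divide)
    moreover have "(norm (a + b))\<^sup>2 + (norm (a - b))\<^sup>2 = 2 * (norm a)\<^sup>2 + 2 * (norm b)\<^sup>2"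
      by (simp add: power2_norm_add power2_norm_diff)
    moreover have "norm (a - b) = norm (y m - y n)" by (simp add: a_def b_def norm_minus_commute)
    ultimately show ?thesis using y(2)[of m] y(2)[of n] by (simp add: a_def b_def)
  qed
  have "Cauchy y"
  proof (rule CauchyI)
    fix e :: real assume "e > 0"
    then obtain N where N: "4 / e\<^sup>2 < real N" using reals_Archimedean2 by blast
    show "\<exists>M. \<forall>m\<ge>M. \<forall>n\<ge>M. norm (y m - y n) < e"
    proof (intro exI allI impI)
      fix m n assume mn: "N \<le> m" "N \<le> n"
      have *: "2 / Suc k < e\<^sup>2 / 2" if "N \<le> k" for k
      proof -
        have "4 / e\<^sup>2 < Suc k" using N that by simp
        then show ?thesis using \<open>e > 0\<close> by (simp add: field_simps)
      qed
      have "(norm (y m - y n))\<^sup>2 < e\<^sup>2" using par[of m n] *[OF mn(1)] *[OF mn(2)] by linarith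
      then show "norm (y m - y n) < e" using \<open>e > 0\<close> by (simp add: power_less_imp_less_base)
    qed
  qed
  then obtain l where l: "y \<longlonglongrightarrow> l" by (auto simp: Cauchy_convergent_iff convergent_def)
  have "l \<in> K" using assms(2) y(1) l closed_sequentially by blast
  have "(\<lambda>n. (norm (x - y n))\<^sup>2) \<longlonglongrightarrow> (norm (x - l))\<^sup>2" by (intro tendsto_intros l)
  moreover have "(\<lambda>n. d + 1 / Suc n) \<longlonglongrightarrow> d + 0"
    by (intro tendsto_intros LIMSEQ_Suc[OF lim_1_over_n])
  ultimately have le: "(norm (x - l))\<^sup>2 \<le> d"
    using y(2) by (intro LIMSEQ_le[of _ _ "\<lambda>n. d + 1 / Suc n"]) (auto intro: less_imp_le)
  have "cinner (x - l) z = 0" if "z \<in> K" for z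
  proof (cases "z = 0")
    case False
    \<comment> \<open>If the remainder had a component along z, moving \<open>l\<close> by that
      component would bring the distance below the infimum.\<close>
    define c where "c = cinner (x - l) z / (norm z)\<^sup>2"
    have "l + c *\<^sub>C z \<in> K" using \<open>l \<in> K\<close> that assms(1) by (simp add: cvs.subspace_add cvs.subspace_scale)
    then have "(norm (x - l))\<^sup>2 \<le> (norm (x - (l + c *\<^sub>C z)))\<^sup>2"
      using d_le le order_trans by blast
    also have "x - (l + c *\<^sub>C z) = x - l - c *\<^sub>C z" by (rule diff_diff_eq[symmetric])
    also have "(norm \<dots>)\<^sup>2 = (norm (x - l))\<^sup>2 - (cmod (cinner (x - l) z) / norm z)\<^sup>2"
      unfolding c_def by (rule power2_norm_diff_component[OF False])
    finally show ?thesis using False by (simp add: power_divide divide_le_0_iff)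
  qed simp
  with \<open>l \<in> K\<close> show ?thesis by blast
qed

lemma proj_eqI:
  assumes "cvs.subspace K" "y \<in> K" "x - y \<in> orth K"
  shows "proj K x = y"
  unfolding proj_def
proof (rule the_equality)
  show "y \<in> K \<and> (\<forall>z\<in>K. cinner (x - y) z = 0)" using assms(2,3) by (auto simp: orth_def)
  fix y' assume y': "y' \<in> K \<and> (\<forall>z\<in>K. cinner (x - y') z = 0)"
  then have "y' - y \<in> K" using assms(1,2) by (simp add: cvs.subspace_diff)
  then have "cinner (x - y) (y' - y) = 0" "cinner (x - y') (y' - y) = 0"
    using y' assms(3) by (auto simp: orth_def)
  then have "cinner (y' - y) (y' - y) = 0" by (simp add: cinner_diff_left)
  then show "y' = y" by simp
qed

locale closed_csubspace =
  fixes K :: "'a::complex_hilbert set"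
  assumes subspace: "cvs.subspace K" and closed: "closed K"
begin

lemma proj_props: "proj K x \<in> K \<and> x - proj K x \<in> orth K"
proof -
  obtain y where "y \<in> K" "\<forall>z\<in>K. cinner (x - y) z = 0"
    using ex_projection[OF subspace closed] by blast
  then show ?thesis using proj_eqI[OF subspace, of y x] by (auto simp: orth_def)
qed

lemma proj_in [simp, intro]: "proj K x \<in> K"
  and proj_orth [simp, intro]: "x - proj K x \<in> orth K"
  using proj_props by auto

lemma proj_id: "x \<in> K \<Longrightarrow> proj K x = x"
  by (rule proj_eqI[OF subspace]) (auto simp: orth_def)

lemma proj_add: "proj K (x + y) = proj K x + proj K y"
proof (rule proj_eqI[OF subspace])
  have "x + y - (proj K x + proj K y) = (x - proj K x) + (y - proj K y)" by simp
  then show "x + y - (proj K x + proj K y) \<in> orth K"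
    using cvs.subspace_add[OF orth_subspace proj_orth proj_orth] by metis
qed (simp add: subspace cvs.subspace_add)

lemma proj_scale: "proj K (c *\<^sub>C x) = c *\<^sub>C proj K x"
  using cvs.subspace_scale[OF orth_subspace proj_orth[of x], of c]
  by (intro proj_eqI[OF subspace])
     (simp_all add: subspace cvs.subspace_scale cvs.scale_right_diff_distrib)

lemma proj_0_iff: "proj K x = 0 \<longleftrightarrow> x \<in> orth K"
  using proj_props[of x] proj_eqI[OF subspace cvs.subspace_0[OF subspace], of x]
  by (metis diff_zero)

lemma proj_zero [simp]: "proj K 0 = 0"
  by (simp add: proj_id subspace cvs.subspace_0)

lemma proj_diff: "proj K (x - y) = proj K x - proj K y"
  using proj_add[of "x - y" y] by simp

lemma cinner_proj_left: "y \<in> K \<Longrightarrow> cinner (proj K x) y = cinner x y"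
  using orthD[OF proj_orth[of x], of y] by (simp add: cinner_diff_left)

lemma cinner_proj_right: "y \<in> K \<Longrightarrow> cinner y (proj K x) = cinner y x"
  by (metis cinner_proj_left cinner_commute)

lemma norm_proj: "(norm x)\<^sup>2 = (norm (proj K x))\<^sup>2 + (norm (x - proj K x))\<^sup>2"
  using pythagoras[OF orthD'[OF proj_orth[of x] proj_in[of x]]] by simp

lemma norm_proj_le: "norm (proj K x) \<le> norm x"
  by (rule power2_le_imp_le) (simp_all add: norm_proj[of x])

lemma orth_orth: "orth (orth K) = K"
proof
  show "orth (orth K) \<subseteq> K"
  proof
    fix x assume x: "x \<in> orth (orth K)"
    have "cinner (x - proj K x) (x - proj K x) = cinner x (x - proj K x)"
      by (simp add: cinner_diff_left orthD'[OF proj_orth proj_in])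
    also have "\<dots> = 0" using x by (simp add: orthD)
    finally show "x \<in> K" using proj_in[of x] by simp
  qed
qed (auto simp: orth_iff' orthD)

end

lemma closed_csubspace_orth: "closed_csubspace (orth A)"
  by unfold_locales (rule orth_subspace closed_orth)+

lemma closed_csubspace_Int:
  "closed_csubspace A \<Longrightarrow> closed_csubspace B \<Longrightarrow> closed_csubspace (A \<inter> B)"
  by (simp add: closed_csubspace_def cvs.subspace_inter closed_Int)

lemma subspace_closure:
  assumes A: "cvs.subspace A"
  shows "cvs.subspace (closure A)"
  unfolding cvs.subspace_def
proof (intro conjI ballI allI)
  show "0 \<in> closure A" using cvs.subspace_0[OF A] closure_subset by blast
next
  fix x y assume "x \<in> closure A" "y \<in> closure A"
  then obtain f g where "\<And>n. f n \<in> A" "f \<longlonglongrightarrow> x" "\<And>n. g n \<in> A" "g \<longlonglongrightarrow> y"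
    by (auto simp: closure_sequential)
  then show "x + y \<in> closure A"
    unfolding closure_sequential
    by (intro exI[of _ "\<lambda>n. f n + g n"] conjI allI tendsto_add cvs.subspace_add[OF A])
next
  fix c x assume "x \<in> closure A"
  then obtain f where "\<And>n. f n \<in> A" "f \<longlonglongrightarrow> x"
    by (auto simp: closure_sequential)
  then show "c *\<^sub>C x \<in> closure A"
    unfolding closure_sequential
    by (intro exI[of _ "\<lambda>n. c *\<^sub>C f n"] conjI allI tendsto_scaleC cvs.subspace_scale[OF A])
qed

lemma closed_csubspace_closure: "cvs.subspace A \<Longrightarrow> closed_csubspace (closure A)"
  by (simp add: closed_csubspace_def subspace_closure)

text \<open>If \<open>F\<close> is not zero, the bound makes its kernel closed, and a suitable
  multiple of a vector of \<open>K\<close> orthogonal to the kernel represents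
  \<open>F\<close>.\<close>

lemma (in closed_csubspace) riesz:
  assumes add: "\<And>x y. x \<in> K \<Longrightarrow> y \<in> K \<Longrightarrow> F (x + y) = F x + F y"
    and scale: "\<And>c x. x \<in> K \<Longrightarrow> F (c *\<^sub>C x) = c * F x"
    and bound: "\<And>x. x \<in> K \<Longrightarrow> cmod (F x) \<le> C * norm x"
  shows "\<exists>z\<in>K. \<forall>x\<in>K. F x = cinner x z"
proof (cases "\<forall>x\<in>K. F x = 0")
  case True
  then show ?thesis using cvs.subspace_0[OF subspace] by force
next
  case False
  then obtain a where a: "a \<in> K" "F a \<noteq> 0" by blast
  define Z where "Z = {x \<in> K. F x = 0}"
  have F_diff: "F (x - y) = F x - F y" if "x \<in> K" "y \<in> K" for x y
    using add[of "x - y" y] that cvs.subspace_diff[OF subspace] by simp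
  have "cvs.subspace Z"
    using scale[OF cvs.subspace_0[OF subspace], of 0]
    by (auto simp: Z_def cvs.subspace_def add scale cvs.subspace_0[OF subspace]
        cvs.subspace_add[OF subspace] cvs.subspace_scale[OF subspace])
  moreover have "closed Z"
  proof (unfold closed_sequential_limits, intro allI impI, elim conjE)
    fix x l assume x: "\<forall>n. x n \<in> Z" "x \<longlonglongrightarrow> l"
    then have l: "l \<in> K" using closed_sequentially[OF closed] by (auto simp: Z_def)
    have "cmod (F l) \<le> C * norm (l - x n)" for n
      using bound[of "l - x n"] F_diff[of l "x n"] x(1) l cvs.subspace_diff[OF subspace]
      by (simp add: Z_def)
    moreover have "(\<lambda>n. C * norm (l - x n)) \<longlonglongrightarrow> C * norm (l - l)" by (intro tendsto_intros x)
    ultimately have "cmod (F l) \<le> C * norm (l - l)"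
      by (intro LIMSEQ_le_const) auto
    with l show "l \<in> Z" by (simp add: Z_def)
  qed
  ultimately interpret Z: closed_csubspace Z by unfold_locales
  define w where "w = a - proj Z a"
  have "proj Z a \<in> K" "F (proj Z a) = 0" using Z.proj_in[of a] by (auto simp: Z_def)
  then have w: "w \<in> K" "F w \<noteq> 0" "w \<in> orth Z"
    using a F_diff cvs.subspace_diff[OF subspace] by (auto simp: w_def)
  then have "w \<noteq> 0" using scale[OF w(1), of 0] by force
  \<comment> \<open>The factor is dictated by the requirement
    \<open>cinner w z = F w\<close>.\<close>
  define z where "z = (cnj (F w) / (norm w)\<^sup>2) *\<^sub>C w"
  show ?thesis
  proof (intro bexI ballI)
    show "z \<in> K" using w by (simp add: z_def cvs.subspace_scale[OF subspace])
    fix x assume x: "x \<in> K"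
    have "x - (F x / F w) *\<^sub>C w \<in> Z"
      using x w by (simp add: Z_def F_diff scale cvs.subspace_diff[OF subspace] cvs.subspace_scale[OF subspace])
    then have "cinner (x - (F x / F w) *\<^sub>C w) w = 0" using w(3) orthD' by blast
    then have "cinner x w = F x / F w * cinner w w" by (simp add: cinner_simps)
    then show "F x = cinner x z"
      using w(2) \<open>w \<noteq> 0\<close> by (simp add: z_def cinner_simps cinner_self)
  qed
qed

subsection \<open>Contractions\<close>

lemma contraction_onD:
  assumes "contraction_on M N U" "x \<in> M"
  shows "U x \<in> N" "norm (U x) \<le> norm x"
    "y \<in> M \<Longrightarrow> U (x + y) = U x + U y" "U (c *\<^sub>C x) = c *\<^sub>C U x"
  using assms by (auto simp: contraction_on_def)

lemma adjoint_on_eqI: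
  assumes M: "closed_csubspace M" and z: "z \<in> M" "\<And>x. x \<in> M \<Longrightarrow> cinner (U x) y = cinner x z"
  shows "adjoint_on M U y = z"
  unfolding adjoint_on_def
proof (rule the_equality)
  fix z' assume z': "z' \<in> M \<and> (\<forall>x\<in>M. cinner (U x) y = cinner x z')"
  then have "z' - z \<in> M" using z cvs.subspace_diff[OF closed_csubspace.subspace[OF M]] by blast
  then have "cinner (z' - z) (z' - z) = 0" using z z' by (simp add: cinner_diff_right)
  then show "z' = z" by simp
qed (use z in blast)

lemma adjoint_on_props:
  assumes M: "closed_csubspace M" and U: "contraction_on M N U"
  shows "adjoint_on M U y \<in> M" and "x \<in> M \<Longrightarrow> cinner (U x) y = cinner x (adjoint_on M U y)"
proof -
  interpret M: closed_csubspace M by (rule M)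
  have "\<exists>z\<in>M. \<forall>x\<in>M. cinner (U x) y = cinner x z"
  proof (rule M.riesz[where C = "norm y"])
    fix x assume "x \<in> M"
    have "cmod (cinner (U x) y) \<le> norm (U x) * norm y" by (rule cmod_cinner_le)
    also have "\<dots> \<le> norm y * norm x"
      using contraction_onD(2)[OF U \<open>x \<in> M\<close>] by (metis mult.commute mult_right_mono norm_ge_zero)
    finally show "cmod (cinner (U x) y) \<le> norm y * norm x" .
  qed (use U in \<open>auto simp: contraction_onD cinner_simps\<close>)
  then obtain z where z: "z \<in> M" "\<forall>x\<in>M. cinner (U x) y = cinner x z" by blast
  have "adjoint_on M U y = z" by (rule adjoint_on_eqI[OF M z(1)]) (use z(2) in blast)
  with z show "adjoint_on M U y \<in> M" and "x \<in> M \<Longrightarrow> cinner (U x) y = cinner x (adjoint_on M U y)"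
    by auto
qed

lemma contraction_on_adjoint:
  assumes M: "closed_csubspace M" and N: "closed_csubspace N" and U: "contraction_on M N U"
  shows "contraction_on N M (adjoint_on M U)"
proof -
  interpret M: closed_csubspace M by (rule M)
  note adj = adjoint_on_props[OF M U]
  have "norm (adjoint_on M U y) \<le> norm y" for y
  proof -
    let ?z = "adjoint_on M U y"
    have "(norm ?z)\<^sup>2 = cmod (cinner (U ?z) y)"
      using adj(2)[OF adj(1)[of y], of y] by (simp add: cinner_self norm_power)
    also have "\<dots> \<le> norm (U ?z) * norm y" by (rule cmod_cinner_le)
    also have "\<dots> \<le> norm ?z * norm y"
      using contraction_onD(2)[OF U adj(1)] by (simp add: mult_right_mono)
    finally show ?thesis
      by (cases "?z = 0") (auto simp: power2_eq_square)
  qed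
  moreover have "adjoint_on M U (x + y) = adjoint_on M U x + adjoint_on M U y" for x y
    by (rule adjoint_on_eqI[OF M]) (simp_all add: adj cvs.subspace_add[OF M.subspace] cinner_simps)
  moreover have "adjoint_on M U (c *\<^sub>C x) = c *\<^sub>C adjoint_on M U x" for c x
    by (rule adjoint_on_eqI[OF M]) (simp_all add: adj cvs.subspace_scale[OF M.subspace] cinner_simps)
  ultimately show ?thesis using adj(1) by (simp add: contraction_on_def)
qed

section \<open>Operators as graphs, their closures and their shifted ranges\<close>

lemma operator_inD:
  assumes "operator_in K T"
  shows "(f, g) \<in> T \<Longrightarrow> f \<in> K" "(f, g) \<in> T \<Longrightarrow> g \<in> K" "(0, 0) \<in> T"
    "(f, g) \<in> T \<Longrightarrow> (f', g') \<in> T \<Longrightarrow> (f + f', g + g') \<in> T"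
    "(f, g) \<in> T \<Longrightarrow> (c *\<^sub>C f, c *\<^sub>C g) \<in> T"
    "(f, g) \<in> T \<Longrightarrow> (f, g') \<in> T \<Longrightarrow> g = g'"
  using assms unfolding operator_in_def single_valued_def by blast+

lemma operator_in_diff:
  assumes "operator_in K T" "(f, g) \<in> T" "(f', g') \<in> T"
  shows "(f - f', g - g') \<in> T"
  using operator_inD(4)[OF assms(1,2) operator_inD(5)[OF assms(1,3), of "-1"]] by simp

lemma subspace_Domain: "operator_in K T \<Longrightarrow> cvs.subspace (Domain T)"
  unfolding cvs.subspace_def by (blast intro: operator_inD(3-5))

lemma closure_graph_sequential:
  "(x, y) \<in> closure (T :: ('a::complex_hilbert \<times> 'a) set) \<longleftrightarrow>
    (\<exists>f g. (\<forall>n. (f n, g n) \<in> T) \<and> f \<longlonglongrightarrow> x \<and> g \<longlonglongrightarrow> y)"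
proof
  assume "(x, y) \<in> closure T"
  then obtain h where "\<forall>n. h n \<in> T" "h \<longlonglongrightarrow> (x, y)" by (auto simp: closure_sequential)
  then show "\<exists>f g. (\<forall>n. (f n, g n) \<in> T) \<and> f \<longlonglongrightarrow> x \<and> g \<longlonglongrightarrow> y"
    by (intro exI[of _ "\<lambda>n. fst (h n)"] exI[of _ "\<lambda>n. snd (h n)"])
       (auto dest: tendsto_fst tendsto_snd)
next
  assume "\<exists>f g. (\<forall>n. (f n, g n) \<in> T) \<and> f \<longlonglongrightarrow> x \<and> g \<longlonglongrightarrow> y"
  then obtain f g where "\<forall>n. (f n, g n) \<in> T" "f \<longlonglongrightarrow> x" "g \<longlonglongrightarrow> y" by blast
  then show "(x, y) \<in> closure T"
    unfolding closure_sequential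
    by (intro exI[of _ "\<lambda>n. (f n, g n)"]) (simp add: tendsto_Pair)
qed

lemma closure_graph_add:
  assumes T: "operator_in K T" and "(x, y) \<in> closure T" "(x', y') \<in> closure T"
  shows "(x + x', y + y') \<in> closure T"
proof -
  from assms(2,3) obtain f g f' g' where "\<forall>n. (f n, g n) \<in> T" "f \<longlonglongrightarrow> x" "g \<longlonglongrightarrow> y"
    "\<forall>n. (f' n, g' n) \<in> T" "f' \<longlonglongrightarrow> x'" "g' \<longlonglongrightarrow> y'"
    unfolding closure_graph_sequential by blast
  then show ?thesis
    unfolding closure_graph_sequential
    by (intro exI[of _ "\<lambda>n. f n + f' n"] exI[of _ "\<lambda>n. g n + g' n"])
       (auto intro: tendsto_add operator_inD(4)[OF T])
qed

lemma closure_graph_scale: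
  assumes T: "operator_in K T" and "(x, y) \<in> closure T"
  shows "(c *\<^sub>C x, c *\<^sub>C y) \<in> closure T"
proof -
  from assms(2) obtain f g where "\<forall>n. (f n, g n) \<in> T" "f \<longlonglongrightarrow> x" "g \<longlonglongrightarrow> y"
    unfolding closure_graph_sequential by blast
  then show ?thesis
    unfolding closure_graph_sequential
    by (intro exI[of _ "\<lambda>n. c *\<^sub>C f n"] exI[of _ "\<lambda>n. c *\<^sub>C g n"])
       (auto intro: tendsto_scaleC operator_inD(5)[OF T])
qed

lemma Cauchy_dominated:
  fixes f :: "nat \<Rightarrow> 'a::real_normed_vector" and g :: "nat \<Rightarrow> 'b::real_normed_vector"
  assumes "Cauchy f" and "\<And>m n. norm (g m - g n) \<le> norm (f m - f n)"
  shows "Cauchy g"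
proof (rule CauchyI)
  fix e :: real assume "e > 0"
  then obtain M where M: "\<forall>m\<ge>M. \<forall>n\<ge>M. norm (f m - f n) < e"
    using CauchyD[OF assms(1)] by blast
  show "\<exists>M. \<forall>m\<ge>M. \<forall>n\<ge>M. norm (g m - g n) < e"
  proof (intro exI allI impI)
    fix m n assume "M \<le> m" "M \<le> n"
    then show "norm (g m - g n) < e" using M assms(2)[of m n] by (meson le_less_trans)
  qed
qed

text \<open>Close up by continuity and continue by zero on the orthogonal complement of the domain.\<close>

lemma contraction_graph_extend:
  assumes M: "closed_csubspace M" and N: "closed_csubspace N" and T: "contraction_graph M N T"
  obtains W where "contraction_on M N W" "\<And>x y. (x, y) \<in> T \<Longrightarrow> W x = y"
proof -
  have op: "operator_in UNIV T" and TMN: "\<And>x y. (x, y) \<in> T \<Longrightarrow> x \<in> M \<and> y \<in> N"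
    and le: "\<And>x y. (x, y) \<in> T \<Longrightarrow> norm y \<le> norm x"
    using T by (auto simp: contraction_graph_def)
  interpret D: closed_csubspace "closure (Domain T)"
    by (rule closed_csubspace_closure[OF subspace_Domain[OF op]])
  define W where "W x = (THE y. (proj (closure (Domain T)) x, y) \<in> closure T)" for x
  have cl_le: "norm y \<le> norm x" if xy: "(x, y) \<in> closure T" for x y
  proof -
    obtain f g where fg: "\<forall>n. (f n, g n) \<in> T" "f \<longlonglongrightarrow> x" "g \<longlonglongrightarrow> y"
      using xy unfolding closure_graph_sequential by blast
    show ?thesis
      by (rule LIMSEQ_le[OF tendsto_norm[OF fg(3)] tendsto_norm[OF fg(2)]]) (use fg(1) le in blast)
  qed
  have cl_N: "y \<in> N" if xy: "(x, y) \<in> closure T" for x y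
  proof -
    obtain f g where "\<forall>n. (f n, g n) \<in> T" "g \<longlonglongrightarrow> y"
      using xy unfolding closure_graph_sequential by blast
    then show ?thesis using closed_sequentially[OF closed_csubspace.closed[OF N]] TMN by blast
  qed
  have uniq: "y = y'" if "(x, y) \<in> closure T" "(x, y') \<in> closure T" for x y y'
  proof -
    \<comment> \<open>Two values over the same point differ by a value over 0, which
      \<open>cl_le\<close> forces to vanish.\<close>
    have "(-1 *\<^sub>C x, -1 *\<^sub>C y') \<in> closure T" by (rule closure_graph_scale[OF op that(2)])
    from cl_le[OF closure_graph_add[OF op that(1) this]] show ?thesis by simp
  qed
  have ex: "\<exists>y. (x, y) \<in> closure T" if "x \<in> closure (Domain T)" for x
  proof -
    obtain f where f: "\<forall>n. f n \<in> Domain T" "f \<longlonglongrightarrow> x"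
      using \<open>x \<in> closure (Domain T)\<close> by (auto simp: closure_sequential)
    then have "\<forall>n. \<exists>y. (f n, y) \<in> T" by blast
    then obtain g where g: "\<And>n. (f n, g n) \<in> T" by metis
    have "Cauchy g"
      by (rule Cauchy_dominated[OF LIMSEQ_imp_Cauchy[OF f(2)] le[OF operator_in_diff[OF op g g]]])
    then obtain y where "g \<longlonglongrightarrow> y" by (auto simp: Cauchy_convergent_iff convergent_def)
    then show ?thesis using f g unfolding closure_graph_sequential by blast
  qed
  have W: "(proj (closure (Domain T)) x, W x) \<in> closure T" for x
    unfolding W_def by (rule theI') (use ex[OF D.proj_in] uniq in blast)
  have "contraction_on M N W"
    unfolding contraction_on_def
  proof (intro conjI ballI allI)
    fix x
    show "W x \<in> N" by (rule cl_N[OF W])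
    show "norm (W x) \<le> norm x" using cl_le[OF W] D.norm_proj_le order_trans by blast
    show "W (x + y) = W x + W y" for y
      using uniq[OF W[of "x + y"]] closure_graph_add[OF op W W] by (simp add: D.proj_add)
    show "W (c *\<^sub>C x) = c *\<^sub>C W x" for c
      using uniq[OF W[of "c *\<^sub>C x"]] closure_graph_scale[OF op W] by (simp add: D.proj_scale)
  qed
  moreover have "W x = y" if "(x, y) \<in> T" for x y
  proof -
    have "x \<in> closure (Domain T)" "(x, y) \<in> closure T"
      using that closure_subset[of "Domain T"] closure_subset[of T] by blast+
    then show ?thesis using uniq[OF W[of x], of y] by (simp add: D.proj_id)
  qed
  ultimately show ?thesis by (rule that)
qed

text \<open>When g + s f converges, \<open>le\<close> applied to differences makes f and g Cauchy
  separately; closedness of \<open>T\<close> then puts the limit pair into \<open>T\<close>.\<close>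

lemma closed_shifted_range:
  assumes op: "operator_in K T" and cl: "closed T"
    and le: "\<And>f g. (f, g) \<in> T \<Longrightarrow> norm f \<le> norm (g + s *\<^sub>C f) \<and> norm g \<le> norm (g + s *\<^sub>C f)"
  shows "closed {g + s *\<^sub>C f | f g. (f, g) \<in> T}"
proof (unfold closed_sequential_limits, intro allI impI, elim conjE)
  fix h l assume "\<forall>n. h n \<in> {g + s *\<^sub>C f | f g. (f, g) \<in> T}" and h: "h \<longlonglongrightarrow> l"
  then have "\<forall>n. \<exists>f g. (f, g) \<in> T \<and> h n = g + s *\<^sub>C f" by blast
  then obtain f g where fg: "\<And>n. (f n, g n) \<in> T" "\<And>n. h n = g n + s *\<^sub>C f n" by metis
  have "norm (f m - f n) \<le> norm (h m - h n) \<and> norm (g m - g n) \<le> norm (h m - h n)" for m n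
    using le[OF operator_in_diff[OF op fg(1)[of m] fg(1)[of n]]]
    by (simp add: fg(2) cvs.scale_right_diff_distrib add_diff_add)
  then have "Cauchy f" "Cauchy g" using Cauchy_dominated[OF LIMSEQ_imp_Cauchy[OF h]] by blast+
  then obtain x y where xy: "f \<longlonglongrightarrow> x" "g \<longlonglongrightarrow> y"
    by (auto simp: Cauchy_convergent_iff convergent_def)
  then have "(x, y) \<in> closure T" using fg(1) unfolding closure_graph_sequential by blast
  then have "(x, y) \<in> T" using cl by simp
  moreover have "h \<longlonglongrightarrow> y + s *\<^sub>C x" unfolding fg(2) by (intro tendsto_intros xy)
  then have "l = y + s *\<^sub>C x" using h LIMSEQ_unique by blast
  ultimately show "l \<in> {g + s *\<^sub>C f | f g. (f, g) \<in> T}" by blast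
qed

lemma subspace_shifted_range:
  assumes op: "operator_in K T"
  shows "cvs.subspace {g + s *\<^sub>C f | f g. (f, g) \<in> T}"
  unfolding cvs.subspace_def
proof (intro conjI ballI allI)
  show "0 \<in> {g + s *\<^sub>C f | f g. (f, g) \<in> T}"
    by (rule CollectI) (use operator_inD(3)[OF op] in \<open>auto intro!: exI[of _ 0]\<close>)
next
  fix x y assume "x \<in> {g + s *\<^sub>C f | f g. (f, g) \<in> T}" "y \<in> {g + s *\<^sub>C f | f g. (f, g) \<in> T}"
  then obtain f g f' g' where fg: "(f, g) \<in> T" "(f', g') \<in> T" "x = g + s *\<^sub>C f" "y = g' + s *\<^sub>C f'"
    by blast
  then have "x + y = (g + g') + s *\<^sub>C (f + f')" by (simp add: scaleC_add_right)
  then show "x + y \<in> {g + s *\<^sub>C f | f g. (f, g) \<in> T}" using operator_inD(4)[OF op fg(1,2)] by blast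
next
  fix c x assume "x \<in> {g + s *\<^sub>C f | f g. (f, g) \<in> T}"
  then obtain f g where fg: "(f, g) \<in> T" "x = g + s *\<^sub>C f" by blast
  then have "c *\<^sub>C x = (c *\<^sub>C g) + s *\<^sub>C (c *\<^sub>C f)"
    by (simp add: scaleC_add_right scaleC_scaleC mult.commute)
  then show "c *\<^sub>C x \<in> {g + s *\<^sub>C f | f g. (f, g) \<in> T}" using operator_inD(5)[OF op fg(1)] by blast
qed

subsection \<open>Symmetric and dissipative operators\<close>

text \<open>Polarization: adding the two pairs settles the imaginary parts, and adding after
  multiplying the first pair by \<i> settles the real parts.\<close>

lemma symmetric_in_cinner:
  assumes "symmetric_in K T" "(f, g) \<in> T" "(f', g') \<in> T"
  shows "cinner g f' = cinner f g'"
proof -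
  have op: "operator_in K T" and Im0: "\<And>f g. (f, g) \<in> T \<Longrightarrow> Im (cinner g f) = 0"
    using assms(1) by (auto simp: symmetric_in_def)
  have "Im (cinner (g + g') (f + f')) = 0"
    by (rule Im0[OF operator_inD(4)[OF op assms(2,3)]])
  then have "Im (cinner g f') = - Im (cinner g' f)"
    using Im0[OF assms(2)] Im0[OF assms(3)] by (simp add: cinner_simps)
  moreover have "Im (cinner (\<i> *\<^sub>C g + g') (\<i> *\<^sub>C f + f')) = 0"
    by (rule Im0[OF operator_inD(4)[OF op operator_inD(5)[OF op assms(2)] assms(3)]])
  then have "Re (cinner g f') = Re (cinner g' f)"
    using Im0[OF assms(2)] Im0[OF assms(3)] by (simp add: cinner_simps)
  ultimately show ?thesis
    by (simp add: complex_eq_iff Re_cinner_commute[of f g'] Im_cinner_commute[of f g'])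
qed

lemma symmetric_in_norm_shift:
  assumes "symmetric_in K T" "(f, g) \<in> T" "s = \<i> \<or> s = - \<i>"
  shows "(norm (g + s *\<^sub>C f))\<^sup>2 = (norm g)\<^sup>2 + (norm f)\<^sup>2"
proof -
  have "Im (cinner g f) = 0" using assms(1,2) by (auto simp: symmetric_in_def)
  then have "Re (cinner g (s *\<^sub>C f)) = 0" using assms(3) by (auto simp: cinner_simps)
  then show ?thesis using assms(3) by (auto simp: power2_norm_add)
qed

lemma le_of_sum_squares_le:
  fixes a b c :: real
  assumes "a\<^sup>2 + b\<^sup>2 \<le> c\<^sup>2" "0 \<le> c"
  shows "b \<le> c \<and> a \<le> c"
proof -
  have "a\<^sup>2 \<le> c\<^sup>2" "b\<^sup>2 \<le> c\<^sup>2"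
    using assms(1) zero_le_power2[of a] zero_le_power2[of b] by linarith+
  then show ?thesis using assms(2) power2_le_imp_le by blast
qed

lemma symmetric_in_closed_range:
  assumes "symmetric_in K T" "closed T" "s = \<i> \<or> s = - \<i>"
  shows "closed {g + s *\<^sub>C f | f g. (f, g) \<in> T}"
proof (rule closed_shifted_range)
  show "operator_in K T" using assms(1) by (simp add: symmetric_in_def)
  show "norm f \<le> norm (g + s *\<^sub>C f) \<and> norm g \<le> norm (g + s *\<^sub>C f)" if "(f, g) \<in> T" for f g
    using symmetric_in_norm_shift[OF assms(1) that assms(3)] by (intro le_of_sum_squares_le) simp_all
qed (rule assms)

lemma dissipative_in_closed_range:
  assumes "dissipative_in K T" "closed T"
  shows "closed {g + \<i> *\<^sub>C f | f g. (f, g) \<in> T}"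
proof (rule closed_shifted_range)
  show "operator_in K T" using assms(1) by (simp add: dissipative_in_def)
  show "norm f \<le> norm (g + \<i> *\<^sub>C f) \<and> norm g \<le> norm (g + \<i> *\<^sub>C f)" if "(f, g) \<in> T" for f g
  proof -
    have "Im (cinner g f) \<ge> 0" using assms(1) that by (auto simp: dissipative_in_def)
    then have "(norm (g + \<i> *\<^sub>C f))\<^sup>2 \<ge> (norm g)\<^sup>2 + (norm f)\<^sup>2"
      by (simp add: power2_norm_add cinner_simps)
    then show ?thesis by (intro le_of_sum_squares_le) simp_all
  qed
qed (rule assms)


text \<open>If T + s is onto \<open>K\<close> and T' + s is injective, each element of
  \<open>T'\<close> has the same image as some element of \<open>T\<close> and hence equals it. Both
  maximality criteria below are instances.\<close>

lemma range_extension_eq: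
  assumes K: "cvs.subspace K" and op: "operator_in K T'" and sub: "T \<subseteq> T'"
    and onto: "\<And>x. x \<in> K \<Longrightarrow> \<exists>(f, g)\<in>T. x = g + s *\<^sub>C f"
    and inj: "\<And>u. (u, - s *\<^sub>C u) \<in> T' \<Longrightarrow> u = 0"
  shows "T' = T"
proof -
  have "(f, g) \<in> T" if fg: "(f, g) \<in> T'" for f g
  proof -
    have "g + s *\<^sub>C f \<in> K"
      by (intro cvs.subspace_add[OF K] cvs.subspace_scale[OF K] operator_inD(1,2)[OF op fg])
    from onto[OF this] obtain f' g' where fg': "(f', g') \<in> T" "g + s *\<^sub>C f = g' + s *\<^sub>C f'"
      by blast
    then have *: "(f - f', g - g') \<in> T'" using sub operator_in_diff[OF op fg] by blast
    moreover have "g - g' = - s *\<^sub>C (f - f')"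
      using fg'(2) by (simp add: cvs.scale_right_diff_distrib algebra_simps)
    ultimately have "f - f' = 0" using inj[of "f - f'"] by simp
    with \<open>g - g' = _\<close> fg'(1) show ?thesis by simp
  qed
  then show ?thesis using sub by auto
qed

text \<open>For every dissipative extension T', the operator T' + \<i> is injective: a pair (u,
  -\<i> u) has imaginary part minus the squared norm of u.\<close>

lemma maximal_dissipative_inI:
  assumes K: "cvs.subspace K" and T: "dissipative_in K T"
    and onto: "\<And>x. x \<in> K \<Longrightarrow> \<exists>(f, g)\<in>T. x = g + \<i> *\<^sub>C f"
  shows "maximal_dissipative_in K T"
  unfolding maximal_dissipative_in_def
proof (intro conjI allI impI, rule T, elim conjE)
  fix T' assume T': "dissipative_in K T'" and sub: "T \<subseteq> T'"
  have "u = 0" if "(u, - \<i> *\<^sub>C u) \<in> T'" for u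
  proof -
    have "Im (cinner (- \<i> *\<^sub>C u) u) \<ge> 0" using T' that by (auto simp: dissipative_in_def)
    then show ?thesis by (simp add: cinner_simps cinner_self)
  qed
  with T' show "T' = T"
    by (intro range_extension_eq[OF K _ sub onto]) (auto simp: dissipative_in_def)
qed

lemma maximal_symmetric_inI:
  assumes K: "cvs.subspace K" and T: "symmetric_in K T"
    and onto: "\<And>x. x \<in> K \<Longrightarrow> \<exists>(f, g)\<in>T. x = g + \<i> *\<^sub>C f"
  shows "maximal_symmetric_in K T"
  unfolding maximal_symmetric_in_def
proof (intro conjI allI impI, rule T, elim conjE)
  fix T' assume T': "symmetric_in K T'" and sub: "T \<subseteq> T'"
  have "u = 0" if "(u, - \<i> *\<^sub>C u) \<in> T'" for u
  proof -
    have "Im (cinner (- \<i> *\<^sub>C u) u) = 0" using T' that by (auto simp: symmetric_in_def)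
    then show ?thesis by (simp add: cinner_simps cinner_self)
  qed
  with T' show "T' = T"
    by (intro range_extension_eq[OF K _ sub onto]) (auto simp: symmetric_in_def)
qed

section \<open>Passing from an operator to its negative\<close>

lemma op_neg_iff [simp]: "(f, g) \<in> op_neg T \<longleftrightarrow> (f, - g) \<in> T"
  unfolding op_neg_def by (auto intro: exI[of _ "- g"])

lemma op_neg_op_neg [simp]: "op_neg (op_neg T) = T"
  by auto

lemma Domain_op_neg [simp]: "Domain (op_neg T) = Domain T"
  by (auto simp: Domain_iff) (metis minus_minus)

lemma op_neg_subset: "op_neg T \<subseteq> T' \<longleftrightarrow> T \<subseteq> op_neg T'"
  by (auto simp: subset_iff) (metis minus_minus)+

lemma symmetric_in_op_neg:
  assumes K: "cvs.subspace K" and T: "symmetric_in K T"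
  shows "symmetric_in K (op_neg T)"
proof -
  have op: "operator_in K T" using T by (simp add: symmetric_in_def)
  have "operator_in K (op_neg T)"
    unfolding operator_in_def
  proof (intro conjI)
    show "op_neg T \<subseteq> K \<times> K"
      using operator_inD(1,2)[OF op] cvs.subspace_neg[OF K] by force
    show "single_valued (op_neg T)"
      using operator_inD(6)[OF op] unfolding single_valued_def by fastforce
    show "(0, 0) \<in> op_neg T" using operator_inD(3)[OF op] by simp
    show "\<forall>(f, g)\<in>op_neg T. \<forall>(f', g')\<in>op_neg T. (f + f', g + g') \<in> op_neg T"
      using operator_inD(4)[OF op] by fastforce
    show "\<forall>c. \<forall>(f, g)\<in>op_neg T. (c *\<^sub>C f, c *\<^sub>C g) \<in> op_neg T"
      using operator_inD(5)[OF op] by fastforce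
  qed
  moreover have "\<forall>(f, g)\<in>op_neg T. Im (cinner g f) = 0"
    using T by (fastforce simp: symmetric_in_def)
  ultimately show ?thesis by (simp add: symmetric_in_def)
qed

lemma maximal_symmetric_in_op_neg:
  assumes K: "cvs.subspace K" and T: "maximal_symmetric_in K T"
  shows "maximal_symmetric_in K (op_neg T)"
  unfolding maximal_symmetric_in_def
proof (intro conjI allI impI)
  show "symmetric_in K (op_neg T)"
    using T by (simp add: maximal_symmetric_in_def symmetric_in_op_neg[OF K])
  fix T' assume "symmetric_in K T' \<and> op_neg T \<subseteq> T'"
  then have "op_neg T' = T"
    using T symmetric_in_op_neg[OF K, of T'] by (auto simp: maximal_symmetric_in_def op_neg_subset)
  then show "T' = op_neg T" by (metis op_neg_op_neg)
qed

text \<open>The extension of \<open>A\<close> which von Neumann's formulas attach to the graph \<open>G\<close> of an operator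
  between the deficiency subspaces; \<open>s\<close> is \<open>\<i>\<close> or \<open>-\<i>\<close>.\<close>

definition vn_ext ::
    "complex \<Rightarrow> ('a::complex_hilbert \<times> 'a) set \<Rightarrow> ('a \<times> 'a) set \<Rightarrow> ('a \<times> 'a) set" where
  "vn_ext s A G = {(f + (x - y), g + s *\<^sub>C (x + y)) | f g x y. (f, g) \<in> A \<and> (x, y) \<in> G}"

lemma vn_extI:
  "(f, g) \<in> A \<Longrightarrow> (x, y) \<in> G \<Longrightarrow> (f + (x - y), g + s *\<^sub>C (x + y)) \<in> vn_ext s A G"
  unfolding vn_ext_def by blast

lemma vn_extE:
  assumes "(a, b) \<in> vn_ext s A G"
  obtains f g x y where "(f, g) \<in> A" "(x, y) \<in> G" "a = f + (x - y)" "b = g + s *\<^sub>C (x + y)"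
  using assms unfolding vn_ext_def by blast

lemma op_neg_vn_ext: "op_neg (vn_ext s A G) = vn_ext (- s) (op_neg A) G"
proof -
  have "(a, b) \<in> op_neg (vn_ext s A G) \<longleftrightarrow> (a, b) \<in> vn_ext (- s) (op_neg A) G" for a b
  proof
    assume "(a, b) \<in> op_neg (vn_ext s A G)"
    then have "(a, - b) \<in> vn_ext s A G" by simp
    then obtain f g x y where *: "(f, g) \<in> A" "(x, y) \<in> G" "a = f + (x - y)" "- b = g + s *\<^sub>C (x + y)"
      by (auto elim!: vn_extE)
    then have "b = - g + (- s) *\<^sub>C (x + y)" by (metis add.inverse_inverse minus_add_distrib cvs.scale_minus_left)
    then show "(a, b) \<in> vn_ext (- s) (op_neg A) G"
      using * vn_extI[of f "- g" "op_neg A" x y G "- s"] by simp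
  next
    assume "(a, b) \<in> vn_ext (- s) (op_neg A) G"
    then obtain f g x y where *: "(f, - g) \<in> A" "(x, y) \<in> G" "a = f + (x - y)" "b = g + (- s) *\<^sub>C (x + y)"
      by (auto elim!: vn_extE)
    then have "- b = - g + s *\<^sub>C (x + y)" by simp
    then show "(a, b) \<in> op_neg (vn_ext s A G)"
      using * vn_extI[of f "- g" A x y G s] by simp
  qed
  then show ?thesis by auto
qed

text \<open>The hypotheses \<open>x\<close> and \<open>y\<close> place the entries of
  \<open>G\<close> in the deficiency subspaces of \<open>A\<close>. The cross terms with
  \<open>A\<close> then cancel in the imaginary part, which becomes the difference of the squared
  norms of x and y. The hypothesis \<open>inj\<close> serves single-valuedness.\<close>

lemma dissipative_in_vn_ext:
  assumes K: "cvs.subspace K" and A: "symmetric_in K A"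
    and G: "operator_in UNIV G" and GK: "G \<subseteq> K \<times> K" and le: "\<And>x y. (x, y) \<in> G \<Longrightarrow> norm y \<le> norm x"
    and x: "\<And>x y f g. (x, y) \<in> G \<Longrightarrow> (f, g) \<in> A \<Longrightarrow> cinner x g = \<i> * cinner x f"
    and y: "\<And>x y f g. (x, y) \<in> G \<Longrightarrow> (f, g) \<in> A \<Longrightarrow> cinner y g = - \<i> * cinner y f"
    and inj: "\<And>x y g. (x, y) \<in> G \<Longrightarrow> (x - y, g) \<in> A \<Longrightarrow> x = 0"
  shows "dissipative_in K (vn_ext \<i> A G)"
proof -
  have opA: "operator_in K A" using A by (simp add: symmetric_in_def)
  let ?T = "vn_ext \<i> A G"
  have add: "(a + a', b + b') \<in> ?T" if ab: "(a, b) \<in> ?T" "(a', b') \<in> ?T" for a b a' b'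
  proof -
    obtain f g x y where 1: "(f, g) \<in> A" "(x, y) \<in> G" "a = f + (x - y)" "b = g + \<i> *\<^sub>C (x + y)"
      using ab(1) by (rule vn_extE)
    obtain f' g' x' y' where 2: "(f', g') \<in> A" "(x', y') \<in> G" "a' = f' + (x' - y')" "b' = g' + \<i> *\<^sub>C (x' + y')"
      using ab(2) by (rule vn_extE)
    have "a + a' = (f + f') + ((x + x') - (y + y'))" "b + b' = (g + g') + \<i> *\<^sub>C ((x + x') + (y + y'))"
      using 1 2 by (simp_all add: scaleC_add_right)
    then show ?thesis
      using vn_extI[OF operator_inD(4)[OF opA 1(1) 2(1)] operator_inD(4)[OF G 1(2) 2(2)], of \<i>]
      by simp
  qed
  have scale: "(c *\<^sub>C a, c *\<^sub>C b) \<in> ?T" if ab: "(a, b) \<in> ?T" for a b c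
  proof -
    obtain f g x y where 1: "(f, g) \<in> A" "(x, y) \<in> G" "a = f + (x - y)" "b = g + \<i> *\<^sub>C (x + y)"
      using ab(1) by (rule vn_extE)
    have "c *\<^sub>C a = c *\<^sub>C f + (c *\<^sub>C x - c *\<^sub>C y)" "c *\<^sub>C b = c *\<^sub>C g + \<i> *\<^sub>C (c *\<^sub>C x + c *\<^sub>C y)"
      using 1 by (simp_all add: scaleC_add_right cvs.scale_right_diff_distrib scaleC_scaleC mult.commute)
    then show ?thesis
      using vn_extI[OF operator_inD(5)[OF opA 1(1)] operator_inD(5)[OF G 1(2)], of c c \<i>]
      by simp
  qed
  \<comment> \<open>By linearity only the fibre over 0 matters. There x - y lies in the domain of
    \<open>A\<close>, so \<open>inj\<close> removes x, the norm bound removes y, and nothing is left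
    of f and g.\<close>
  have zero: "b = 0" if "(0, b) \<in> ?T" for b
  proof -
    from that obtain f g x y where 1: "(f, g) \<in> A" "(x, y) \<in> G" "0 = f + (x - y)" "b = g + \<i> *\<^sub>C (x + y)"
      by (rule vn_extE)
    have "x - y = - f" using 1(3) by (metis add.commute eq_neg_iff_add_eq_0)
    then have "(x - y, - g) \<in> A" using operator_inD(5)[OF opA 1(1), of "-1"] by simp
    then have "x = 0" using inj[OF 1(2)] by blast
    moreover from this have "y = 0" using le[OF 1(2)] by simp
    ultimately have "f = 0" using \<open>x - y = - f\<close> by simp
    then have "g = 0" using operator_inD(6)[OF opA _ operator_inD(3)[OF opA]] 1(1) by blast
    with \<open>x = 0\<close> \<open>y = 0\<close> 1(4) show ?thesis by simp
  qed
  have "operator_in K ?T"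
    unfolding operator_in_def
  proof (intro conjI)
    show "?T \<subseteq> K \<times> K"
    proof
      fix p assume "p \<in> ?T"
      then obtain f g x y where "(f, g) \<in> A" "(x, y) \<in> G" "p = (f + (x - y), g + \<i> *\<^sub>C (x + y))"
        unfolding vn_ext_def by blast
      moreover from this have "f \<in> K" "g \<in> K" "x \<in> K" "y \<in> K"
        using operator_inD(1,2)[OF opA] GK by blast+
      ultimately show "p \<in> K \<times> K"
        by (simp add: cvs.subspace_add[OF K] cvs.subspace_diff[OF K] cvs.subspace_scale[OF K])
    qed
    show "single_valued ?T"
      unfolding single_valued_def
    proof (intro allI impI)
      fix a b b' assume "(a, b) \<in> ?T" "(a, b') \<in> ?T"
      then have "(a + (-1) *\<^sub>C a, b + (-1) *\<^sub>C b') \<in> ?T" by (intro add scale)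
      then show "b = b'" using zero[of "b - b'"] by simp
    qed
    show "(0, 0) \<in> ?T"
      using vn_extI[OF operator_inD(3)[OF opA] operator_inD(3)[OF G], of \<i>] by simp
  qed (use add scale in auto)
  moreover have "Im (cinner b a) \<ge> 0" if "(a, b) \<in> ?T" for a b
  proof -
    from that obtain f g u v where 1: "(f, g) \<in> A" "(u, v) \<in> G" "a = f + (u - v)" "b = g + \<i> *\<^sub>C (u + v)"
      by (rule vn_extE)
    have "Im (cinner g f) = 0" using A 1(1) by (auto simp: symmetric_in_def)
    moreover have "cinner g u = - \<i> * cinner f u" "cinner g v = \<i> * cinner f v"
      using arg_cong[OF x[OF 1(2,1)], of cnj] arg_cong[OF y[OF 1(2,1)], of cnj]
      by (simp_all flip: cinner_commute)
    moreover have "(norm v)\<^sup>2 \<le> (norm u)\<^sup>2" using le[OF 1(2)] by (simp add: power_mono)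
    ultimately show ?thesis
      using Re_cinner_commute[of f u] Re_cinner_commute[of f v] Re_cinner_commute[of u v]
      by (simp add: 1(3,4) cinner_simps cinner_self)
  qed
  ultimately show ?thesis by (auto simp: dissipative_in_def)
qed

subsection \<open>The subspaces attached to a regular symmetric operator\<close>

lemma scaleC_2: "(2 * c) *\<^sub>C x = c *\<^sub>C x + c *\<^sub>C x" "(c * 2) *\<^sub>C x = c *\<^sub>C x + c *\<^sub>C x"
  by (metis mult_2 mult_2_right scaleC_add_left)+

lemma defectD: "\<phi> \<in> defect S z \<Longrightarrow> (f, g) \<in> S \<Longrightarrow> cinner \<phi> g = z * cinner \<phi> f"
  unfolding defect_def orth_def by (force simp: cinner_simps)

lemma defectI: "(\<And>f g. (f, g) \<in> S \<Longrightarrow> cinner \<phi> g = z * cinner \<phi> f) \<Longrightarrow> \<phi> \<in> defect S z"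
  unfolding defect_def orth_def by (force simp: cinner_simps)

lemma defect_closed_csubspace: "closed_csubspace (defect S z)"
  unfolding defect_def by (rule closed_csubspace_orth)

lemma semidefect_closed_csubspace: "closed_csubspace (semidefect S z)"
  unfolding semidefect_def by (intro closed_csubspace_Int defect_closed_csubspace closed_csubspace_orth)

locale regular_op =
  fixes S :: "('a::complex_hilbert \<times> 'a) set"
  assumes regular: "regular_symmetric S"
begin

abbreviation "H0 \<equiv> dom_space S"

abbreviation "pN s \<equiv> proj (defect S s)"

lemma sym: "symmetric_in UNIV S"
  and op: "operator_in UNIV S"
  using regular by (auto simp: regular_symmetric_def symmetric_in_def)

sublocale H0: closed_csubspace "dom_space S"
  unfolding dom_space_def by (rule closed_csubspace_closure[OF subspace_Domain[OF op]])

sublocale L: closed_csubspace "codom_space S"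
  unfolding codom_space_def by (rule closed_csubspace_orth)

sublocale N: closed_csubspace "defect S s" for s
  by (rule defect_closed_csubspace)

lemma Domain_subset_H0: "(f, g) \<in> S \<Longrightarrow> f \<in> H0"
  unfolding dom_space_def by (rule subsetD[OF closure_subset]) (rule DomainI)

lemma codom_space_eq: "codom_space S = orth (Domain S)"
  by (simp add: codom_space_def dom_space_def orth_closure)

lemma codom_space_cinner: "h \<in> codom_space S \<Longrightarrow> (f, g) \<in> S \<Longrightarrow> cinner h f = 0"
  by (metis codom_space_eq orthD DomainI)

lemma orth_codom_space: "orth (codom_space S) = H0"
  unfolding codom_space_def by (rule H0.orth_orth)

lemma proj_H0_codom: "h \<in> codom_space S \<Longrightarrow> proj H0 h = 0"
  by (simp add: H0.proj_0_iff codom_space_def)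

lemma diff_proj_H0: "x - proj H0 x \<in> codom_space S"
  by (simp add: codom_space_def)

lemma core_opI: "(f, g) \<in> S \<Longrightarrow> (f, proj H0 g) \<in> core_op S"
  by (auto simp: core_op_def)

lemma core_opE:
  assumes "(f, g) \<in> core_op S"
  obtains k where "(f, k) \<in> S" "g = proj H0 k"
  using assms by (auto simp: core_op_def)

lemma Domain_core_op: "Domain (core_op S) = Domain S"
  by (auto simp: core_op_def)

lemma core_symmetric: "symmetric_in H0 (core_op S)"
proof -
  have "operator_in H0 (core_op S)"
    unfolding operator_in_def
  proof (intro conjI)
    show "core_op S \<subseteq> H0 \<times> H0" by (auto elim!: core_opE dest: Domain_subset_H0)
    show "single_valued (core_op S)"
      unfolding single_valued_def by (auto elim!: core_opE dest: operator_inD(6)[OF op])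
    show "(0, 0) \<in> core_op S" using core_opI[OF operator_inD(3)[OF op]] by simp
    show "\<forall>(f, g)\<in>core_op S. \<forall>(f', g')\<in>core_op S. (f + f', g + g') \<in> core_op S"
    proof (clarify elim!: core_opE)
      fix f g f' g' assume "(f, g) \<in> S" "(f', g') \<in> S"
      from core_opI[OF operator_inD(4)[OF op this]]
      show "(f + f', proj H0 g + proj H0 g') \<in> core_op S" by (simp add: H0.proj_add)
    qed
    show "\<forall>c. \<forall>(f, g)\<in>core_op S. (c *\<^sub>C f, c *\<^sub>C g) \<in> core_op S"
    proof (clarify elim!: core_opE)
      fix c f g assume "(f, g) \<in> S"
      from core_opI[OF operator_inD(5)[OF op this, of c]]
      show "(c *\<^sub>C f, c *\<^sub>C proj H0 g) \<in> core_op S" by (simp add: H0.proj_scale)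
    qed
  qed
  moreover have "Im (cinner g f) = 0" if "(f, g) \<in> core_op S" for f g
    using that sym Domain_subset_H0
    by (auto elim!: core_opE simp: H0.cinner_proj_left symmetric_in_def)
  ultimately show ?thesis by (auto simp: symmetric_in_def)
qed

lemma core_op: "operator_in H0 (core_op S)"
  using core_symmetric by (simp add: symmetric_in_def)

abbreviation "srange s \<equiv> {g + s *\<^sub>C f | f g. (f, g) \<in> S}"

section \<open>Deficiency subspaces, semi-deficiency subspaces and the isometry, for both signs of
  \<open>s\<close> at once\<close>

context
  fixes s :: complex
  assumes s: "s = \<i> \<or> s = - \<i>"
begin

lemma s_simps: "cnj s = - s" "s * s = - 1" "s \<noteq> 0" "s * (s * a) = - a"
  using s by auto

lemma defect_eq_orth_ran: "defect S s = orth (srange s)"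
  unfolding defect_def by (simp add: s_simps)

text \<open>Closedness of \<open>S\<close> makes the range of S + s closed, so the double complement
  is the range itself and not merely its closure.\<close>

lemma orth_defect: "orth (defect S s) = srange s"
proof -
  interpret R: closed_csubspace "srange s"
    using symmetric_in_closed_range[OF sym _ s] regular subspace_shifted_range[OF op]
    by unfold_locales (auto simp: regular_symmetric_def)
  show ?thesis by (simp add: defect_eq_orth_ran R.orth_orth)
qed

lemma proj_defect_eqI: "(f, g) \<in> S \<Longrightarrow> \<phi> \<in> defect S s \<Longrightarrow> x = (g + s *\<^sub>C f) + \<phi> \<Longrightarrow> pN s x = \<phi>"
  by (rule proj_eqI[OF N.subspace]) (auto simp: orth_defect)

lemma defect_decomp: "\<exists>(f, g)\<in>S. x = (g + s *\<^sub>C f) + pN s x"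
proof -
  have "x - pN s x \<in> srange s" using N.proj_orth[of x s] by (simp add: orth_defect)
  then obtain f g where "(f, g) \<in> S" "x - pN s x = g + s *\<^sub>C f" by blast
  then show ?thesis by (intro bexI[of _ "(f, g)"]) (auto simp: algebra_simps)
qed

text \<open>For \<phi> in the deficiency subspace, pairing with \<open>pN s h\<close> is pairing
  with h. Orthogonality to \<open>Lpart S s\<close> is therefore orthogonality to
  \<open>codom_space S\<close>, that is, membership in \<open>H0\<close>.\<close>

lemma semidefect_eq: "semidefect S s = defect S s \<inter> H0"
proof -
  have "\<phi> \<in> orth (Lpart S s) \<longleftrightarrow> \<phi> \<in> H0" if "\<phi> \<in> defect S s" for \<phi>
  proof -
    have "\<phi> \<in> orth (Lpart S s) \<longleftrightarrow> (\<forall>h\<in>codom_space S. cinner \<phi> (pN s h) = 0)"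
      by (auto simp: orth_def Lpart_def)
    also have "\<dots> \<longleftrightarrow> \<phi> \<in> orth (codom_space S)"
      using that by (simp add: orth_def N.cinner_proj_right)
    finally show ?thesis by (simp add: orth_codom_space)
  qed
  then show ?thesis by (auto simp: semidefect_def)
qed

lemma semidefect_cinner_core:
  assumes "\<phi> \<in> semidefect S s" "(f, g) \<in> core_op S"
  shows "cinner \<phi> g = s * cinner \<phi> f"
  using assms by (auto elim!: core_opE simp: semidefect_eq H0.cinner_proj_right defectD)

text \<open>Closedness of the core makes its shifted range \<open>?R\<close> closed. A vector of
  \<open>H0\<close> cannot distinguish a value of \<open>S\<close> from its projection to
  \<open>H0\<close>, so the part of x orthogonal to \<open>?R\<close> lies in the deficiency
  subspace of \<open>S\<close>.\<close>

lemma core_decomp: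
  assumes x: "x \<in> H0"
  shows "\<exists>f g. (f, g) \<in> core_op S \<and> x = (g + s *\<^sub>C f) + proj (semidefect S s) x"
proof -
  let ?R = "{g + s *\<^sub>C f | f g. (f, g) \<in> core_op S}"
  interpret N': closed_csubspace "semidefect S s" by (rule semidefect_closed_csubspace)
  interpret R: closed_csubspace ?R
    using symmetric_in_closed_range[OF core_symmetric _ s] regular subspace_shifted_range[OF core_op]
    by unfold_locales (auto simp: regular_symmetric_def)
  have "x - proj ?R x \<in> H0"
  proof -
    have "?R \<subseteq> H0"
      using operator_inD(1,2)[OF core_op] cvs.subspace_add[OF H0.subspace] cvs.subspace_scale[OF H0.subspace]
      by blast
    then show ?thesis using x R.proj_in[of x] cvs.subspace_diff[OF H0.subspace] by blast
  qed
  moreover have "x - proj ?R x \<in> defect S s"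
  proof (rule defectI)
    fix f g assume fg: "(f, g) \<in> S"
    have "cinner (x - proj ?R x) (proj H0 g + s *\<^sub>C f) = 0"
      by (rule orthD[OF R.proj_orth]) (use core_opI[OF fg] in blast)
    then show "cinner (x - proj ?R x) g = s * cinner (x - proj ?R x) f"
      using \<open>x - proj ?R x \<in> H0\<close> by (simp add: cinner_add_right cinner_scaleC_right H0.cinner_proj_right s_simps)
  qed
  ultimately have "x - proj ?R x \<in> semidefect S s" by (simp add: semidefect_eq)
  moreover have "x - (x - proj ?R x) \<in> orth (semidefect S s)"
  proof -
    obtain f g where fg: "(f, g) \<in> core_op S" "proj ?R x = g + s *\<^sub>C f" using R.proj_in[of x] by blast
    then show ?thesis
      using semidefect_cinner_core[OF _ fg(1)] by (simp add: orth_iff' cinner_simps s_simps)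
  qed
  ultimately have "proj (semidefect S s) x = x - proj ?R x" by (intro proj_eqI[OF N'.subspace])
  moreover obtain f g where "(f, g) \<in> core_op S" "proj ?R x = g + s *\<^sub>C f" using R.proj_in[of x] by blast
  ultimately show ?thesis by (intro exI[of _ f] exI[of _ g]) simp
qed

text \<open>This description makes \<open>Lpart S s\<close> closed. For the nontrivial inclusion,
  the \<open>H0\<close> part of x is orthogonal to the semi-deficiency subspace and hence, by
  \<open>core_decomp\<close>, lies in the range of the shifted core.\<close>

lemma Lpart_eq: "Lpart S s = defect S s \<inter> orth (semidefect S s)"
proof (intro equalityI subsetI)
  fix x assume "x \<in> Lpart S s"
  then show "x \<in> defect S s \<inter> orth (semidefect S s)"
    unfolding semidefect_def using N.proj_in by (auto simp: Lpart_def orth_def[of "_ \<inter> _"] intro: orthD' )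
next
  fix x assume x: "x \<in> defect S s \<inter> orth (semidefect S s)"
  interpret N': closed_csubspace "semidefect S s" by (rule semidefect_closed_csubspace)
  have "proj (semidefect S s) (proj H0 x) = proj (semidefect S s) x"
  proof (rule proj_eqI[OF N'.subspace])
    have "x - proj H0 x \<in> orth (semidefect S s)"
      unfolding orth_iff'
    proof
      fix y assume "y \<in> semidefect S s"
      then have "y \<in> orth (codom_space S)" by (simp add: semidefect_eq orth_codom_space)
      then show "cinner y (x - proj H0 x) = 0" using diff_proj_H0 by (rule orthD)
    qed
    with cvs.subspace_diff[OF orth_subspace N'.proj_orth[of x] this]
    show "proj H0 x - proj (semidefect S s) x \<in> orth (semidefect S s)" by simp
  qed simp
  also have "\<dots> = 0" using x by (simp add: N'.proj_0_iff)
  finally have "proj (semidefect S s) (proj H0 x) = 0" .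
  then obtain f g where fg: "(f, g) \<in> core_op S" "proj H0 x = g + s *\<^sub>C f"
    using core_decomp[OF H0.proj_in[of x]] by auto
  then obtain k where k: "(f, k) \<in> S" "g = proj H0 k" by (auto elim: core_opE)
  \<comment> \<open>Subtracting an element of the range of S + s does not change the projection to
    the deficiency subspace, and this element is chosen to cancel the \<open>H0\<close> component of
    x.\<close>
  define h where "h = x - (k + s *\<^sub>C f)"
  have "h = (x - proj H0 x) - (k - proj H0 k)" using fg(2) k(2) by (simp add: h_def algebra_simps)
  then have "h \<in> codom_space S"
    using cvs.subspace_diff[OF L.subspace diff_proj_H0 diff_proj_H0] by metis
  moreover have "(- f, - k) \<in> S" using operator_inD(5)[OF op k(1), of "-1"] by simp
  then have "pN s h = x"
    by (rule proj_defect_eqI) (use x in \<open>simp_all add: h_def\<close>)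
  ultimately show "x \<in> Lpart S s" by (auto simp: Lpart_def)
qed

lemma Lpart_subset: "x \<in> Lpart S s \<Longrightarrow> x \<in> defect S s"
  and Lpart_orth_semidefect: "x \<in> Lpart S s \<Longrightarrow> x \<in> orth (semidefect S s)"
  by (auto simp: Lpart_eq)

lemma Lpart_closed_csubspace: "closed_csubspace (Lpart S s)"
  unfolding Lpart_eq by (intro closed_csubspace_Int N.closed_csubspace_axioms closed_csubspace_orth)

lemma proj_semidefect_defect: "\<phi> \<in> defect S s \<Longrightarrow> proj (semidefect S s) \<phi> = \<phi> - proj (Lpart S s) \<phi>"
proof -
  interpret N': closed_csubspace "semidefect S s" by (rule semidefect_closed_csubspace)
  interpret L': closed_csubspace "Lpart S s" by (rule Lpart_closed_csubspace)
  assume \<phi>: "\<phi> \<in> defect S s"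
  show "proj (semidefect S s) \<phi> = \<phi> - proj (Lpart S s) \<phi>"
  proof (rule proj_eqI[OF N'.subspace])
    show "\<phi> - proj (Lpart S s) \<phi> \<in> semidefect S s"
      using cvs.subspace_diff[OF N.subspace \<phi> Lpart_subset[OF L'.proj_in[of \<phi>]]] L'.proj_orth[of \<phi>]
      by (simp add: semidefect_def)
  qed (simp add: Lpart_orth_semidefect)
qed

text \<open>The pair from the decomposition of h at s also works at -s: symmetry of \<open>S\<close>
  and orthogonality of h to the domain place h - g + s f in the opposite deficiency subspace, and
  the remainder g - s f is in the range of S - s.\<close>

lemma proj_codom_pair:
  assumes h: "h \<in> codom_space S"
  shows "\<exists>(f, g)\<in>S. pN s h = h - g - s *\<^sub>C f \<and> pN (- s) h = h - g + s *\<^sub>C f"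
proof -
  obtain f g where fg: "(f, g) \<in> S" "h = (g + s *\<^sub>C f) + pN s h"
    using defect_decomp[of h] by blast
  then have P: "pN s h = h - g - s *\<^sub>C f" by (simp add: algebra_simps)
  have "h - g + s *\<^sub>C f \<in> defect S (- s)"
  proof (rule defectI)
    fix f' g' assume fg': "(f', g') \<in> S"
    have "cinner (h - g - s *\<^sub>C f) g' = s * cinner (h - g - s *\<^sub>C f) f'"
      using defectD[OF N.proj_in fg', of s h] by (simp add: P)
    moreover have "cinner h f' = 0" by (rule codom_space_cinner[OF h fg'])
    moreover have "cinner g f' = cinner f g'" by (rule symmetric_in_cinner[OF sym fg(1) fg'])
    ultimately show "cinner (h - g + s *\<^sub>C f) g' = - s * cinner (h - g + s *\<^sub>C f) f'"
      by (simp add: cinner_simps algebra_simps s_simps)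
  qed
  moreover have "h - (h - g + s *\<^sub>C f) \<in> orth (defect S (- s))"
    using defectD[OF _ fg(1), of _ "- s"] by (simp add: orth_iff' cinner_simps s_simps)
  ultimately have "pN (- s) h = h - g + s *\<^sub>C f" by (intro proj_eqI[OF N.subspace])
  with P fg(1) show ?thesis by blast
qed

text \<open>A vanishing projection means h = g + s f. As h is orthogonal to f and the pairing of g
  with f is real, the imaginary part leaves only the squared norm of f, up to sign.\<close>

lemma proj_codom_inj:
  assumes h: "h \<in> codom_space S" and 0: "pN s h = 0"
  shows "h = 0"
proof -
  obtain f g where fg: "(f, g) \<in> S" "pN s h = h - g - s *\<^sub>C f"
    using proj_codom_pair[OF h] by blast
  then have h_eq: "h = g + s *\<^sub>C f" using 0 by (simp add: algebra_simps)
  have "Im (cinner h f) = 0" using codom_space_cinner[OF h fg(1)] by simp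
  moreover have "Im (cinner g f) = 0" using sym fg(1) by (auto simp: symmetric_in_def)
  ultimately have "f = 0" using s by (auto simp: h_eq cinner_simps cinner_self)
  then have "g = 0" using operator_inD(6)[OF op _ operator_inD(3)[OF op]] fg(1) by blast
  with \<open>f = 0\<close> h_eq show ?thesis by simp
qed

text \<open>The definite description in \<open>Viso\<close> is meaningful because h is determined by
  its projection, by \<open>proj_codom_inj\<close>.\<close>

lemma Viso_proj:
  assumes h: "h \<in> codom_space S"
  shows "Viso S s (pN s h) = pN (- s) h"
  unfolding Viso_def
proof (rule the_equality)
  show "\<exists>k\<in>codom_space S. pN s h = pN s k \<and> pN (- s) h = pN (cnj s) k"
    using h by (auto simp: s_simps)
  fix y assume "\<exists>k\<in>codom_space S. pN s h = pN s k \<and> y = pN (cnj s) k"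
  then obtain k where k: "k \<in> codom_space S" "pN s h = pN s k" "y = pN (- s) k"
    by (auto simp: s_simps)
  then have "pN s (h - k) = 0" by (simp add: N.proj_diff)
  then have "h - k = 0" by (rule proj_codom_inj[OF cvs.subspace_diff[OF L.subspace h k(1)]])
  then show "y = pN (- s) h" using k by simp
qed

text \<open>The isometry property of \<open>Viso\<close>: after one projection is dropped, the two
  sides differ only by multiples of the pairing of f with k, which is zero.\<close>

lemma cinner_proj_codom:
  assumes h: "h \<in> codom_space S" and k: "k \<in> codom_space S"
  shows "cinner (pN s h) (pN s k) = cinner (pN (- s) h) (pN (- s) k)"
proof -
  obtain f g where fg: "(f, g) \<in> S" "pN s h = h - g - s *\<^sub>C f" "pN (- s) h = h - g + s *\<^sub>C f"
    using proj_codom_pair[OF h] by blast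
  have "cinner f k = 0" using codom_space_cinner[OF k fg(1)] cinner_commute[of f k] by simp
  then show ?thesis by (simp add: N.cinner_proj_right) (simp add: fg cinner_simps)
qed

lemma norm_proj_codom: "h \<in> codom_space S \<Longrightarrow> norm (pN (- s) h) = norm (pN s h)"
  using cinner_proj_codom[of h h] by (simp add: cinner_self power_eq_iff_eq_base flip: of_real_power)

text \<open>With the pair of \<open>proj_codom_pair\<close> the two projections differ by -2 s f, an
  element of the domain.\<close>

lemma proj_codom_diff_in:
  assumes h: "h \<in> codom_space S"
  shows "(pN s h - pN (- s) h, s *\<^sub>C (pN s h + pN (- s) h) - (2 * s) *\<^sub>C h) \<in> S"
proof -
  obtain f g where fg: "(f, g) \<in> S" "pN s h = h - g - s *\<^sub>C f" "pN (- s) h = h - g + s *\<^sub>C f"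
    using proj_codom_pair[OF h] by blast
  have "(- (2 * s)) *\<^sub>C f = pN s h - pN (- s) h"
    "(- (2 * s)) *\<^sub>C g = s *\<^sub>C (pN s h + pN (- s) h) - (2 * s) *\<^sub>C h"
    by (simp_all add: fg scaleC_2 algebra_simps scaleC_add_right cvs.scale_right_diff_distrib)
  then show ?thesis using operator_inD(5)[OF op fg(1), of "- (2 * s)"] by simp
qed

text \<open>The converse of \<open>proj_codom_diff_in\<close>: a difference of deficiency vectors
  enters the domain of \<open>S\<close> only as a difference of projections of one h.\<close>

lemma defect_diff_in_Domain:
  assumes \<phi>: "\<phi> \<in> defect S s" and \<psi>: "\<psi> \<in> defect S (- s)" and g: "(\<phi> - \<psi>, g) \<in> S"
  shows "\<exists>h\<in>codom_space S. \<phi> = pN s h \<and> \<psi> = pN (- s) h"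
proof -
  \<comment> \<open>Both g and s (\<phi> + \<psi>) are values at \<phi> - \<psi> of the adjoint
    relation of \<open>S\<close>. Two such values differ by a vector orthogonal to the domain. The
    projections of h are 2 s \<phi> and 2 s \<psi>, whence the rescaling at the end.\<close>
  define h where "h = s *\<^sub>C (\<phi> + \<psi>) - g"
  have "h \<in> codom_space S"
    unfolding codom_space_eq orth_def
  proof (intro CollectI ballI)
    fix f' assume "f' \<in> Domain S"
    then obtain g' where fg': "(f', g') \<in> S" by blast
    show "cinner h f' = 0"
      using defectD[OF \<phi> fg'] defectD[OF \<psi> fg'] symmetric_in_cinner[OF sym g fg']
      by (simp add: h_def cinner_simps algebra_simps)
  qed
  moreover have "(- (\<phi> - \<psi>), - g) \<in> S" using operator_inD(5)[OF op g, of "-1"] by simp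
  then have "pN s h = (2 * s) *\<^sub>C \<phi>"
    by (rule proj_defect_eqI)
       (use cvs.subspace_scale[OF N.subspace \<phi>, of "2 * s"] in
        \<open>simp_all add: h_def scaleC_2 scaleC_add_right algebra_simps cvs.scale_right_diff_distrib\<close>)
  moreover have "pN (- s) h = (2 * s) *\<^sub>C \<psi>"
  proof (rule proj_eqI[OF N.subspace])
    show "h - (2 * s) *\<^sub>C \<psi> \<in> orth (defect S (- s))"
      using defectD[OF _ g, of _ "- s"]
      by (simp add: orth_iff' h_def scaleC_2 cinner_simps s_simps algebra_simps)
  qed (simp add: cvs.subspace_scale[OF N.subspace] \<psi>)
  ultimately show ?thesis
    using s_simps(3) by (intro bexI[of _ "(1 / (2 * s)) *\<^sub>C h"])
      (simp_all add: N.proj_scale scaleC_scaleC cvs.subspace_scale[OF L.subspace])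
qed

text \<open>Here \<phi> is a projection of some h in \<open>codom_space S\<close> but also lies in
  \<open>H0\<close>, so its pairing with itself equals that of h with \<phi>, which is 0.\<close>

lemma core_op_semidefect_inj:
  assumes \<phi>: "\<phi> \<in> semidefect S s" and u: "u \<in> semidefect S (- s)" and g: "(\<phi> - u, g) \<in> core_op S"
  shows "\<phi> = 0"
proof -
  obtain k where k: "(\<phi> - u, k) \<in> S" "g = proj H0 k" using g by (rule core_opE)
  have \<phi>': "\<phi> \<in> defect S s" "\<phi> \<in> H0" and u': "u \<in> defect S (- s)"
    using \<phi> u by (simp_all add: semidefect_eq) (simp add: semidefect_def)
  then obtain h where h: "h \<in> codom_space S" "\<phi> = pN s h" using defect_diff_in_Domain k by blast
  have "cinner \<phi> \<phi> = cinner h \<phi>" using h(2) N.cinner_proj_left \<phi>' by metis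
  also have "\<dots> = 0" using h(1) \<phi>'(2) by (simp add: codom_space_def orthD)
  finally show ?thesis by simp
qed

end

end

subsection \<open>The compression of the extension determined by \<open>U\<close>\<close>

text \<open>Single-valuedness comes from the norm bound: two values over one point differ by a value
  over 0.\<close>

lemma contraction_graph_zero_unique:
  assumes lin: "\<And>x y x' y'. (x, y) \<in> G \<Longrightarrow> (x', y') \<in> G \<Longrightarrow> (x + x', y + y') \<in> G"
    "\<And>c x y. (x, y) \<in> G \<Longrightarrow> (c *\<^sub>C x, c *\<^sub>C y) \<in> G"
    and zero: "(0, 0) \<in> G" and sub: "G \<subseteq> M \<times> N" and le: "\<And>x y. (x, y) \<in> G \<Longrightarrow> norm y \<le> norm x"
  shows "contraction_graph M N G"
proof -
  have "y = y'" if "(x, y) \<in> G" "(x, y') \<in> G" for x y y'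
    using le[OF lin(1)[OF that(1) lin(2)[OF that(2), of "-1"]]] by simp
  then have "single_valued G" unfolding single_valued_def by blast
  then show ?thesis
    using assms unfolding contraction_graph_def operator_in_def by auto
qed

lemma contraction_graph_of_on:
  assumes M: "closed_csubspace M" and U: "contraction_on M N U"
  shows "contraction_graph M N {(x, U x) | x. x \<in> M}"
proof -
  interpret M: closed_csubspace M by (rule M)
  show ?thesis
  proof (rule contraction_graph_zero_unique)
    show "(0, 0) \<in> {(x, U x) | x. x \<in> M}"
      using contraction_onD(4)[OF U, of 0 0] cvs.subspace_0[OF M.subspace] by simp
  qed (use contraction_onD[OF U] cvs.subspace_add[OF M.subspace] cvs.subspace_scale[OF M.subspace] in auto)
qed

locale extension_param = regular_op +
  fixes U
  assumes contr: "contraction_on (defect S \<i>) (defect S (- \<i>)) U"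
    and ker: "\<And>\<phi>. \<phi> \<in> Lpart S \<i> \<Longrightarrow> U \<phi> = Viso S \<i> \<phi> \<Longrightarrow> \<phi> = 0"
begin

abbreviation "T \<equiv> vn_ext \<i> S {(\<phi>, U \<phi>) | \<phi>. \<phi> \<in> defect S \<i>}"

lemma i_eq: "\<i> = \<i> \<or> \<i> = - \<i>" and minus_i_eq: "- \<i> = \<i> \<or> - \<i> = - \<i>"
  by simp_all

lemma U_in: "\<phi> \<in> defect S \<i> \<Longrightarrow> U \<phi> \<in> defect S (- \<i>)"
  using contraction_onD(1)[OF contr] .

sublocale Li: closed_csubspace "Lpart S \<i>" by (rule Lpart_closed_csubspace[OF i_eq])
sublocale Lmi: closed_csubspace "Lpart S (- \<i>)" by (rule Lpart_closed_csubspace[OF minus_i_eq])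
sublocale N': closed_csubspace "semidefect S s" for s by (rule semidefect_closed_csubspace)

text \<open>Membership of \<phi> - U \<phi> in the domain of \<open>S\<close> would make
  \<open>U\<close> agree with the isometry at \<phi>, which is what \<open>ker\<close> excludes.
  This yields direct sums although \<open>S\<close> is not densely defined.\<close>

lemma param_inj:
  assumes \<phi>: "\<phi> \<in> defect S \<i>" and g: "(\<phi> - U \<phi>, g) \<in> S"
  shows "\<phi> = 0"
proof -
  obtain h where h: "h \<in> codom_space S" "\<phi> = pN \<i> h" "U \<phi> = pN (- \<i>) h"
    using defect_diff_in_Domain[OF i_eq \<phi> U_in[OF \<phi>] g] by blast
  show ?thesis
  proof (rule ker)
    show "\<phi> \<in> Lpart S \<i>" using h by (simp add: Lpart_def)
    show "U \<phi> = Viso S \<i> \<phi>" using Viso_proj[OF i_eq h(1)] h(2,3) by metis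
  qed
qed

lemma kerU_iff:
  assumes \<phi>: "\<phi> \<in> defect S \<i>"
  shows "\<phi> \<in> kerU S U \<longleftrightarrow> \<phi> - U \<phi> \<in> H0"
proof -
  obtain k where k: "k \<in> codom_space S" "proj (Lpart S \<i>) \<phi> = pN \<i> k"
    using Li.proj_in[of \<phi>] by (auto simp: Lpart_def)
  \<comment> \<open>Up to sign \<open>d\<close> is the failure of the kernel equation with both
    sides in \<open>Lpart S (- \<i>)\<close>. Orthogonality of \<phi> - U \<phi> to
    \<open>codom_space S\<close> becomes orthogonality of \<open>d\<close> to the subspace that
    contains it.\<close>
  define d where "d = proj (Lpart S (- \<i>)) (U \<phi>) - pN (- \<i>) k"
  have "pN (- \<i>) k \<in> Lpart S (- \<i>)" using k(1) by (auto simp: Lpart_def)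
  then have d: "d \<in> Lpart S (- \<i>)" by (simp add: d_def cvs.subspace_diff[OF Lmi.subspace])
  have "cinner (\<phi> - U \<phi>) h = - cinner d (pN (- \<i>) h)" if h: "h \<in> codom_space S" for h
  proof -
    have L: "pN \<i> h \<in> Lpart S \<i>" "pN (- \<i>) h \<in> Lpart S (- \<i>)" using h by (auto simp: Lpart_def)
    have "cinner \<phi> h = cinner (proj (Lpart S \<i>) \<phi>) (pN \<i> h)"
      by (simp add: Li.cinner_proj_left[OF L(1)] N.cinner_proj_right[OF \<phi>])
    also have "\<dots> = cinner (pN (- \<i>) k) (pN (- \<i>) h)"
      using cinner_proj_codom[OF i_eq k(1) h] by (simp add: k(2))
    finally have "cinner \<phi> h = cinner (pN (- \<i>) k) (pN (- \<i>) h)" .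
    moreover have "cinner (U \<phi>) h = cinner (proj (Lpart S (- \<i>)) (U \<phi>)) (pN (- \<i>) h)"
      by (simp add: Lmi.cinner_proj_left[OF L(2)] N.cinner_proj_right[OF U_in[OF \<phi>]])
    ultimately show ?thesis by (simp add: d_def cinner_diff_left)
  qed
  then have "\<phi> - U \<phi> \<in> H0 \<longleftrightarrow> (\<forall>h\<in>codom_space S. cinner d (pN (- \<i>) h) = 0)"
    unfolding orth_codom_space[symmetric] by (simp add: orth_def)
  also have "\<dots> \<longleftrightarrow> d \<in> orth (Lpart S (- \<i>))"
    by (auto simp: orth_def Lpart_def)
  also have "\<dots> \<longleftrightarrow> d = 0"
    using d orthD[of d "Lpart S (- \<i>)" d] cvs.subspace_0[OF orth_subspace] by auto
  also have "\<dots> \<longleftrightarrow> \<phi> \<in> kerU S U"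
    using \<phi> Viso_proj[OF i_eq k(1)] by (simp add: kerU_def d_def k(2))
  finally show ?thesis ..
qed

lemma kerU_eq: "kerU S U = {\<phi> \<in> defect S \<i>. \<phi> - U \<phi> \<in> H0}"
  using kerU_iff by (auto simp: kerU_def)

lemma kerU_defect: "\<phi> \<in> kerU S U \<Longrightarrow> \<phi> \<in> defect S \<i>"
  by (simp add: kerU_eq)

lemma kerU_subspace: "cvs.subspace (kerU S U)"
proof -
  have "U 0 = 0" using contraction_onD(4)[OF contr cvs.subspace_0[OF N.subspace], of 0] by simp
  moreover have "\<phi> + \<psi> - (U \<phi> + U \<psi>) \<in> H0" if "\<phi> - U \<phi> \<in> H0" "\<psi> - U \<psi> \<in> H0" for \<phi> \<psi>
    using cvs.subspace_add[OF H0.subspace that] by (simp add: add_diff_add)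
  ultimately show ?thesis
    unfolding kerU_eq cvs.subspace_def
    using contraction_onD(3,4)[OF contr] cvs.subspace_0[OF N.subspace] cvs.subspace_add[OF N.subspace]
      cvs.subspace_scale[OF N.subspace] cvs.subspace_0[OF H0.subspace] cvs.subspace_add[OF H0.subspace]
      cvs.subspace_scale[OF H0.subspace]
    by (simp flip: cvs.scale_right_diff_distrib)
qed

lemma kerU_decomp:
  assumes \<phi>: "\<phi> \<in> kerU S U"
  shows "\<exists>h\<in>codom_space S. proj (Lpart S \<i>) \<phi> = pN \<i> h \<and> proj (Lpart S (- \<i>)) (U \<phi>) = pN (- \<i>) h \<and>
    \<phi> = proj (semidefect S \<i>) \<phi> + pN \<i> h \<and> U \<phi> = proj (semidefect S (- \<i>)) (U \<phi>) + pN (- \<i>) h"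
proof -
  obtain k where k: "k \<in> codom_space S" "proj (Lpart S \<i>) \<phi> = pN \<i> k"
    using Li.proj_in[of \<phi>] by (auto simp: Lpart_def)
  have "proj (Lpart S (- \<i>)) (U \<phi>) = pN (- \<i>) k"
    using \<phi> Viso_proj[OF i_eq k(1)] by (simp add: kerU_def k(2))
  then show ?thesis
    using k proj_semidefect_defect[OF i_eq kerU_defect[OF \<phi>]]
      proj_semidefect_defect[OF minus_i_eq U_in[OF kerU_defect[OF \<phi>]]]
    by (intro bexI[of _ k]) simp_all
qed

lemma U0I: "\<phi> \<in> kerU S U \<Longrightarrow> (proj (semidefect S \<i>) \<phi>, proj (semidefect S (- \<i>)) (U \<phi>)) \<in> U0 S U"
  by (auto simp: U0_def)

lemma U0E:
  assumes "(x, y) \<in> U0 S U"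
  obtains \<phi> where "\<phi> \<in> kerU S U" "x = proj (semidefect S \<i>) \<phi>" "y = proj (semidefect S (- \<i>)) (U \<phi>)"
  using assms by (auto simp: U0_def)

lemma Domain_U0: "Domain (U0 S U) = proj (semidefect S \<i>) ` kerU S U"
  by (auto simp: U0_def)

text \<open>The components of \<phi> and U \<phi> in the two sets \<open>Lpart\<close> are
  projections of the same h and have equal norms, so they cancel from the contraction inequality by
  Pythagoras.\<close>

lemma semidefect_norm_le:
  assumes \<phi>: "\<phi> \<in> kerU S U"
  shows "norm (proj (semidefect S (- \<i>)) (U \<phi>)) \<le> norm (proj (semidefect S \<i>) \<phi>)"
proof (rule power2_le_imp_le)
  obtain h where h: "h \<in> codom_space S"
    "\<phi> = proj (semidefect S \<i>) \<phi> + pN \<i> h" "U \<phi> = proj (semidefect S (- \<i>)) (U \<phi>) + pN (- \<i>) h"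
    using kerU_decomp[OF \<phi>] by blast
  have L: "pN \<i> h \<in> Lpart S \<i>" "pN (- \<i>) h \<in> Lpart S (- \<i>)" using h(1) by (auto simp: Lpart_def)
  have "(norm \<phi>)\<^sup>2 = (norm (proj (semidefect S \<i>) \<phi>))\<^sup>2 + (norm (pN \<i> h))\<^sup>2"
    using pythagoras[OF orthD'[OF Lpart_orth_semidefect[OF i_eq L(1)] N'.proj_in[of \<i> \<phi>]]] h(2) by simp
  moreover have "(norm (U \<phi>))\<^sup>2 = (norm (proj (semidefect S (- \<i>)) (U \<phi>)))\<^sup>2 + (norm (pN (- \<i>) h))\<^sup>2"
    using pythagoras[OF orthD'[OF Lpart_orth_semidefect[OF minus_i_eq L(2)] N'.proj_in[of "- \<i>" "U \<phi>"]]] h(3) by simp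
  moreover have "norm (pN (- \<i>) h) = norm (pN \<i> h)" by (rule norm_proj_codom[OF i_eq h(1)])
  moreover have "(norm (U \<phi>))\<^sup>2 \<le> (norm \<phi>)\<^sup>2"
    using contraction_onD(2)[OF contr kerU_defect[OF \<phi>]] by (simp add: power_mono)
  ultimately show "(norm (proj (semidefect S (- \<i>)) (U \<phi>)))\<^sup>2 \<le> (norm (proj (semidefect S \<i>) \<phi>))\<^sup>2"
    by simp
qed simp

lemma contraction_graph_U0: "contraction_graph (semidefect S \<i>) (semidefect S (- \<i>)) (U0 S U)"
proof (rule contraction_graph_zero_unique)
  fix x y x' y' assume "(x, y) \<in> U0 S U" "(x', y') \<in> U0 S U"
  then obtain \<phi> \<psi> where 1: "\<phi> \<in> kerU S U" "x = proj (semidefect S \<i>) \<phi>" "y = proj (semidefect S (- \<i>)) (U \<phi>)"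
    and 2: "\<psi> \<in> kerU S U" "x' = proj (semidefect S \<i>) \<psi>" "y' = proj (semidefect S (- \<i>)) (U \<psi>)"
    by (metis U0E)
  have "U (\<phi> + \<psi>) = U \<phi> + U \<psi>" using contraction_onD(3)[OF contr] 1 2 kerU_defect by blast
  then show "(x + x', y + y') \<in> U0 S U"
    using U0I[OF cvs.subspace_add[OF kerU_subspace 1(1) 2(1)]] 1 2 by (simp add: N'.proj_add)
next
  fix c x y assume "(x, y) \<in> U0 S U"
  then obtain \<phi> where 1: "\<phi> \<in> kerU S U" "x = proj (semidefect S \<i>) \<phi>" "y = proj (semidefect S (- \<i>)) (U \<phi>)"
    by (metis U0E)
  have "U (c *\<^sub>C \<phi>) = c *\<^sub>C U \<phi>" using contraction_onD(4)[OF contr] 1 kerU_defect by blast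
  then show "(c *\<^sub>C x, c *\<^sub>C y) \<in> U0 S U"
    using U0I[OF cvs.subspace_scale[OF kerU_subspace 1(1)], of c] 1 by (simp add: N'.proj_scale)
next
  have "U 0 = 0" using contraction_onD(4)[OF contr cvs.subspace_0[OF N.subspace], of 0] by simp
  then show "(0, 0) \<in> U0 S U" using U0I[OF cvs.subspace_0[OF kerU_subspace]] by simp
qed (auto elim!: U0E simp: semidefect_norm_le)

lemma U0_mem: "(x, y) \<in> U0 S U \<Longrightarrow> x \<in> semidefect S \<i> \<and> y \<in> semidefect S (- \<i>)"
  by (auto elim!: U0E)

text \<open>The elements of \<open>T\<close> and of the compression determined by the same \<open>\<phi>\<close> differ by an
  element of \<open>S\<close>, up to the component of the value in \<open>\<LL>\<close>.\<close>

lemma kerU_shift: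
  assumes \<phi>: "\<phi> \<in> kerU S U"
  shows "\<exists>f g h. (f, g) \<in> S \<and> h \<in> codom_space S \<and>
    \<phi> - U \<phi> = f + (proj (semidefect S \<i>) \<phi> - proj (semidefect S (- \<i>)) (U \<phi>)) \<and>
    \<i> *\<^sub>C (\<phi> + U \<phi>) = (g + h) + \<i> *\<^sub>C (proj (semidefect S \<i>) \<phi> + proj (semidefect S (- \<i>)) (U \<phi>))"
proof -
  obtain h where h: "h \<in> codom_space S" and
    d: "\<phi> = proj (semidefect S \<i>) \<phi> + pN \<i> h" "U \<phi> = proj (semidefect S (- \<i>)) (U \<phi>) + pN (- \<i>) h"
    using kerU_decomp[OF \<phi>] by blast
  let ?x = "proj (semidefect S \<i>) \<phi>" and ?y = "proj (semidefect S (- \<i>)) (U \<phi>)"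
  have "\<phi> - U \<phi> = (pN \<i> h - pN (- \<i>) h) + (?x - ?y)"
    using d by (metis add.commute add_diff_add)
  moreover have "\<i> *\<^sub>C (\<phi> + U \<phi>) =
      ((\<i> *\<^sub>C (pN \<i> h + pN (- \<i>) h) - (2 * \<i>) *\<^sub>C h) + (2 * \<i>) *\<^sub>C h) + \<i> *\<^sub>C (?x + ?y)"
    by (subst (1) d(1), subst (1) d(2)) (simp add: scaleC_add_right)
  moreover have "(2 * \<i>) *\<^sub>C h \<in> codom_space S" by (rule cvs.subspace_scale[OF L.subspace h])
  ultimately show ?thesis using proj_codom_diff_in[OF i_eq h] by blast
qed

text \<open>In both directions \<open>kerU_shift\<close> exchanges \<phi> for its semi-deficiency
  components; the domain error is absorbed by \<open>S\<close>, and the error of the value in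
  \<open>codom_space S\<close> is annihilated by the projection to \<open>H0\<close>.\<close>

lemma compression_ext: "compression H0 T = vn_ext \<i> (core_op S) (U0 S U)"
proof (intro equalityI subrelI)
  fix a b assume "(a, b) \<in> compression H0 T"
  then obtain g where g: "(a, g) \<in> T" "a \<in> H0" "b = proj H0 g" by (auto simp: compression_def)
  then obtain f k \<phi> where f: "(f, k) \<in> S" "\<phi> \<in> defect S \<i>" "a = f + (\<phi> - U \<phi>)" "g = k + \<i> *\<^sub>C (\<phi> + U \<phi>)"
    by (auto elim!: vn_extE)
  then have "\<phi> - U \<phi> = a - f" by simp
  then have "\<phi> \<in> kerU S U"
    using f(2) cvs.subspace_diff[OF H0.subspace g(2) Domain_subset_H0[OF f(1)]] by (simp add: kerU_eq)
  then obtain f' g' h where s: "(f', g') \<in> S" "h \<in> codom_space S"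
      "\<phi> - U \<phi> = f' + (proj (semidefect S \<i>) \<phi> - proj (semidefect S (- \<i>)) (U \<phi>))"
      "\<i> *\<^sub>C (\<phi> + U \<phi>) = (g' + h) + \<i> *\<^sub>C (proj (semidefect S \<i>) \<phi> + proj (semidefect S (- \<i>)) (U \<phi>))"
    using kerU_shift by blast
  let ?x = "proj (semidefect S \<i>) \<phi>" and ?y = "proj (semidefect S (- \<i>)) (U \<phi>)"
  have "?x \<in> H0" "?y \<in> H0"
    using N'.proj_in[of \<i> \<phi>] N'.proj_in[of "- \<i>" "U \<phi>"] semidefect_eq[OF i_eq] semidefect_eq[OF minus_i_eq] by blast+
  then have "proj H0 (\<i> *\<^sub>C (?x + ?y)) = \<i> *\<^sub>C (?x + ?y)"
    by (simp add: H0.proj_id H0.proj_scale H0.proj_add)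
  then have "b = proj H0 (k + g') + \<i> *\<^sub>C (?x + ?y)"
    by (simp add: g(3) f(4) s(4) H0.proj_add proj_H0_codom[OF s(2)])
  moreover have "a = (f + f') + (?x - ?y)" by (simp add: f(3) s(3))
  ultimately show "(a, b) \<in> vn_ext \<i> (core_op S) (U0 S U)"
    using vn_extI[OF core_opI[OF operator_inD(4)[OF op f(1) s(1)]] U0I[OF \<open>\<phi> \<in> kerU S U\<close>], of \<i>] by simp
next
  fix a b assume "(a, b) \<in> vn_ext \<i> (core_op S) (U0 S U)"
  then obtain f k x y where f: "(f, k) \<in> core_op S" "(x, y) \<in> U0 S U" "a = f + (x - y)" "b = k + \<i> *\<^sub>C (x + y)"
    by (rule vn_extE)
  obtain g where g: "(f, g) \<in> S" "k = proj H0 g" using f(1) by (rule core_opE)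
  obtain \<phi> where \<phi>: "\<phi> \<in> kerU S U" "x = proj (semidefect S \<i>) \<phi>" "y = proj (semidefect S (- \<i>)) (U \<phi>)"
    using f(2) by (rule U0E)
  obtain f' g' h where s: "(f', g') \<in> S" "h \<in> codom_space S" "\<phi> - U \<phi> = f' + (x - y)"
      "\<i> *\<^sub>C (\<phi> + U \<phi>) = (g' + h) + \<i> *\<^sub>C (x + y)"
    using kerU_shift[OF \<phi>(1)] unfolding \<phi>(2,3) by blast
  have xy: "x \<in> H0" "y \<in> H0" using U0_mem[OF f(2)] semidefect_eq[OF i_eq] semidefect_eq[OF minus_i_eq] by blast+
  then have *: "proj H0 (\<i> *\<^sub>C (x + y)) = \<i> *\<^sub>C (x + y)"
    by (simp add: H0.proj_id H0.proj_scale H0.proj_add)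
  have "((f - f') + (\<phi> - U \<phi>), (g - g') + \<i> *\<^sub>C (\<phi> + U \<phi>)) \<in> T"
    using operator_in_diff[OF op g(1) s(1)] kerU_defect[OF \<phi>(1)] by (intro vn_extI) auto
  moreover have "(f - f') + (\<phi> - U \<phi>) = a" by (simp add: f(3) s(3))
  moreover have "a \<in> H0"
    using xy Domain_subset_H0[OF g(1)] by (simp add: f(3) cvs.subspace_add[OF H0.subspace] cvs.subspace_diff[OF H0.subspace])
  moreover have "proj H0 ((g - g') + \<i> *\<^sub>C (\<phi> + U \<phi>)) = b"
    unfolding s(4) f(4) g(2) H0.proj_add[of "g - g'"] H0.proj_add[of "g' + h"] H0.proj_add[of g' h] H0.proj_diff *
      proj_H0_codom[OF s(2)] by simp
  ultimately show "(a, b) \<in> compression H0 T" unfolding compression_def by blast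
qed

end

subsection \<open>Maximality and adjoints of von Neumann extensions\<close>

text \<open>Shifting a value of the extension by s times its argument eliminates y and leaves the
  range of A + s plus a multiple of x. All factors 2 s below originate here.\<close>

lemma vn_ext_shift: "(g + s *\<^sub>C (x + y)) + s *\<^sub>C (f + (x - y)) = (g + s *\<^sub>C f) + (2 * s) *\<^sub>C x"
  by (simp add: scaleC_2 scaleC_add_right cvs.scale_right_diff_distrib)

text \<open>An abstraction shared by \<open>S\<close> in the whole space and its core in
  \<open>H0\<close>. The conditions say that \<open>K\<close> is the orthogonal sum of the range of
  A + \<i> and \<open>Np\<close>, and of the range of A - \<i> and \<open>Nm\<close>.\<close>

locale deficiency_pair =
  fixes A :: "('a::complex_hilbert \<times> 'a) set" and K Np Nm :: "'a set"
  assumes symA: "symmetric_in K A"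
    and subspK: "cvs.subspace K"
    and Np: "closed_csubspace Np" and Nm: "closed_csubspace Nm"
    and NpK: "Np \<subseteq> K" and NmK: "Nm \<subseteq> K"
    and Np_cinner: "\<And>x f g. x \<in> Np \<Longrightarrow> (f, g) \<in> A \<Longrightarrow> cinner x g = \<i> * cinner x f"
    and Nm_cinner: "\<And>x f g. x \<in> Nm \<Longrightarrow> (f, g) \<in> A \<Longrightarrow> cinner x g = - \<i> * cinner x f"
    and decomp_p: "\<And>x. x \<in> K \<Longrightarrow> \<exists>f g. \<exists>n\<in>Np. (f, g) \<in> A \<and> x = (g + \<i> *\<^sub>C f) + n"
    and decomp_m: "\<And>x. x \<in> K \<Longrightarrow> \<exists>f g. \<exists>n\<in>Nm. (f, g) \<in> A \<and> x = (g + (- \<i>) *\<^sub>C f) + n"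
begin

sublocale Np: closed_csubspace Np by (rule Np)
sublocale Nm: closed_csubspace Nm by (rule Nm)

lemma opA: "operator_in K A"
  using symA by (simp add: symmetric_in_def)

lemma range_unique_p: "n \<in> Np \<Longrightarrow> (f, g) \<in> A \<Longrightarrow> n = g + \<i> *\<^sub>C f \<Longrightarrow> n = 0"
  using Np_cinner[of n f g] cinner_self_eq_0[of n] by (simp add: cinner_add_right cinner_scaleC_right)

lemma range_unique_m: "n \<in> Nm \<Longrightarrow> (f, g) \<in> A \<Longrightarrow> n = g + (- \<i>) *\<^sub>C f \<Longrightarrow> n = 0"
  using Nm_cinner[of n f g] cinner_self_eq_0[of n] by (simp add: cinner_diff_right cinner_scaleC_right)

text \<open>By \<open>vn_ext_shift\<close> the shifted value determines x, since the range of A +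
  \<i> meets \<open>Np\<close> only in 0. Domains of parameters are recovered from extensions in
  this way.\<close>

lemma vn_ext_domain_p:
  assumes G: "G \<subseteq> Np \<times> B" and ab: "(a, b) \<in> vn_ext \<i> A G" and n: "n \<in> Np"
    and eq: "b + \<i> *\<^sub>C a = (2 * \<i>) *\<^sub>C n"
  shows "n \<in> Domain G"
proof -
  obtain f g x y where 1: "(f, g) \<in> A" "(x, y) \<in> G" "a = f + (x - y)" "b = g + \<i> *\<^sub>C (x + y)"
    using ab by (rule vn_extE)
  have "(2 * \<i>) *\<^sub>C n = (g + \<i> *\<^sub>C f) + (2 * \<i>) *\<^sub>C x"
    using eq unfolding 1(3,4) vn_ext_shift by simp
  then have "(2 * \<i>) *\<^sub>C (n - x) = g + \<i> *\<^sub>C f" by (simp add: cvs.scale_right_diff_distrib)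
  moreover have "(2 * \<i>) *\<^sub>C (n - x) \<in> Np"
    using n G 1(2) by (intro cvs.subspace_scale[OF Np.subspace] cvs.subspace_diff[OF Np.subspace]) auto
  ultimately have "(2 * \<i>) *\<^sub>C (n - x) = 0" using range_unique_p[OF _ 1(1)] by blast
  then show ?thesis using 1(2) by auto
qed

lemma vn_ext_domain_m:
  assumes G: "G \<subseteq> Nm \<times> B" and ab: "(a, b) \<in> vn_ext (- \<i>) A G" and n: "n \<in> Nm"
    and eq: "b + (- \<i>) *\<^sub>C a = (2 * (- \<i>)) *\<^sub>C n"
  shows "n \<in> Domain G"
proof -
  obtain f g x y where 1: "(f, g) \<in> A" "(x, y) \<in> G" "a = f + (x - y)" "b = g + (- \<i>) *\<^sub>C (x + y)"
    using ab by (rule vn_extE)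
  have "(2 * (- \<i>)) *\<^sub>C n = (g + (- \<i>) *\<^sub>C f) + (2 * (- \<i>)) *\<^sub>C x"
    using eq unfolding 1(3,4) vn_ext_shift by simp
  then have "(2 * (- \<i>)) *\<^sub>C (n - x) = g + (- \<i>) *\<^sub>C f" by (simp only: cvs.scale_right_diff_distrib add_diff_cancel_right')
  moreover have "(2 * (- \<i>)) *\<^sub>C (n - x) \<in> Nm"
    using n G 1(2) by (intro cvs.subspace_scale[OF Nm.subspace] cvs.subspace_diff[OF Nm.subspace]) auto
  ultimately have "(2 * (- \<i>)) *\<^sub>C (n - x) = 0" using range_unique_m[OF _ 1(1)] by blast
  then show ?thesis using 1(2) by auto
qed

lemma vn_ext_range_p:
  assumes x: "x \<in> K" and dom: "Np \<subseteq> Domain G"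
  shows "\<exists>(a, b)\<in>vn_ext \<i> A G. x = b + \<i> *\<^sub>C a"
proof -
  obtain f g n where 1: "(f, g) \<in> A" "n \<in> Np" "x = (g + \<i> *\<^sub>C f) + n" using decomp_p[OF x] by blast
  \<comment> \<open>The scaling compensates the factor in \<open>vn_ext_shift\<close>.\<close>
  have "(1 / (2 * \<i>)) *\<^sub>C n \<in> Domain G" using dom cvs.subspace_scale[OF Np.subspace 1(2)] by blast
  then obtain y where y: "((1 / (2 * \<i>)) *\<^sub>C n, y) \<in> G" by blast
  show ?thesis
    by (rule bexI[OF _ vn_extI[OF 1(1) y]]) (simp only: prod.case vn_ext_shift, simp add: 1(3) scaleC_scaleC)
qed

lemma vn_ext_range_m:
  assumes x: "x \<in> K" and dom: "Nm \<subseteq> Domain G"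
  shows "\<exists>(a, b)\<in>vn_ext (- \<i>) A G. x = b + (- \<i>) *\<^sub>C a"
proof -
  obtain f g n where 1: "(f, g) \<in> A" "n \<in> Nm" "x = (g + (- \<i>) *\<^sub>C f) + n" using decomp_m[OF x] by blast
  have "(1 / (2 * (- \<i>))) *\<^sub>C n \<in> Domain G" using dom cvs.subspace_scale[OF Nm.subspace 1(2)] by blast
  then obtain y where y: "((1 / (2 * (- \<i>))) *\<^sub>C n, y) \<in> G" by blast
  show ?thesis
    by (rule bexI[OF _ vn_extI[OF 1(1) y]]) (simp only: prod.case vn_ext_shift, simp add: 1(3) scaleC_scaleC)
qed

text \<open>Stated for a single pair (a, b) rather than for an operator, so that pairs not yet known
  to lie in \<open>H\<close> can be tested in \<open>adjoint_vn_ext_iff\<close>.\<close>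

lemma adjoint_memI:
  assumes a: "a \<in> Nm" and b: "b \<in> Np" and G: "G \<subseteq> Np \<times> Nm"
    and adj: "\<And>x y. (x, y) \<in> G \<Longrightarrow> cinner y a = cinner x b" and fg: "(f, g) \<in> A"
  shows "(f + (a - b), g + (- \<i>) *\<^sub>C (a + b)) \<in> adjoint_in K (vn_ext \<i> A G)"
proof -
  have "a \<in> K" "b \<in> K" "f \<in> K" "g \<in> K" using a b NpK NmK operator_inD(1,2)[OF opA fg] by auto
  then have mem: "f + (a - b) \<in> K" "g + (- \<i>) *\<^sub>C (a + b) \<in> K"
    by (simp_all add: cvs.subspace_add[OF subspK] cvs.subspace_diff[OF subspK] cvs.subspace_scale[OF subspK])
  have "cinner k (f + (a - b)) = cinner u (g + (- \<i>) *\<^sub>C (a + b))" if "(u, k) \<in> vn_ext \<i> A G" for u k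
  proof -
    obtain f' g' x y where 1: "(f', g') \<in> A" "(x, y) \<in> G" "u = f' + (x - y)" "k = g' + \<i> *\<^sub>C (x + y)"
      using \<open>(u, k) \<in> vn_ext \<i> A G\<close> by (rule vn_extE)
    then have "x \<in> Np" "y \<in> Nm" using G by auto
    moreover have "cinner g' a = \<i> * cinner f' a" "cinner g' b = - \<i> * cinner f' b"
      using arg_cong[OF Nm_cinner[OF a 1(1)], of cnj] arg_cong[OF Np_cinner[OF b 1(1)], of cnj]
      by (simp_all flip: cinner_commute)
    ultimately show ?thesis
      using Np_cinner[OF _ fg, of x] Nm_cinner[OF _ fg, of y] symmetric_in_cinner[OF symA 1(1) fg] adj[OF 1(2)]
      by (simp add: 1(3,4) cinner_simps algebra_simps)
  qed
  then show ?thesis using mem by (auto simp: adjoint_in_def)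
qed

lemma adjoint_vn_ext_subset:
  assumes G: "G \<subseteq> Np \<times> Nm" and H: "H \<subseteq> Nm \<times> Np"
    and adj: "\<And>x y a b. (x, y) \<in> G \<Longrightarrow> (a, b) \<in> H \<Longrightarrow> cinner y a = cinner x b"
  shows "vn_ext (- \<i>) A H \<subseteq> adjoint_in K (vn_ext \<i> A G)"
proof (rule subrelI)
  fix u v assume "(u, v) \<in> vn_ext (- \<i>) A H"
  then obtain f g a b where 1: "(f, g) \<in> A" "(a, b) \<in> H" "u = f + (a - b)" "v = g + (- \<i>) *\<^sub>C (a + b)"
    by (rule vn_extE)
  then show "(u, v) \<in> adjoint_in K (vn_ext \<i> A G)"
    using H adjoint_memI[OF _ _ G adj[OF _ 1(2)] 1(1)] by auto
qed

lemma adjoint_vn_ext_eqI: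
  assumes G: "G \<subseteq> Np \<times> Nm" and H: "H \<subseteq> Nm \<times> Np"
    and adj: "\<And>x y a b. (x, y) \<in> G \<Longrightarrow> (a, b) \<in> H \<Longrightarrow> cinner y a = cinner x b"
    and zero: "(0, 0) \<in> G" and dense: "closure (Domain G) = Np" and dom: "Domain H = Nm"
  shows "vn_ext (- \<i>) A H = adjoint_in K (vn_ext \<i> A G)"
proof (rule equalityI[OF adjoint_vn_ext_subset[OF G H adj]])
  let ?T = "vn_ext \<i> A G"
  show "adjoint_in K ?T \<subseteq> vn_ext (- \<i>) A H"
  proof (rule subrelI)
    fix x y assume xy: "(x, y) \<in> adjoint_in K ?T"
    then have "x \<in> K" "y \<in> K" by (auto simp: adjoint_in_def)
    then have "y + (- \<i>) *\<^sub>C x \<in> K" by (intro cvs.subspace_add[OF subspK] cvs.subspace_scale[OF subspK])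
    then obtain x' y' where 1: "(x', y') \<in> vn_ext (- \<i>) A H" "y + (- \<i>) *\<^sub>C x = y' + (- \<i>) *\<^sub>C x'"
      using vn_ext_range_m[of _ H] dom by blast
    then have xy': "(x', y') \<in> adjoint_in K ?T" using adjoint_vn_ext_subset[OF G H adj] by blast
    \<comment> \<open>An element of the extension with the same image under the shift by -\<i> has
      been subtracted, so the adjoint relation sends \<open>u\<close> to \<i> u and \<open>u\<close>
      is orthogonal to the range of the extension shifted by \<i>.\<close>
    define u where "u = x - x'"
    have "x' \<in> K" using xy' by (auto simp: adjoint_in_def)
    then have "u \<in> K" using \<open>x \<in> K\<close> by (simp add: u_def cvs.subspace_diff[OF subspK])
    have y: "y - y' = \<i> *\<^sub>C u" using 1(2) by (simp add: u_def cvs.scale_right_diff_distrib algebra_simps)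
    have ortho: "cinner (k + \<i> *\<^sub>C f) u = 0" if "(f, k) \<in> ?T" for f k
    proof -
      have "cinner k x = cinner f y" "cinner k x' = cinner f y'"
        using xy xy' that by (auto simp: adjoint_in_def)
      then have "cinner k u = cinner f (y - y')" by (simp add: u_def cinner_diff_right)
      then show ?thesis by (simp add: y cinner_simps)
    qed
    obtain f g n where n: "(f, g) \<in> A" "n \<in> Np" "u = (g + \<i> *\<^sub>C f) + n"
      using decomp_p[OF \<open>u \<in> K\<close>] by blast
    \<comment> \<open>Testing with (0, 0) in \<open>G\<close> removes the component of u in the
      range of A + \<i>, so u lies in \<open>Np\<close>. Testing with f = 0 then makes u orthogonal
      to the dense domain of \<open>G\<close>.\<close>
    have "cinner (g + \<i> *\<^sub>C f) u = 0" using ortho vn_extI[OF n(1) zero, of \<i>] by simp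
    moreover have "cinner n (g + \<i> *\<^sub>C f) = 0" using Np_cinner[OF n(2,1)] by (simp add: cinner_simps)
    then have "cinner (g + \<i> *\<^sub>C f) n = 0" using cinner_commute[of "g + \<i> *\<^sub>C f" n] by simp
    ultimately have "cinner (g + \<i> *\<^sub>C f) (g + \<i> *\<^sub>C f) = 0"
      unfolding n(3) by (simp only: cinner_add_right[of _ "g + \<i> *\<^sub>C f" n] add_0_right)
    then have "u = n" using n(3) by simp
    have "cinner z u = 0" if "(z, w) \<in> G" for z w
      using ortho[OF vn_extI[OF operator_inD(3)[OF opA] that]]
      unfolding vn_ext_shift by (simp add: cinner_simps)
    then have "u \<in> orth (closure (Domain G))" unfolding orth_closure by (auto simp: orth_iff')
    then have "cinner u u = 0" using n(2) \<open>u = n\<close> dense orthD by blast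
    then have "u = 0" by simp
    then show "(x, y) \<in> vn_ext (- \<i>) A H" using 1(1) y by (simp add: u_def)
  qed
qed

text \<open>The injectivity hypothesis stands for \<open>A\<close> being densely defined in \<open>K\<close>.\<close>

context
  assumes inj: "\<And>x y g. x \<in> Np \<Longrightarrow> y \<in> Nm \<Longrightarrow> (x - y, g) \<in> A \<Longrightarrow> x = 0"
begin

lemma dissipative_vn_ext:
  assumes G: "contraction_graph Np Nm G"
  shows "dissipative_in K (vn_ext \<i> A G)"
proof (rule dissipative_in_vn_ext[OF subspK symA])
  show "operator_in UNIV G" using G by (simp add: contraction_graph_def)
  show "G \<subseteq> K \<times> K" using G NpK NmK by (auto simp: contraction_graph_def)
  show "norm y \<le> norm x" if "(x, y) \<in> G" for x y using G that by (auto simp: contraction_graph_def)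
  show "cinner x g = \<i> * cinner x f" "cinner y g = - \<i> * cinner y f"
    if "(x, y) \<in> G" "(f, g) \<in> A" for x y f g
    using G that Np_cinner Nm_cinner unfolding contraction_graph_def by blast+
  show "x = 0" if "(x, y) \<in> G" "(x - y, g) \<in> A" for x y g
    using G that inj unfolding contraction_graph_def by blast
qed

text \<open>A contraction defined on all of \<open>Np\<close> and extending \<open>G\<close> gives a
  dissipative extension; maximality makes it coincide with the given one, and
  \<open>vn_ext_domain_p\<close> recovers every n. Conversely a full domain makes the range of the
  extension shifted by \<i> all of \<open>K\<close>.\<close>

lemma maximal_dissipative_vn_ext_iff:
  assumes G: "contraction_graph Np Nm G"
  shows "maximal_dissipative_in K (vn_ext \<i> A G) \<longleftrightarrow> Domain G = Np"
proof
  assume max: "maximal_dissipative_in K (vn_ext \<i> A G)"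
  obtain W where W: "contraction_on Np Nm W" "\<And>x y. (x, y) \<in> G \<Longrightarrow> W x = y"
    using contraction_graph_extend[OF Np Nm G] by blast
  let ?G = "{(x, W x) | x. x \<in> Np}"
  have GN: "G \<subseteq> Np \<times> Nm" using G by (simp add: contraction_graph_def)
  have "G \<subseteq> ?G" using W(2) GN by fastforce
  then have "vn_ext \<i> A G \<subseteq> vn_ext \<i> A ?G" unfolding vn_ext_def by blast
  moreover have "dissipative_in K (vn_ext \<i> A ?G)"
    by (rule dissipative_vn_ext[OF contraction_graph_of_on[OF Np W(1)]])
  ultimately have eq: "vn_ext \<i> A ?G = vn_ext \<i> A G" using max by (auto simp: maximal_dissipative_in_def)
  have "n \<in> Domain G" if n: "n \<in> Np" for n
  proof (rule vn_ext_domain_p[OF GN _ n])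
    show "(0 + (n - W n), 0 + \<i> *\<^sub>C (n + W n)) \<in> vn_ext \<i> A G"
      unfolding eq[symmetric] using n operator_inD(3)[OF opA] by (intro vn_extI) auto
    show "(0 + \<i> *\<^sub>C (n + W n)) + \<i> *\<^sub>C (0 + (n - W n)) = (2 * \<i>) *\<^sub>C n"
      unfolding vn_ext_shift by simp
  qed
  then show "Domain G = Np" using GN by auto
next
  assume "Domain G = Np"
  then show "maximal_dissipative_in K (vn_ext \<i> A G)"
    using vn_ext_range_p[of _ G] by (intro maximal_dissipative_inI subspK dissipative_vn_ext G) auto
qed

lemma adjoint_vn_ext_iff:
  assumes G: "contraction_graph Np Nm G" and H: "contraction_graph Nm Np H"
    and adj: "\<And>x y a b. (x, y) \<in> G \<Longrightarrow> (a, b) \<in> H \<Longrightarrow> cinner y a = cinner x b"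
  shows "vn_ext (- \<i>) A H = adjoint_in K (vn_ext \<i> A G) \<longleftrightarrow> closure (Domain G) = Np \<and> Domain H = Nm"
proof
  have GN: "G \<subseteq> Np \<times> Nm" and HN: "H \<subseteq> Nm \<times> Np" and opG: "operator_in UNIV G"
    and le: "\<And>x y. (x, y) \<in> H \<Longrightarrow> norm y \<le> norm x"
    using G H by (auto simp: contraction_graph_def)
  {
    assume "closure (Domain G) = Np \<and> Domain H = Nm"
    then show "vn_ext (- \<i>) A H = adjoint_in K (vn_ext \<i> A G)"
      by (intro adjoint_vn_ext_eqI[OF GN HN adj operator_inD(3)[OF opG]]) auto
  }
  assume eq: "vn_ext (- \<i>) A H = adjoint_in K (vn_ext \<i> A G)"
  note A0 = operator_inD(3)[OF opA]
  have "v = 0" if v: "v \<in> Np" "v \<in> orth (Domain G)" for v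
  proof -
    \<comment> \<open>Orthogonality of v to the domain of \<open>G\<close> is the adjoint relation
      for the pair (0, v). The resulting element vanishes under the shift by -\<i>, so its
      \<open>H\<close> part is zero and -v lies in the domain of \<open>A\<close>.\<close>
    have "(0 + (0 - v), 0 + (- \<i>) *\<^sub>C (0 + v)) \<in> adjoint_in K (vn_ext \<i> A G)"
      by (rule adjoint_memI[OF cvs.subspace_0[OF Nm.subspace] v(1) GN _ A0])
         (use v(2) in \<open>auto simp: orth_iff'\<close>)
    then obtain f g a b where 1: "(f, g) \<in> A" "(a, b) \<in> H" "0 + (0 - v) = f + (a - b)"
        "0 + (- \<i>) *\<^sub>C (0 + v) = g + (- \<i>) *\<^sub>C (a + b)"
      unfolding eq[symmetric] by (rule vn_extE)
    have "(0 + (- \<i>) *\<^sub>C (0 + v)) + (- \<i>) *\<^sub>C (0 + (0 - v)) = 0 + (2 * (- \<i>)) *\<^sub>C 0"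
      unfolding vn_ext_shift by simp
    then have "(g + (- \<i>) *\<^sub>C f) + (2 * (- \<i>)) *\<^sub>C a = 0"
      unfolding 1(3,4) vn_ext_shift by simp
    then have "(2 * \<i>) *\<^sub>C a = g + (- \<i>) *\<^sub>C f" by (simp add: add_eq_0_iff eq_neg_iff_add_eq_0 algebra_simps)
    then have "(2 * \<i>) *\<^sub>C a = 0"
      using range_unique_m[OF cvs.subspace_scale[OF Nm.subspace] 1(1)] 1(2) HN by blast
    then have "a = 0" by simp
    then have "b = 0" using le[OF 1(2)] by simp
    with \<open>a = 0\<close> 1(1,3) have "(- v - 0, g) \<in> A" by simp
    then have "- v = 0"
      using inj[of "- v" 0] cvs.subspace_neg[OF Np.subspace v(1)] cvs.subspace_0[OF Nm.subspace] by blast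
    then show ?thesis by simp
  qed
  note trivial = this
  interpret D: closed_csubspace "closure (Domain G)"
    by (rule closed_csubspace_closure[OF subspace_Domain[OF opG]])
  have DNp: "closure (Domain G) \<subseteq> Np" using GN by (intro closure_minimal Np.closed) auto
  have "n \<in> closure (Domain G)" if n: "n \<in> Np" for n
  proof -
    have "n - proj (closure (Domain G)) n = 0"
      using n DNp D.proj_in[of n] D.proj_orth[of n]
      by (intro trivial cvs.subspace_diff[OF Np.subspace]) (auto simp: orth_closure)
    then show ?thesis using D.proj_in[of n] by simp
  qed
  then have dense: "closure (Domain G) = Np" using DNp by blast
  obtain W where W: "contraction_on Np Nm W" "\<And>x y. (x, y) \<in> G \<Longrightarrow> W x = y"
    using contraction_graph_extend[OF Np Nm G] by blast
  have "n \<in> Domain H" if n: "n \<in> Nm" for n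
  proof -
    \<comment> \<open>The adjoint of the full contraction \<open>W\<close> supplies, for each n, a
      partner satisfying the adjoint relation with \<open>G\<close>.\<close>
    define v where "v = adjoint_on Np W n"
    have v: "v \<in> Np" "\<And>x y. (x, y) \<in> G \<Longrightarrow> cinner y n = cinner x v"
      using adjoint_on_props[OF Np W(1), where y = n] W(2) GN unfolding v_def by blast+
    have "(0 + (n - v), 0 + (- \<i>) *\<^sub>C (n + v)) \<in> vn_ext (- \<i>) A H"
      unfolding eq by (rule adjoint_memI[OF n v(1) GN v(2) A0])
    then show ?thesis
      by (rule vn_ext_domain_m[OF HN _ n]) (simp only: vn_ext_shift, simp)
  qed
  then show "closure (Domain G) = Np \<and> Domain H = Nm" using dense HN by auto
qed

text \<open>A closed dissipative operator has closed range after the shift by \<i>. This range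
  contains 2 \<i> x for every x in the domain of \<open>G\<close>, hence also the limits.\<close>

lemma Domain_closed_of_closed_vn_ext:
  assumes G: "contraction_graph Np Nm G" and cl: "closed (vn_ext \<i> A G)" and dense: "closure (Domain G) = Np"
  shows "Domain G = Np"
proof -
  let ?R = "{b + \<i> *\<^sub>C a | a b. (a, b) \<in> vn_ext \<i> A G}"
  have GN: "G \<subseteq> Np \<times> Nm" using G by (simp add: contraction_graph_def)
  have R: "closed ?R" by (rule dissipative_in_closed_range[OF dissipative_vn_ext[OF G] cl])
  have "n \<in> Domain G" if n: "n \<in> Np" for n
  proof -
    obtain x where x: "\<forall>k. x k \<in> Domain G" "x \<longlonglongrightarrow> n"
      using n dense closure_sequential by blast
    have "(2 * \<i>) *\<^sub>C x k \<in> ?R" for k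
    proof -
      obtain y where "(x k, y) \<in> G" using x(1) by blast
      then have "(0 + (x k - y), 0 + \<i> *\<^sub>C (x k + y)) \<in> vn_ext \<i> A G"
        by (intro vn_extI operator_inD(3)[OF opA])
      moreover have "(2 * \<i>) *\<^sub>C x k = (0 + \<i> *\<^sub>C (x k + y)) + \<i> *\<^sub>C (0 + (x k - y))"
        unfolding vn_ext_shift by simp
      ultimately show ?thesis by blast
    qed
    moreover have "(\<lambda>k. (2 * \<i>) *\<^sub>C x k) \<longlonglongrightarrow> (2 * \<i>) *\<^sub>C n" by (intro tendsto_scaleC x(2))
    ultimately have "(2 * \<i>) *\<^sub>C n \<in> ?R" by (rule closed_sequentially[OF R, of "\<lambda>k. (2 * \<i>) *\<^sub>C x k"])
    then obtain a b where "(a, b) \<in> vn_ext \<i> A G" "(2 * \<i>) *\<^sub>C n = b + \<i> *\<^sub>C a" by blast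
    then show ?thesis using vn_ext_domain_p[OF GN _ n] by metis
  qed
  then show ?thesis using GN by auto
qed

end

end

section \<open>The two instances: \<open>S\<close> in the whole space and its core in
  \<open>H0\<close>\<close>

context regular_op
begin

text \<open>This instance serves the adjoint formula \<open>adjoint_ext\<close>. The later results
  use the instance \<open>core\<close>, where \<open>core_inj\<close> provides the injectivity that
  \<open>proj_codom_diff_in\<close> obstructs for \<open>S\<close> itself.\<close>

sublocale full: deficiency_pair S UNIV "defect S \<i>" "defect S (- \<i>)"
proof
  show "cvs.subspace (UNIV :: 'a set)" by (rule cvs.subspace_UNIV)
  show "\<exists>f g. \<exists>n\<in>defect S \<i>. (f, g) \<in> S \<and> x = (g + \<i> *\<^sub>C f) + n" for x
    using defect_decomp[of \<i> x] N.proj_in by blast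
  show "\<exists>f g. \<exists>n\<in>defect S (- \<i>). (f, g) \<in> S \<and> x = (g + (- \<i>) *\<^sub>C f) + n" for x
    using defect_decomp[of "- \<i>" x] N.proj_in by blast
qed (use sym defect_closed_csubspace defectD in \<open>blast+\<close>)

sublocale core: deficiency_pair "core_op S" H0 "semidefect S \<i>" "semidefect S (- \<i>)"
proof (rule deficiency_pair.intro)
  interpret N': closed_csubspace "semidefect S s" for s by (rule semidefect_closed_csubspace)
  show "\<exists>f g. \<exists>n\<in>semidefect S \<i>. (f, g) \<in> core_op S \<and> x = (g + \<i> *\<^sub>C f) + n" if "x \<in> H0" for x
    using core_decomp[OF _ that, of \<i>] N'.proj_in by blast
  show "\<exists>f g. \<exists>n\<in>semidefect S (- \<i>). (f, g) \<in> core_op S \<and> x = (g + (- \<i>) *\<^sub>C f) + n" if "x \<in> H0" for x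
    using core_decomp[OF _ that, of "- \<i>"] N'.proj_in by blast
  show "semidefect S \<i> \<subseteq> H0" "semidefect S (- \<i>) \<subseteq> H0" using semidefect_eq by auto
  show "x \<in> semidefect S \<i> \<Longrightarrow> (f, g) \<in> core_op S \<Longrightarrow> cinner x g = \<i> * cinner x f" for x f g
    by (rule semidefect_cinner_core) simp_all
  show "x \<in> semidefect S (- \<i>) \<Longrightarrow> (f, g) \<in> core_op S \<Longrightarrow> cinner x g = - \<i> * cinner x f" for x f g
    by (rule semidefect_cinner_core) simp_all
qed (rule core_symmetric H0.subspace semidefect_closed_csubspace | simp)+

lemma core_inj: "x \<in> semidefect S \<i> \<Longrightarrow> y \<in> semidefect S (- \<i>) \<Longrightarrow> (x - y, g) \<in> core_op S \<Longrightarrow> x = 0"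
  by (rule core_op_semidefect_inj[of \<i>]) simp_all

end

subsection \<open>The domain of the compression and the semi-deficiency subspaces\<close>

interpretation cvp: vector_space_pair
    "scaleC :: complex \<Rightarrow> 'a::complex_hilbert \<Rightarrow> 'a" "scaleC :: complex \<Rightarrow> 'b::complex_hilbert \<Rightarrow> 'b" ..

text \<open>The surjection \<open>E\<close> bounds the dimension of \<open>B\<close> by that of
  \<open>A\<close>. A vector of \<open>B\<close> outside the image of the injective map
  \<open>F\<close> would give one independent vector too many.\<close>

lemma finite_dim_image_eq:
  assumes fin: "finite_dim A" and A: "cvs.subspace A"
    and E: "Vector_Spaces.linear scaleC scaleC E" and F: "Vector_Spaces.linear scaleC scaleC F"
    and EA: "E ` A = B" and FA: "F ` A \<subseteq> B" and ker: "\<And>x. x \<in> A \<Longrightarrow> F x = 0 \<Longrightarrow> x = 0"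
  shows "F ` A = B"
proof (rule ccontr)
  assume "F ` A \<noteq> B"
  with FA obtain b where b: "b \<in> B" "b \<notin> F ` A" by blast
  obtain C where C: "C \<subseteq> A" "cvs.independent C" "A \<subseteq> cvs.span C"
    by (rule cvs.maximal_independent_subset)
  obtain D where D: "finite D" "A \<subseteq> cvs.span D" using fin by (auto simp: finite_dim_def)
  have finC: "finite C"
    using cvs.independent_span_bound[OF D(1) C(2)] C(1) D(2) by blast
  have spanC: "cvs.span C = A"
    using cvs.span_minimal[OF C(1) A] C(3) by blast
  have inj: "inj_on F A"
  proof (rule inj_onI)
    fix x y assume "x \<in> A" "y \<in> A" "F x = F y"
    then have "x - y = 0"
      by (intro ker cvs.subspace_diff[OF A]) (simp_all add: cvp.linear_diff[OF F])
    then show "x = y" by simp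
  qed
  have spanF: "cvs.span (F ` C) = F ` A"
    by (simp add: cvp.linear_span_image[OF F] spanC)
  have "cvs.independent (F ` C)"
    by (rule cvp.linear_independent_injective_image[OF F C(2)]) (simp add: spanC inj)
  then have ind: "cvs.independent (insert b (F ` C))"
    using b by (intro cvs.independent_insertI) (simp_all add: spanF)
  have "insert b (F ` C) \<subseteq> cvs.span (E ` C)"
    unfolding cvp.linear_span_image[OF E] spanC EA using b(1) FA C(1) by blast
  then have "card (insert b (F ` C)) \<le> card (E ` C)"
    using cvs.independent_span_bound[OF finite_imageI[OF finC] ind] by simp
  also have "\<dots> \<le> card C" by (rule card_image_le[OF finC])
  also have "card (insert b (F ` C)) = Suc (card C)"
  proof -
    have "b \<notin> F ` C" using b(2) C(1) by blast
    then show ?thesis using finC card_image[OF inj_on_subset[OF inj C(1)]] by simp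
  qed
  finally show False by simp
qed

context extension_param
begin

lemma U_zero: "U 0 = 0"
  using contraction_onD(4)[OF contr cvs.subspace_0[OF N.subspace], of 0] by simp

lemma extE:
  assumes "(a, b) \<in> T"
  obtains f g \<phi> where "(f, g) \<in> S" "\<phi> \<in> defect S \<i>" "a = f + (\<phi> - U \<phi>)" "b = g + \<i> *\<^sub>C (\<phi> + U \<phi>)"
  using assms by (auto elim!: vn_extE)

lemma extI:
  "(f, g) \<in> S \<Longrightarrow> \<phi> \<in> defect S \<i> \<Longrightarrow> (f + (\<phi> - U \<phi>), g + \<i> *\<^sub>C (\<phi> + U \<phi>)) \<in> T"
  by (rule vn_extI) auto

lemma Domain_compression: "Domain (compression H0 T) = Domain T \<inter> H0"
  by (auto simp: compression_def)

lemma direct_sum_kerU: "is_direct_sum (Domain T \<inter> H0) (Domain S) ((\<lambda>\<phi>. \<phi> - U \<phi>) ` kerU S U)"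
  unfolding is_direct_sum_def
proof (intro conjI equalityI subsetI)
  fix x assume "x \<in> Domain T \<inter> H0"
  then obtain y where "(x, y) \<in> T" "x \<in> H0" by blast
  then obtain f g \<phi> where 1: "(f, g) \<in> S" "\<phi> \<in> defect S \<i>" "x = f + (\<phi> - U \<phi>)" by (blast elim: extE)
  have "\<phi> - U \<phi> = x - f" by (simp add: 1(3))
  then have "\<phi> \<in> kerU S U"
    using 1(2) cvs.subspace_diff[OF H0.subspace \<open>x \<in> H0\<close> Domain_subset_H0[OF 1(1)]] by (simp add: kerU_eq)
  then show "x \<in> {a + b |a b. a \<in> Domain S \<and> b \<in> (\<lambda>\<phi>. \<phi> - U \<phi>) ` kerU S U}" using 1 by blast
next
  fix x assume "x \<in> {a + b |a b. a \<in> Domain S \<and> b \<in> (\<lambda>\<phi>. \<phi> - U \<phi>) ` kerU S U}"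
  then obtain f g \<phi> where 1: "(f, g) \<in> S" "\<phi> \<in> kerU S U" "x = f + (\<phi> - U \<phi>)" by blast
  then have "x \<in> Domain T" using extI kerU_defect by blast
  moreover have "x \<in> H0"
    using 1 Domain_subset_H0 cvs.subspace_add[OF H0.subspace] by (auto simp: kerU_eq)
  ultimately show "x \<in> Domain T \<inter> H0" by blast
next
  fix x assume "x \<in> Domain S \<inter> (\<lambda>\<phi>. \<phi> - U \<phi>) ` kerU S U"
  then obtain \<phi> g where "\<phi> \<in> kerU S U" "x = \<phi> - U \<phi>" "(x, g) \<in> S" by blast
  then show "x \<in> {0}" using param_inj kerU_defect U_zero by fastforce
next
  fix x :: 'a assume "x \<in> {0}"
  then show "x \<in> Domain S \<inter> (\<lambda>\<phi>. \<phi> - U \<phi>) ` kerU S U"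
    using operator_inD(3)[OF op] cvs.subspace_0[OF kerU_subspace] U_zero by (auto intro!: image_eqI[of _ _ 0])
qed

lemma direct_sum_U0: "is_direct_sum (Domain T \<inter> H0) (Domain S) ((\<lambda>(x, y). x - y) ` U0 S U)"
  unfolding is_direct_sum_def Domain_compression[symmetric] compression_ext
proof (intro conjI equalityI subsetI)
  fix a assume "a \<in> Domain (vn_ext \<i> (core_op S) (U0 S U))"
  then obtain b where "(a, b) \<in> vn_ext \<i> (core_op S) (U0 S U)" by blast
  then obtain f g x y where 1: "(f, g) \<in> core_op S" "(x, y) \<in> U0 S U" "a = f + (x - y)" by (rule vn_extE)
  moreover have "f \<in> Domain S" using 1(1) Domain_core_op by blast
  ultimately show "a \<in> {a + b |a b. a \<in> Domain S \<and> b \<in> (\<lambda>(x, y). x - y) ` U0 S U}" by force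
next
  fix a assume "a \<in> {a + b |a b. a \<in> Domain S \<and> b \<in> (\<lambda>(x, y). x - y) ` U0 S U}"
  then obtain f x y where "f \<in> Domain (core_op S)" "(x, y) \<in> U0 S U" "a = f + (x - y)"
    unfolding Domain_core_op by auto
  then show "a \<in> Domain (vn_ext \<i> (core_op S) (U0 S U))" using vn_extI by blast
next
  fix a assume a: "a \<in> Domain S \<inter> (\<lambda>(x, y). x - y) ` U0 S U"
  then obtain x y where 1: "(x, y) \<in> U0 S U" "a = x - y" by auto
  have "x - y \<in> Domain (core_op S)" using a by (simp add: Domain_core_op 1(2))
  then obtain g where "(x - y, g) \<in> core_op S" by blast
  then have "x = 0" using core_inj U0_mem[OF 1(1)] by blast
  then have "norm y \<le> 0" using 1(1) contraction_graph_U0 by (auto simp: contraction_graph_def)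
  then show "a \<in> {0}" using 1(2) \<open>x = 0\<close> by simp
next
  fix a :: 'a assume "a \<in> {0}"
  moreover have "(0, 0) \<in> U0 S U"
    using contraction_graph_U0 operator_inD(3) by (auto simp: contraction_graph_def)
  ultimately show "a \<in> Domain S \<inter> (\<lambda>(x, y). x - y) ` U0 S U"
    using operator_inD(3)[OF op] by (auto intro!: image_eqI[of _ _ "(0, 0)"])
qed

lemma image_U0:
  "(\<lambda>(x, y). x - y) ` U0 S U = (\<lambda>\<phi>. proj (semidefect S \<i>) \<phi> - proj (semidefect S (- \<i>)) (U \<phi>)) ` kerU S U"
  by (force simp: U0_def)

lemma compression_action:
  "\<forall>(f, g)\<in>core_op S. \<forall>(x, y)\<in>U0 S U. (f + (x - y), g + \<i> *\<^sub>C (x + y)) \<in> compression H0 T"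
  unfolding compression_ext by (blast intro: vn_extI)

lemma kerU_zero: "0 \<in> kerU S U"
  by (rule cvs.subspace_0[OF kerU_subspace])

lemma Domain_trivial_iff: "Domain T \<inter> H0 = Domain S \<longleftrightarrow> kerU S U = {0}"
proof
  assume eq: "Domain T \<inter> H0 = Domain S"
  have "\<phi> = 0" if "\<phi> \<in> kerU S U" for \<phi>
  proof -
    have "0 + (\<phi> - U \<phi>) \<in> Domain T \<inter> H0"
      using extI[OF operator_inD(3)[OF op] kerU_defect[OF that]] that by (auto simp: kerU_eq)
    then show ?thesis using param_inj[OF kerU_defect[OF that]] unfolding eq by auto
  qed
  then show "kerU S U = {0}" using kerU_zero by blast
next
  assume "kerU S U = {0}"
  then show "Domain T \<inter> H0 = Domain S" using direct_sum_kerU by (simp add: is_direct_sum_def U_zero)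
qed

text \<open>With no component in the first semi-deficiency subspace there is none in the second, by
  the norm bound; then \<phi> - U \<phi> lies in the domain of \<open>S\<close>.\<close>

lemma kerU_proj_semidefect_inj:
  assumes \<phi>: "\<phi> \<in> kerU S U" and 0: "proj (semidefect S \<i>) \<phi> = 0"
  shows "\<phi> = 0"
proof -
  have "proj (semidefect S (- \<i>)) (U \<phi>) = 0" using semidefect_norm_le[OF \<phi>] 0 by simp
  then obtain g where "(\<phi> - U \<phi>, g) \<in> S" using kerU_shift[OF \<phi>] 0 by auto
  then show ?thesis by (rule param_inj[OF kerU_defect[OF \<phi>]])
qed

lemma kerU_trivial_iff: "kerU S U = {0} \<longleftrightarrow> proj (semidefect S \<i>) ` kerU S U = {0}"
proof
  assume *: "proj (semidefect S \<i>) ` kerU S U = {0}"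
  have "\<phi> = 0" if "\<phi> \<in> kerU S U" for \<phi>
    using kerU_proj_semidefect_inj[OF that] * that by blast
  then show "kerU S U = {0}" using kerU_zero by blast
qed simp

text \<open>The parameter \<open>U0\<close> reduces to {(0, 0)}, so the compression is the core
  itself, whose range after the shift by \<i> is all of \<open>H0\<close>.\<close>

lemma semidefect_trivial:
  assumes triv: "semidefect S \<i> = {0}"
  shows "Domain T \<inter> H0 = Domain S" "maximal_symmetric_in H0 (compression H0 T)"
proof -
  have "proj (semidefect S \<i>) \<phi> = 0" for \<phi>
    using N'.proj_in[of \<i> \<phi>] by (simp add: triv)
  then have "proj (semidefect S \<i>) ` kerU S U = {0}"
    using kerU_zero by (auto simp: image_iff)
  then have K: "kerU S U = {0}" using kerU_trivial_iff by blast
  then show "Domain T \<inter> H0 = Domain S" by (simp add: Domain_trivial_iff)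
  have U00: "U0 S U = {(0, 0)}" by (simp add: U0_def K U_zero)
  have "compression H0 T = core_op S" unfolding compression_ext U00 by (simp add: vn_ext_def)
  moreover have "maximal_symmetric_in H0 (core_op S)"
  proof (rule maximal_symmetric_inI[OF H0.subspace core_symmetric])
    fix x assume "x \<in> H0"
    then show "\<exists>(f, g)\<in>core_op S. x = g + \<i> *\<^sub>C f" using core.decomp_p[of x] unfolding triv by auto
  qed
  ultimately show "maximal_symmetric_in H0 (compression H0 T)" by simp
qed

lemma maximal_dissipative_compression_iff:
  "maximal_dissipative_in H0 (compression H0 T) \<longleftrightarrow> proj (semidefect S \<i>) ` kerU S U = semidefect S \<i>"
  unfolding compression_ext Domain_U0[symmetric]
  by (rule core.maximal_dissipative_vn_ext_iff[OF core_inj contraction_graph_U0])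

text \<open>\<open>V\<^sub>i - P U\<close> is injective from \<open>\<LL>\<^sub>i\<close> to \<open>\<LL>\<^sub>-\<^sub>i\<close>, hence onto in finite dimension; this
  allows every vector of \<open>\<NN>'\<^sub>i\<close> to be completed to an element of the kernel.\<close>

lemma finite_codim_Domain_U0:
  assumes fin: "finite_dim (codom_space S)"
  shows "proj (semidefect S \<i>) ` kerU S U = semidefect S \<i>"
proof -
  define F where "F h = pN (- \<i>) h - proj (Lpart S (- \<i>)) (U (pN \<i> h))" for h
  have "F ` codom_space S = Lpart S (- \<i>)"
  proof (rule finite_dim_image_eq[OF fin L.subspace])
    show "Vector_Spaces.linear scaleC scaleC (pN (- \<i>))"
      by unfold_locales (simp_all add: N.proj_add N.proj_scale)
    have "F (x + y) = F x + F y" "F (c *\<^sub>C x) = c *\<^sub>C F x" for c x y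
      by (simp_all add: F_def N.proj_add N.proj_scale Lmi.proj_add Lmi.proj_scale
          contraction_onD[OF contr N.proj_in] cvs.scale_right_diff_distrib)
    then show "Vector_Spaces.linear scaleC scaleC F" by unfold_locales
    show "pN (- \<i>) ` codom_space S = Lpart S (- \<i>)" by (simp add: Lpart_def)
    show "F ` codom_space S \<subseteq> Lpart S (- \<i>)"
    proof
      fix y assume "y \<in> F ` codom_space S"
      then obtain h where h: "h \<in> codom_space S" "y = F h" by blast
      then have "pN (- \<i>) h \<in> Lpart S (- \<i>)" by (auto simp: Lpart_def)
      then show "y \<in> Lpart S (- \<i>)" by (simp add: h(2) F_def cvs.subspace_diff[OF Lmi.subspace])
    qed
    fix h assume h: "h \<in> codom_space S" and "F h = 0"
    then have eq: "proj (Lpart S (- \<i>)) (U (pN \<i> h)) = pN (- \<i>) h" by (simp add: F_def)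
    \<comment> \<open>The norm of U at this vector is at most that of its own projection
      \<open>pN (- \<i>) h\<close>, so the orthogonal part vanishes and U agrees with the isometry
      there.\<close>
    have "norm (U (pN \<i> h)) \<le> norm (pN (- \<i>) h)"
      using contraction_onD(2)[OF contr N.proj_in, of h] norm_proj_codom[OF i_eq h] by simp
    then have "(norm (U (pN \<i> h)))\<^sup>2 \<le> (norm (pN (- \<i>) h))\<^sup>2" by (simp add: power_mono)
    then have "U (pN \<i> h) = pN (- \<i>) h"
      using Lmi.norm_proj[of "U (pN \<i> h)"] unfolding eq by simp
    then have "pN \<i> h = 0"
      using h Viso_proj[OF i_eq h] by (intro ker) (auto simp: Lpart_def)
    then show "h = 0" by (rule proj_codom_inj[OF i_eq h])
  qed
  note surj = this
  have "n \<in> proj (semidefect S \<i>) ` kerU S U" if n: "n \<in> semidefect S \<i>" for n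
  proof -
    have nN: "n \<in> defect S \<i>" and "n \<in> orth (Lpart S \<i>)" using n by (auto simp: semidefect_def)
    then have n0: "proj (Lpart S \<i>) n = 0" by (simp add: Li.proj_0_iff)
    \<comment> \<open>The correction by \<open>pN \<i> h\<close> compensates the
      \<open>Lpart\<close> component of U n without changing the semi-deficiency component
      n.\<close>
    obtain h where h: "h \<in> codom_space S" "proj (Lpart S (- \<i>)) (U n) = F h"
      using surj Lmi.proj_in[of "U n"] by blast
    have hL: "pN \<i> h \<in> Lpart S \<i>" using h(1) by (auto simp: Lpart_def)
    have "proj (Lpart S (- \<i>)) (U (n + pN \<i> h)) = pN (- \<i>) h"
      by (simp add: contraction_onD(3)[OF contr nN N.proj_in] Lmi.proj_add h(2) F_def)
    moreover have "proj (Lpart S \<i>) (n + pN \<i> h) = pN \<i> h"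
      by (simp add: Li.proj_add n0 Li.proj_id[OF hL])
    ultimately have "n + pN \<i> h \<in> kerU S U"
      using Viso_proj[OF i_eq h(1)] cvs.subspace_add[OF N.subspace nN N.proj_in, of h] by (simp add: kerU_def)
    moreover have "proj (semidefect S \<i>) (n + pN \<i> h) = n"
      using N'.proj_0_iff[of \<i> "pN \<i> h"] Lpart_orth_semidefect[OF i_eq hL]
      by (simp add: N'.proj_add N'.proj_id[OF n])
    ultimately show ?thesis by (metis imageI)
  qed
  then show ?thesis using N'.proj_in by blast
qed

end

subsection \<open>Duality\<close>

lemma defect_op_neg: "defect (op_neg S) z = defect S (- z)"
proof (intro equalityI subsetI)
  fix x assume x: "x \<in> defect (op_neg S) z"
  show "x \<in> defect S (- z)"
  proof (rule defectI)
    fix f g assume "(f, g) \<in> S"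
    then show "cinner x g = - z * cinner x f" using defectD[OF x, of f "- g"]
      by (metis minus_minus cinner_minus(2) mult_minus_left op_neg_iff)
  qed
next
  fix x assume x: "x \<in> defect S (- z)"
  show "x \<in> defect (op_neg S) z"
  proof (rule defectI)
    fix f g assume "(f, g) \<in> op_neg S"
    then show "cinner x g = z * cinner x f" using defectD[OF x, of f "- g"] by simp
  qed
qed

lemma dom_space_op_neg: "dom_space (op_neg S) = dom_space S"
  by (simp add: dom_space_def)

lemma codom_space_op_neg: "codom_space (op_neg S) = codom_space S"
  by (simp add: codom_space_def dom_space_op_neg)

lemma Lpart_op_neg: "Lpart (op_neg S) z = Lpart S (- z)"
  by (simp add: Lpart_def defect_op_neg codom_space_op_neg)

lemma semidefect_op_neg: "semidefect (op_neg S) z = semidefect S (- z)"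
  by (simp add: semidefect_def defect_op_neg Lpart_op_neg)

lemma Viso_op_neg: "Viso (op_neg S) z = Viso S (- z)"
  by (simp add: fun_eq_iff Viso_def defect_op_neg codom_space_op_neg)

lemma kerU_op_neg: "kerU (op_neg S) (Uadj S U) = kerU_adj S U"
  by (auto simp: kerU_def kerU_adj_def defect_op_neg Lpart_op_neg Viso_op_neg)

lemma U0_op_neg: "U0 (op_neg S) (Uadj S U) = Us0 S U"
  by (simp add: U0_def Us0_def semidefect_op_neg kerU_op_neg)

lemma (in closed_csubspace) proj_minus: "proj K (- x) = - proj K x"
  using proj_diff[of 0 x] by simp

lemma closed_op_neg:
  assumes "closed (T :: ('a::complex_hilbert \<times> 'a) set)"
  shows "closed (op_neg T)"
proof -
  have "op_neg T = (\<lambda>p. (fst p, - snd p)) -` T" by auto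
  moreover have "continuous_on UNIV (\<lambda>p :: 'a \<times> 'a. (fst p, - snd p))"
    by (intro continuous_intros)
  ultimately show ?thesis using closed_vimage[OF assms] by simp
qed

context regular_op
begin

lemma core_op_op_neg: "core_op (op_neg S) = op_neg (core_op S)"
proof (intro equalityI subrelI)
  fix f g assume "(f, g) \<in> core_op (op_neg S)"
  then obtain k where "(f, - k) \<in> S" "g = proj H0 k" by (auto simp: core_op_def dom_space_op_neg)
  then show "(f, g) \<in> op_neg (core_op S)" using core_opI[of f "- k"] by (simp add: H0.proj_minus)
next
  fix f g assume "(f, g) \<in> op_neg (core_op S)"
  then obtain k where k: "(f, k) \<in> S" "- g = proj H0 k" by (auto elim: core_opE)
  then have "g = proj H0 (- k)" by (metis H0.proj_minus minus_minus)
  with k show "(f, g) \<in> core_op (op_neg S)"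
    unfolding core_op_def dom_space_op_neg by (intro CollectI exI[of _ f] exI[of _ "- k"]) simp
qed

lemma regular_op_op_neg: "regular_op (op_neg S)"
proof
  show "regular_symmetric (op_neg S)"
    using regular symmetric_in_op_neg[OF cvs.subspace_UNIV sym]
    by (simp add: regular_symmetric_def core_op_op_neg closed_op_neg)
qed

lemma compression_op_neg: "compression H0 (op_neg B) = op_neg (compression H0 B)"
proof (intro equalityI subrelI)
  fix f g assume "(f, g) \<in> compression H0 (op_neg B)"
  then obtain k where "(f, - k) \<in> B" "f \<in> H0" "- g = proj H0 (- k)" by (auto simp: compression_def H0.proj_minus)
  then show "(f, g) \<in> op_neg (compression H0 B)" by (auto simp: compression_def)
next
  fix f g assume "(f, g) \<in> op_neg (compression H0 B)"
  then obtain k where k: "(f, k) \<in> B" "f \<in> H0" "- g = proj H0 k" by (auto simp: compression_def)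
  then have "g = proj H0 (- k)" by (metis H0.proj_minus minus_minus)
  with k show "(f, g) \<in> compression H0 (op_neg B)"
    unfolding compression_def by (intro CollectI exI[of _ f] exI[of _ "- k"]) simp
qed

end

context extension_param
begin

lemma contr_adj: "contraction_on (defect S (- \<i>)) (defect S \<i>) (Uadj S U)"
  by (rule contraction_on_adjoint[OF defect_closed_csubspace defect_closed_csubspace contr])

lemma cinner_adj: "\<phi> \<in> defect S \<i> \<Longrightarrow> cinner (U \<phi>) \<psi> = cinner \<phi> (Uadj S U \<psi>)"
  by (rule adjoint_on_props(2)[OF defect_closed_csubspace contr])

text \<open>The equality case of contractivity: with y the adjoint value, y and \<psi> have equal
  norms and U y pairs with \<psi> to the squared norm of y. Hence U y = \<psi>, and the kernel
  condition on \<open>U\<close> applies to y.\<close>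

lemma ker_adj:
  assumes \<psi>: "\<psi> \<in> Lpart S (- \<i>)" and eq: "Uadj S U \<psi> = Viso S (- \<i>) \<psi>"
  shows "\<psi> = 0"
proof -
  obtain h where h: "h \<in> codom_space S" "\<psi> = pN (- \<i>) h" using \<psi> by (auto simp: Lpart_def)
  let ?y = "pN \<i> h"
  have adj: "Uadj S U \<psi> = ?y" using eq Viso_proj[OF minus_i_eq h(1)] by (simp add: h(2))
  have "cinner (U ?y) \<psi> = cinner ?y ?y" using cinner_adj[OF N.proj_in, of h \<psi>] by (simp add: adj)
  then have "(norm (U ?y - \<psi>))\<^sup>2 = (norm (U ?y))\<^sup>2 + (norm \<psi>)\<^sup>2 - 2 * (norm ?y)\<^sup>2"
    by (simp add: power2_norm_diff cinner_self)
  also have "\<dots> \<le> 0"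
    using power_mono[OF contraction_onD(2)[OF contr N.proj_in[of \<i> h]], of 2] norm_proj_codom[OF i_eq h(1)]
    by (simp add: h(2))
  finally have "U ?y = pN (- \<i>) h" by (simp add: h(2))
  then have "?y = 0"
    using h(1) Viso_proj[OF i_eq h(1)] by (intro ker) (auto simp: Lpart_def)
  then have "h = 0" by (rule proj_codom_inj[OF i_eq h(1)])
  then show ?thesis using h(2) by simp
qed

lemma dual: "extension_param (op_neg S) (Uadj S U)"
proof -
  interpret D: regular_op "op_neg S" by (rule regular_op_op_neg)
  show ?thesis
    by unfold_locales (use contr_adj ker_adj in \<open>simp_all add: defect_op_neg Lpart_op_neg Viso_op_neg\<close>)
qed

lemma adjoint_ext: "adjoint_in UNIV T = vn_ext (- \<i>) S {(\<psi>, Uadj S U \<psi>) | \<psi>. \<psi> \<in> defect S (- \<i>)}"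
proof (rule full.adjoint_vn_ext_eqI[symmetric])
  show "(0, 0) \<in> {(\<phi>, U \<phi>) |\<phi>. \<phi> \<in> defect S \<i>}"
    using U_zero cvs.subspace_0[OF N.subspace] by simp
  have "Domain {(\<phi>, U \<phi>) |\<phi>. \<phi> \<in> defect S \<i>} = defect S \<i>" by auto
  then show "closure (Domain {(\<phi>, U \<phi>) |\<phi>. \<phi> \<in> defect S \<i>}) = defect S \<i>" by (simp add: N.closed)
qed (use U_in contraction_onD(1)[OF contr_adj] cinner_adj in auto)

lemma compression_adjoint_ext:
  "compression H0 (adjoint_in UNIV T) = vn_ext (- \<i>) (core_op S) (Us0 S U)"
proof -
  interpret D: extension_param "op_neg S" "Uadj S U" by (rule dual)
  have "adjoint_in UNIV T = op_neg D.T"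
    by (simp add: adjoint_ext op_neg_vn_ext defect_op_neg)
  then show ?thesis
    using D.compression_ext compression_op_neg[of D.T]
    by (simp add: dom_space_op_neg core_op_op_neg U0_op_neg op_neg_vn_ext)
qed

lemma contraction_graph_Us0: "contraction_graph (semidefect S (- \<i>)) (semidefect S \<i>) (Us0 S U)"
  using extension_param.contraction_graph_U0[OF dual] by (simp add: semidefect_op_neg U0_op_neg)

lemma Domain_Us0: "Domain (Us0 S U) = proj (semidefect S (- \<i>)) ` kerU_adj S U"
  by (auto simp: Us0_def)

text \<open>In the identity between \<open>U\<close> and its adjoint, mixed terms vanish by
  orthogonality and the \<open>Lpart\<close> terms agree because the isometry preserves inner
  products; the semi-deficiency terms remain.\<close>

lemma U0_Us0_cinner:
  assumes 1: "(x, y) \<in> U0 S U" and 2: "(a, b) \<in> Us0 S U"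
  shows "cinner y a = cinner x b"
proof -
  interpret D: extension_param "op_neg S" "Uadj S U" by (rule dual)
  obtain \<phi> where \<phi>: "\<phi> \<in> kerU S U" "x = proj (semidefect S \<i>) \<phi>" "y = proj (semidefect S (- \<i>)) (U \<phi>)"
    using 1 by (rule U0E)
  obtain h where h: "h \<in> codom_space S" "\<phi> = x + pN \<i> h" "U \<phi> = y + pN (- \<i>) h"
    using kerU_decomp[OF \<phi>(1)] \<phi>(2,3) by metis
  obtain \<psi> where \<psi>: "\<psi> \<in> kerU_adj S U" "a = proj (semidefect S (- \<i>)) \<psi>" "b = proj (semidefect S \<i>) (Uadj S U \<psi>)"
    using 2 by (auto simp: Us0_def)
  then obtain k where k: "k \<in> codom_space S" "\<psi> = a + pN (- \<i>) k" "Uadj S U \<psi> = b + pN \<i> k"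
    using D.kerU_decomp[of \<psi>] by (auto simp: kerU_op_neg semidefect_op_neg codom_space_op_neg defect_op_neg)
  have mem: "x \<in> semidefect S \<i>" "y \<in> semidefect S (- \<i>)" "a \<in> semidefect S (- \<i>)" "b \<in> semidefect S \<i>"
    by (auto simp: \<phi> \<psi>)
  have zero: "cinner v (pN s l) = 0" "cinner (pN s l) v = 0"
    if "s = \<i> \<or> s = - \<i>" "v \<in> semidefect S s" "l \<in> codom_space S" for s v l
  proof -
    have "pN s l \<in> orth (semidefect S s)"
      using that by (intro Lpart_orth_semidefect[OF that(1)]) (auto simp: Lpart_def)
    then show "cinner v (pN s l) = 0" "cinner (pN s l) v = 0" using that(2) orthD orthD' by blast+
  qed
  have "cinner (y + pN (- \<i>) h) (a + pN (- \<i>) k) = cinner (x + pN \<i> h) (b + pN \<i> k)"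
    using cinner_adj[OF kerU_defect[OF \<phi>(1)], of \<psi>] unfolding h(3) k(2,3) unfolding k(2,3) using h(2) k(2,3) by metis
  then show ?thesis
    using cinner_proj_codom[OF i_eq h(1) k(1)] zero[OF minus_i_eq mem(2) k(1)] zero[OF minus_i_eq mem(3) h(1)]
      zero[OF i_eq mem(1) k(1)] zero[OF i_eq mem(4) h(1)]
    by (simp add: cinner_add_left cinner_add_right)
qed

lemma adjoint_compression_iff:
  "compression H0 (adjoint_in UNIV T) = adjoint_in H0 (compression H0 T) \<longleftrightarrow>
    closure (proj (semidefect S \<i>) ` kerU S U) = semidefect S \<i> \<and>
    proj (semidefect S (- \<i>)) ` kerU_adj S U = semidefect S (- \<i>)"
  unfolding compression_adjoint_ext compression_ext Domain_U0[symmetric] Domain_Us0[symmetric]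
  by (rule core.adjoint_vn_ext_iff[OF core_inj contraction_graph_U0 contraction_graph_Us0 U0_Us0_cinner])

lemma closed_compression_Domain_U0:
  assumes "closed (compression H0 T)" "closure (proj (semidefect S \<i>) ` kerU S U) = semidefect S \<i>"
  shows "proj (semidefect S \<i>) ` kerU S U = semidefect S \<i>"
  unfolding Domain_U0[symmetric]
  by (rule core.Domain_closed_of_closed_vn_ext[OF core_inj contraction_graph_U0
        assms[unfolded compression_ext Domain_U0[symmetric]]])

end

theorem proposition7p1:
  fixes S St :: "('a::complex_hilbert \<times> 'a) set"
    and U :: "'a \<Rightarrow> 'a"
  assumes infinite_dim: "\<not> finite_dim (UNIV :: 'a set)"
    and separable_space: "\<exists>A :: 'a set. countable A \<and> closure A = UNIV"
    and regular: "regular_symmetric S"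
    and non_dense: "closure (Domain S) \<noteq> UNIV"
    and contr: "contraction_on (defect S \<i>) (defect S (- \<i>)) U"
    and ker: "{\<phi> \<in> Lpart S \<i>. U \<phi> - Viso S \<i> \<phi> = 0} = {0}"
    and max_diss: "maximal_dissipative_in UNIV St"
    and ext: "S \<subseteq> St"
    and dom_St: "is_direct_sum (Domain St) (Domain S) ((\<lambda>\<phi>. \<phi> - U \<phi>) ` defect S \<i>)"
    and St_action: "\<forall>(f, g)\<in>S. \<forall>\<phi>\<in>defect S \<i>. (f + (\<phi> - U \<phi>), g + \<i> *\<^sub>C (\<phi> + U \<phi>)) \<in> St"
  shows
    "let H0 = dom_space S; S0 = core_op S;
         N'i = semidefect S \<i>; N'mi = semidefect S (- \<i>);
         Us = Uadj S U; K = kerU S U; Ks = kerU_adj S U;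
         U\<^sub>0 = U0 S U; U\<^sub>s\<^sub>0 = Us0 S U;
         Sts = adjoint_in UNIV St;
         St0 = compression H0 St; Sts0 = compression H0 Sts
     in
     \<comment> \<open>(1)\<close>
     (is_direct_sum (Domain St \<inter> H0) (Domain S) ((\<lambda>\<phi>. \<phi> - U \<phi>) ` K) \<and>
      is_direct_sum (Domain St \<inter> H0) (Domain S) ((\<lambda>\<phi>. proj N'i \<phi> - proj N'mi (U \<phi>)) ` K) \<and>
      is_direct_sum (Domain Sts \<inter> H0) (Domain S) ((\<lambda>\<psi>. \<psi> - Us \<psi>) ` Ks) \<and>
      is_direct_sum (Domain Sts \<inter> H0) (Domain S) ((\<lambda>\<psi>. proj N'mi \<psi> - proj N'i (Us \<psi>)) ` Ks)) \<and>
     \<comment> \<open>(2)\<close>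
     (contraction_graph N'i N'mi U\<^sub>0 \<and> contraction_graph N'mi N'i U\<^sub>s\<^sub>0 \<and>
      is_direct_sum (Domain St0) (Domain S) ((\<lambda>(\<phi>, u). \<phi> - u) ` U\<^sub>0) \<and>
      (\<forall>(f, g)\<in>S0. \<forall>(\<phi>, u)\<in>U\<^sub>0. (f + (\<phi> - u), g + \<i> *\<^sub>C (\<phi> + u)) \<in> St0) \<and>
      is_direct_sum (Domain Sts0) (Domain S) ((\<lambda>(\<psi>, v). \<psi> - v) ` U\<^sub>s\<^sub>0) \<and>
      (\<forall>(f, g)\<in>S0. \<forall>(\<psi>, v)\<in>U\<^sub>s\<^sub>0. (f + (\<psi> - v), g - \<i> *\<^sub>C (\<psi> + v)) \<in> Sts0) \<and>
      (\<forall>(\<phi>, u)\<in>U\<^sub>0. \<forall>(\<psi>, v)\<in>U\<^sub>s\<^sub>0. cinner u \<psi> = cinner \<phi> v)) \<and>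
     \<comment> \<open>(3)\<close>
     ((Domain St \<inter> H0 = Domain S \<longleftrightarrow> K = {0}) \<and>
      (K = {0} \<longleftrightarrow> proj N'i ` K = {0})) \<and>
     \<comment> \<open>(4)\<close>
     ((Domain Sts \<inter> H0 = Domain S \<longleftrightarrow> Ks = {0}) \<and>
      (Ks = {0} \<longleftrightarrow> proj N'mi ` Ks = {0}) \<and>
      (N'i = {0} \<longrightarrow> Domain St \<inter> H0 = Domain S \<and> maximal_symmetric_in H0 St0) \<and>
      (N'mi = {0} \<longrightarrow> Domain Sts \<inter> H0 = Domain S \<and> maximal_symmetric_in H0 Sts0)) \<and>
     \<comment> \<open>(5)\<close>
     (maximal_dissipative_in H0 St0 \<longleftrightarrow> proj N'i ` K = N'i) \<and>
     \<comment> \<open>(6)\<close>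
     (maximal_dissipative_in H0 (op_neg Sts0) \<longleftrightarrow> proj N'mi ` Ks = N'mi) \<and>
     \<comment> \<open>(7)\<close>
     ((proj N'i ` K = N'i \<and> proj N'mi ` Ks = N'mi \<longrightarrow> Sts0 = adjoint_in H0 St0) \<and>
      (closed St0 \<longrightarrow>
        (Sts0 = adjoint_in H0 St0 \<longleftrightarrow> proj N'i ` K = N'i \<and> proj N'mi ` Ks = N'mi)) \<and>
      (Sts0 = adjoint_in H0 St0 \<longleftrightarrow> closure (proj N'i ` K) = N'i \<and> proj N'mi ` Ks = N'mi)) \<and>
     \<comment> \<open>(8)\<close>
     (finite_dim (codom_space S) \<longrightarrow> Sts0 = adjoint_in H0 St0)"
proof -
  have single: "single_valued St"
    using max_diss by (simp add: maximal_dissipative_in_def dissipative_in_def operator_in_def)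
  interpret extension_param S U
  proof
    show "regular_symmetric S" by (rule regular)
    show "contraction_on (defect S \<i>) (defect S (- \<i>)) U" by (rule contr)
    show "\<phi> = 0" if "\<phi> \<in> Lpart S \<i>" "U \<phi> = Viso S \<i> \<phi>" for \<phi>
      using ker that by auto
  qed
  interpret D: extension_param "op_neg S" "Uadj S U" by (rule dual)
  have sub: "T \<subseteq> St"
  proof (rule subrelI)
    fix a b assume "(a, b) \<in> T"
    then obtain f g \<phi> where "(f, g) \<in> S" "\<phi> \<in> defect S \<i>" "a = f + (\<phi> - U \<phi>)" "b = g + \<i> *\<^sub>C (\<phi> + U \<phi>)"
      by (rule extE)
    then show "(a, b) \<in> St" using St_action by blast
  qed
  \<comment> \<open>The domain and the prescribed action determine the graph: \<open>T\<close> is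
    contained in \<open>St\<close>, has the same domain, and \<open>St\<close> is
    single-valued.\<close>
  have St: "St = T"
  proof (rule equalityI[OF subrelI sub])
    fix a b assume ab: "(a, b) \<in> St"
    then have "a \<in> Domain St" by blast
    then obtain f \<phi> where "f \<in> Domain S" "\<phi> \<in> defect S \<i>" "a = f + (\<phi> - U \<phi>)"
      using dom_St unfolding is_direct_sum_def by blast
    then obtain c where c: "(a, c) \<in> T" using extI by blast
    then have "b = c" using ab sub single by (meson single_valuedD subsetD)
    with c show "(a, b) \<in> T" by simp
  qed
  define Sts where "Sts = adjoint_in UNIV St"
  \<comment> \<open>The adjoint is the negative of the extension of -S with parameter U*, so each
    statement about it is the corresponding one in \<open>D\<close>.\<close>
  have Sts: "Sts = op_neg D.T"
    unfolding Sts_def St adjoint_ext op_neg_vn_ext by (simp add: defect_op_neg)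
  note neg = dom_space_op_neg codom_space_op_neg semidefect_op_neg kerU_op_neg U0_op_neg
    core_op_op_neg minus_minus Domain_op_neg
  have DomSts: "Domain D.T = Domain Sts" unfolding Sts by simp
  have Sts0: "compression H0 D.T = op_neg (compression H0 Sts)"
    unfolding Sts compression_op_neg by simp
  have Sts0_eq: "compression H0 Sts = vn_ext (- \<i>) (core_op S) (Us0 S U)"
    unfolding Sts_def St by (rule compression_adjoint_ext)
  have Dom_Sts0: "Domain (compression H0 Sts) = Domain Sts \<inter> H0"
    by (auto simp: compression_def)
  have 1: "is_direct_sum (Domain St \<inter> H0) (Domain S) ((\<lambda>\<phi>. \<phi> - U \<phi>) ` kerU S U)"
    "is_direct_sum (Domain St \<inter> H0) (Domain S)
      ((\<lambda>\<phi>. proj (semidefect S \<i>) \<phi> - proj (semidefect S (- \<i>)) (U \<phi>)) ` kerU S U)"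
    "is_direct_sum (Domain Sts \<inter> H0) (Domain S) ((\<lambda>\<psi>. \<psi> - Uadj S U \<psi>) ` kerU_adj S U)"
    "is_direct_sum (Domain Sts \<inter> H0) (Domain S)
      ((\<lambda>\<psi>. proj (semidefect S (- \<i>)) \<psi> - proj (semidefect S \<i>) (Uadj S U \<psi>)) ` kerU_adj S U)"
    using direct_sum_kerU direct_sum_U0[unfolded image_U0] D.direct_sum_kerU[unfolded DomSts neg]
      D.direct_sum_U0[unfolded D.image_U0, unfolded DomSts neg]
    unfolding St by - (assumption+)
  have 2: "is_direct_sum (Domain (compression H0 St)) (Domain S) ((\<lambda>(\<phi>, u). \<phi> - u) ` U0 S U)"
    "is_direct_sum (Domain (compression H0 Sts)) (Domain S) ((\<lambda>(\<psi>, v). \<psi> - v) ` Us0 S U)"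
    using direct_sum_U0 D.direct_sum_U0[unfolded DomSts neg]
    unfolding St Domain_compression Dom_Sts0 by - (assumption+)
  have 3: "\<forall>(f, g)\<in>core_op S. \<forall>(\<psi>, v)\<in>Us0 S U. (f + (\<psi> - v), g - \<i> *\<^sub>C (\<psi> + v)) \<in> compression H0 Sts"
  proof clarify
    fix f g \<psi> v assume "(f, g) \<in> core_op S" "(\<psi>, v) \<in> Us0 S U"
    from vn_extI[OF this, of "- \<i>"]
    show "(f + (\<psi> - v), g - \<i> *\<^sub>C (\<psi> + v)) \<in> compression H0 Sts" unfolding Sts0_eq by simp
  qed
  have 4: "semidefect S (- \<i>) = {0} \<longrightarrow>
      Domain Sts \<inter> H0 = Domain S \<and> maximal_symmetric_in H0 (compression H0 Sts)"
    using D.semidefect_trivial[unfolded DomSts neg] maximal_symmetric_in_op_neg[OF H0.subspace, of "compression H0 D.T"]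
    unfolding Sts0 by auto
  have 5: "(Domain Sts \<inter> H0 = Domain S) = (kerU_adj S U = {0})"
    "(kerU_adj S U = {0}) = (proj (semidefect S (- \<i>)) ` kerU_adj S U = {0})"
    "maximal_dissipative_in H0 (op_neg (compression H0 Sts)) \<longleftrightarrow>
      proj (semidefect S (- \<i>)) ` kerU_adj S U = semidefect S (- \<i>)"
    "finite_dim (codom_space S) \<Longrightarrow> proj (semidefect S (- \<i>)) ` kerU_adj S U = semidefect S (- \<i>)"
    using D.Domain_trivial_iff[unfolded DomSts neg] D.kerU_trivial_iff[unfolded neg]
      D.maximal_dissipative_compression_iff[unfolded neg Sts0] D.finite_codim_Domain_U0[unfolded neg]
    by blast+
  have 6: "\<forall>(\<phi>, u)\<in>U0 S U. \<forall>(\<psi>, v)\<in>Us0 S U. cinner u \<psi> = cinner \<phi> v"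
    using U0_Us0_cinner by blast
  have 7: "compression H0 Sts = adjoint_in H0 (compression H0 St) \<longleftrightarrow>
    closure (proj (semidefect S \<i>) ` kerU S U) = semidefect S \<i> \<and>
    proj (semidefect S (- \<i>)) ` kerU_adj S U = semidefect S (- \<i>)"
    unfolding Sts_def St by (rule adjoint_compression_iff)
  have cl: "closure (semidefect S \<i>) = semidefect S \<i>" by (simp add: N'.closed)
  \<comment> \<open>Closedness of the compression upgrades the density condition in \<open>7\<close>
    to equality; conversely, equality gives density because the semi-deficiency subspace is
    closed.\<close>
  have 8: "closed (compression H0 St) \<longrightarrow> (compression H0 Sts = adjoint_in H0 (compression H0 St) \<longleftrightarrow>
    proj (semidefect S \<i>) ` kerU S U = semidefect S \<i> \<and>
    proj (semidefect S (- \<i>)) ` kerU_adj S U = semidefect S (- \<i>))"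
    using closed_compression_Domain_U0 cl unfolding 7 unfolding St by metis
  show ?thesis
    unfolding Let_def Sts_def[symmetric]
  proof (intro conjI)
    show "finite_dim (codom_space S) \<longrightarrow> compression H0 Sts = adjoint_in H0 (compression H0 St)"
      unfolding 7 using 5(4) finite_codim_Domain_U0 cl by metis
    show "proj (semidefect S \<i>) ` kerU S U = semidefect S \<i> \<and>
        proj (semidefect S (- \<i>)) ` kerU_adj S U = semidefect S (- \<i>) \<longrightarrow>
        compression H0 Sts = adjoint_in H0 (compression H0 St)"
      unfolding 7 using cl by metis
    show "semidefect S \<i> = {0} \<longrightarrow> Domain St \<inter> H0 = Domain S \<and> maximal_symmetric_in H0 (compression H0 St)"
      unfolding St using semidefect_trivial by blast
    show "maximal_dissipative_in H0 (compression H0 St) \<longleftrightarrow> proj (semidefect S \<i>) ` kerU S U = semidefect S \<i>"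
      unfolding St by (rule maximal_dissipative_compression_iff)
    show "(Domain St \<inter> H0 = Domain S) = (kerU S U = {0})"
      unfolding St by (rule Domain_trivial_iff)
    show "\<forall>(f, g)\<in>core_op S. \<forall>(\<phi>, u)\<in>U0 S U. (f + (\<phi> - u), g + \<i> *\<^sub>C (\<phi> + u)) \<in> compression H0 St"
      unfolding St by (rule compression_action)
  qed (rule 1 2 3 4 5 6 7 8 kerU_trivial_iff contraction_graph_U0 contraction_graph_Us0)+
qed

end
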